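(* Let $F$ be a field of characteristic not $2$, let $A$ be a central simple algebra over $F$ with $\dim_F A = n^2$, and let $\sigma: A \rightarrow A$ be an $F$-linear involution. Then $SL^\sigma(2,A)$ is a linear algebraic group over $F$. More precisely, it is either a symplectic group of dimension $2n^2 + n$ or an orthogonal group of dimension $2n^2 - n$.
   Context: An involution on a ring $R$ is a map $\sigma: R \to R$ with $\sigma(\sigma(x)) = x$, $\sigma(x+y) = \sigma(x)+\sigma(y)$ and $\sigma(xy) = \sigma(y)\sigma(x)$ for all $x,y \in R$. For a ring with involution $(R,\sigma)$ define $\hat{\sigma}: \text{Mat}(2,R) \to \text{Mat}(2,R)$ by $\hat{\sigma}\begin{pmatrix} a & b \\ c & d\end{pmatrix} = \begin{pmatrix} \sigma(d) & -\sigma(b) \\ -\sigma(c) & \sigma(a)\end{pmatrix}$, and $SL^\sigma(2,R) = \{M \in \text{Mat}(2,R) : M\hat{\sigma}(M) = I\}$, a group under matrix multiplication. "Symplectic group" (resp. "orthogonal group") means that after extending scalars to an algebraic closure $\overline{F}$ (so that $\text{Mat}(2, A\otimes_F \overline{F}) \cong \text{Mat}(2n,\overline{F})$), the group becomes the group of invertible matrices preserving a nondegenerate alternating (resp. symmetric) bilinear form on $\overline{F}^{2n}$. *)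

theory Defs
  imports
    "HOL-Analysis.Analysis"
    "HOL-Library.Extended_Nat"
    "HOL-Algebra.Algebraic_Closure_Type"
    "Jordan_Normal_Form.Matrix"
begin

no_notation Matrix.vec_index (infixl "$" 100)
no_notation fps_nth (infixl "$" 75)

section \<open>Central simple algebras, involutions, extension of scalars\<close>

text \<open>
  An algebra over the field \<^typ>\<open>'f\<close> is a unital ring \<^typ>\<open>'a\<close> with a scalar multiplication \<open>s\<close>;
  the class \<^class>\<open>ring_1\<close> includes \<open>0 \<noteq> 1\<close>.  The algebraic closure of \<^typ>\<open>'f\<close> is the type
  \<^typ>\<open>'f alg_closure\<close> with the embedding \<^const>\<open>to_ac\<close>.
\<close>

definition is_algebra :: "('k::field \<Rightarrow> 'a::ring_1 \<Rightarrow> 'a) \<Rightarrow> bool" where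
  "is_algebra s \<longleftrightarrow> vector_space s \<and>
     (\<forall>c x y. s c x * y = s c (x * y) \<and> x * s c y = s c (x * y))"

definition is_basis :: "('k::field \<Rightarrow> 'v::ab_group_add \<Rightarrow> 'v) \<Rightarrow> 'v set \<Rightarrow> bool" where
  "is_basis s B \<longleftrightarrow> \<not> module.dependent s B \<and> module.span s B = UNIV"

definition central_simple_algebra :: "('k::field \<Rightarrow> 'a::ring_1 \<Rightarrow> 'a) \<Rightarrow> bool" where
  "central_simple_algebra s \<longleftrightarrow> is_algebra s \<and>
     (\<exists>B. finite B \<and> is_basis s B) \<and>
     {z. \<forall>x. z * x = x * z} = range (\<lambda>c. s c 1) \<and>
     (\<forall>I. ideal I (ring_of_type_algebra :: 'a ring) \<longrightarrow> I = {0} \<or> I = UNIV)"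

definition ring_involution :: "('r::ring_1 \<Rightarrow> 'r) \<Rightarrow> bool" where
  "ring_involution \<sigma> \<longleftrightarrow>
     (\<forall>x. \<sigma> (\<sigma> x) = x) \<and> (\<forall>x y. \<sigma> (x + y) = \<sigma> x + \<sigma> y) \<and> (\<forall>x y. \<sigma> (x * y) = \<sigma> y * \<sigma> x)"

text \<open>
  \<open>\<iota> : A \<rightarrow> A'\<close> exhibits the algebra \<open>A'\<close> over the algebraic closure as the tensor product of \<open>A\<close>
  with the algebraic closure (with \<open>\<iota> a = a \<otimes> 1\<close>): the map \<open>a \<otimes> c \<mapsto> c \<cdot> \<iota> a\<close> is an
  isomorphism if and only if \<open>\<iota>\<close> carries bases injectively to bases.
\<close>

definition scalar_extension ::
  "('f::field \<Rightarrow> 'a::ring_1 \<Rightarrow> 'a) \<Rightarrow> ('f alg_closure \<Rightarrow> 'b::ring_1 \<Rightarrow> 'b) \<Rightarrow> ('a \<Rightarrow> 'b) \<Rightarrow> bool" where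
  "scalar_extension s s' \<iota> \<longleftrightarrow> is_algebra s \<and> is_algebra s' \<and>
     \<iota> 1 = 1 \<and> (\<forall>x y. \<iota> (x + y) = \<iota> x + \<iota> y) \<and> (\<forall>x y. \<iota> (x * y) = \<iota> x * \<iota> y) \<and>
     (\<forall>c x. \<iota> (s c x) = s' (to_ac c) (\<iota> x)) \<and>
     (\<forall>B. is_basis s B \<longrightarrow> inj_on \<iota> B \<and> is_basis s' (\<iota> ` B))"

section \<open>The group \<open>SL\<^sup>\<sigma>(2,R)\<close>\<close>

definition sigma_hat :: "('r::ring_1 \<Rightarrow> 'r) \<Rightarrow> 'r ^ 2 ^ 2 \<Rightarrow> 'r ^ 2 ^ 2" where
  "sigma_hat \<sigma> M = vector [vector [\<sigma> (M $ 2 $ 2), - \<sigma> (M $ 1 $ 2)],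
                           vector [- \<sigma> (M $ 2 $ 1), \<sigma> (M $ 1 $ 1)]]"

definition SL2 :: "('r::ring_1 \<Rightarrow> 'r) \<Rightarrow> ('r ^ 2 ^ 2) set" where
  "SL2 \<sigma> = {M. M ** sigma_hat \<sigma> M = Finite_Cartesian_Product.mat 1}"

definition SL2_group :: "('r::ring_1 \<Rightarrow> 'r) \<Rightarrow> ('r ^ 2 ^ 2) monoid" where
  "SL2_group \<sigma> = \<lparr>carrier = SL2 \<sigma>, monoid.mult = (**), one = Finite_Cartesian_Product.mat 1\<rparr>"

section \<open>Linear algebraic groups\<close>

text \<open>
  Varieties are closed subsets of a finite-dimensional vector space \<open>W\<close> (type \<^typ>\<open>'w\<close>, scalar
  multiplication \<open>s\<close>) over the algebraic closure of \<open>F\<close>, viewed as an affine space.  Polynomial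
  functions are described without coordinates: they are generated as a ring by constants and
  linear functionals.  An \<open>F\<close>-structure on \<open>W\<close> is the \<open>F\<close>-span \<open>W\<^sub>0\<close> of a basis of \<open>W\<close>; the
  polynomial functions with coefficients in \<open>F\<close> are then generated by the constants in \<open>F\<close>
  and the functionals with values in \<open>F\<close> on \<open>W\<^sub>0\<close>.
\<close>

definition F_structure ::
  "('f::field alg_closure \<Rightarrow> 'w::ab_group_add \<Rightarrow> 'w) \<Rightarrow> 'w set \<Rightarrow> bool" where
  "F_structure s W\<^sub>0 \<longleftrightarrow> vector_space s \<and>
     (\<exists>B. finite B \<and> is_basis s B \<and> W\<^sub>0 = module.span (\<lambda>c. s (to_ac c)) B)"

inductive_set generated_functions :: "'k::comm_ring_1 set \<Rightarrow> ('w \<Rightarrow> 'k) set \<Rightarrow> ('w \<Rightarrow> 'k) set"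
  for C :: "'k set" and L :: "('w \<Rightarrow> 'k) set" where
  const: "c \<in> C \<Longrightarrow> (\<lambda>_. c) \<in> generated_functions C L"
| functional: "l \<in> L \<Longrightarrow> l \<in> generated_functions C L"
| add: "p \<in> generated_functions C L \<Longrightarrow> q \<in> generated_functions C L \<Longrightarrow>
     (\<lambda>x. p x + q x) \<in> generated_functions C L"
| mult: "p \<in> generated_functions C L \<Longrightarrow> q \<in> generated_functions C L \<Longrightarrow>
     (\<lambda>x. p x * q x) \<in> generated_functions C L"

definition functionals :: "('k::field \<Rightarrow> 'w::ab_group_add \<Rightarrow> 'w) \<Rightarrow> ('w \<Rightarrow> 'k) set" where
  "functionals s = {l. Vector_Spaces.linear s (*) l}"

definition F_functionals ::
  "('f::field alg_closure \<Rightarrow> 'w::ab_group_add \<Rightarrow> 'w) \<Rightarrow> 'w set \<Rightarrow> ('w \<Rightarrow> 'f alg_closure) set" where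
  "F_functionals s W\<^sub>0 = {l \<in> functionals s. l ` W\<^sub>0 \<subseteq> range to_ac}"

definition polynomials :: "('k::field \<Rightarrow> 'w::ab_group_add \<Rightarrow> 'w) \<Rightarrow> ('w \<Rightarrow> 'k) set" where
  "polynomials s = generated_functions UNIV (functionals s)"

definition F_polynomials ::
  "('f::field alg_closure \<Rightarrow> 'w::ab_group_add \<Rightarrow> 'w) \<Rightarrow> 'w set \<Rightarrow> ('w \<Rightarrow> 'f alg_closure) set" where
  "F_polynomials s W\<^sub>0 = generated_functions (range to_ac) (F_functionals s W\<^sub>0)"

definition zariski_closed :: "('k::field \<Rightarrow> 'w::ab_group_add \<Rightarrow> 'w) \<Rightarrow> 'w set \<Rightarrow> bool" where
  "zariski_closed s V \<longleftrightarrow> (\<exists>P \<subseteq> polynomials s. V = {x. \<forall>p\<in>P. p x = 0})"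

definition zariski_irreducible :: "('k::field \<Rightarrow> 'w::ab_group_add \<Rightarrow> 'w) \<Rightarrow> 'w set \<Rightarrow> bool" where
  "zariski_irreducible s V \<longleftrightarrow> V \<noteq> {} \<and>
     (\<forall>S T. zariski_closed s S \<longrightarrow> zariski_closed s T \<longrightarrow> V \<subseteq> S \<union> T \<longrightarrow> V \<subseteq> S \<or> V \<subseteq> T)"

text \<open>Krull dimension of the Zariski topology on a closed set.\<close>

definition zariski_dim :: "('k::field \<Rightarrow> 'w::ab_group_add \<Rightarrow> 'w) \<Rightarrow> 'w set \<Rightarrow> enat" where
  "zariski_dim s V = Sup {enat d | d. \<exists>C :: nat \<Rightarrow> 'w set.
     (\<forall>i\<le>d. zariski_closed s (C i) \<and> zariski_irreducible s (C i) \<and> C i \<subseteq> V) \<and>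
     (\<forall>i<d. C i \<subset> C (Suc i))}"

text \<open>
  The vanishing ideal of \<open>V\<close> is generated by polynomials with coefficients in \<open>F\<close>.  Over an
  imperfect field this is stronger than \<open>V\<close> being the zero set of such polynomials.
\<close>

definition defined_over_F ::
  "('f::field alg_closure \<Rightarrow> 'w::ab_group_add \<Rightarrow> 'w) \<Rightarrow> 'w set \<Rightarrow> 'w set \<Rightarrow> bool" where
  "defined_over_F s W\<^sub>0 V \<longleftrightarrow>
     (\<forall>f \<in> polynomials s. (\<forall>x\<in>V. f x = 0) \<longrightarrow>
        (\<exists>(m::nat) h g. (\<forall>i<m. h i \<in> polynomials s \<and> g i \<in> F_polynomials s W\<^sub>0 \<and> (\<forall>x\<in>V. g i x = 0)) \<and>
           f = (\<lambda>x. \<Sum>i<m. h i x * g i x)))"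

text \<open>
  A linear algebraic group over \<open>F\<close>: an affine variety defined over \<open>F\<close> with a group structure
  whose multiplication and inversion are morphisms defined over \<open>F\<close> and whose unit is an
  \<open>F\<close>-rational point.
\<close>

definition linear_algebraic_group ::
  "('f::field alg_closure \<Rightarrow> 'w::ab_group_add \<Rightarrow> 'w) \<Rightarrow> 'w set \<Rightarrow> 'w monoid \<Rightarrow> bool" where
  "linear_algebraic_group s W\<^sub>0 G \<longleftrightarrow>
     F_structure s W\<^sub>0 \<and> group G \<and>
     zariski_closed s (carrier G) \<and> defined_over_F s W\<^sub>0 (carrier G) \<and>
     \<one>\<^bsub>G\<^esub> \<in> W\<^sub>0 \<and>
     (\<forall>l \<in> F_functionals s W\<^sub>0. \<exists>p \<in> F_polynomials (\<lambda>c (x, y). (s c x, s c y)) (W\<^sub>0 \<times> W\<^sub>0).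
        \<forall>x \<in> carrier G. \<forall>y \<in> carrier G. l (x \<otimes>\<^bsub>G\<^esub> y) = p (x, y)) \<and>
     (\<forall>l \<in> F_functionals s W\<^sub>0. \<exists>p \<in> F_polynomials s W\<^sub>0.
        \<forall>x \<in> carrier G. l (inv\<^bsub>G\<^esub> x) = p x)"

section \<open>Symplectic and orthogonal groups\<close>

definition bilinear_form :: "nat \<Rightarrow> ('k::field Matrix.vec \<Rightarrow> 'k Matrix.vec \<Rightarrow> 'k) \<Rightarrow> bool" where
  "bilinear_form N b \<longleftrightarrow>
     (\<forall>u\<in>carrier_vec N. \<forall>v\<in>carrier_vec N. \<forall>w\<in>carrier_vec N. \<forall>c.
        b (u + v) w = b u w + b v w \<and> b w (u + v) = b w u + b w v \<and>
        b (c \<cdot>\<^sub>v u) v = c * b u v \<and> b u (c \<cdot>\<^sub>v v) = c * b u v)"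

definition nondegenerate_form :: "nat \<Rightarrow> ('k::field Matrix.vec \<Rightarrow> 'k Matrix.vec \<Rightarrow> 'k) \<Rightarrow> bool" where
  "nondegenerate_form N b \<longleftrightarrow>
     (\<forall>v\<in>carrier_vec N. (\<forall>w\<in>carrier_vec N. b v w = 0) \<longrightarrow> v = 0\<^sub>v N)"

definition alternating_form :: "nat \<Rightarrow> ('k::field Matrix.vec \<Rightarrow> 'k Matrix.vec \<Rightarrow> 'k) \<Rightarrow> bool" where
  "alternating_form N b \<longleftrightarrow> (\<forall>v\<in>carrier_vec N. b v v = 0)"

definition symmetric_form :: "nat \<Rightarrow> ('k::field Matrix.vec \<Rightarrow> 'k Matrix.vec \<Rightarrow> 'k) \<Rightarrow> bool" where
  "symmetric_form N b \<longleftrightarrow> (\<forall>v\<in>carrier_vec N. \<forall>w\<in>carrier_vec N. b v w = b w v)"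

definition isometry_group ::
  "nat \<Rightarrow> ('k::field Matrix.vec \<Rightarrow> 'k Matrix.vec \<Rightarrow> 'k) \<Rightarrow> 'k Matrix.mat set" where
  "isometry_group N b = {g \<in> carrier_mat N N. invertible_mat g \<and>
     (\<forall>v\<in>carrier_vec N. \<forall>w\<in>carrier_vec N. b (g *\<^sub>v v) (g *\<^sub>v w) = b v w)}"

definition matrix_algebra_iso ::
  "('k::field \<Rightarrow> 'b::ring_1 \<Rightarrow> 'b) \<Rightarrow> nat \<Rightarrow> ('b ^ 2 ^ 2 \<Rightarrow> 'k Matrix.mat) \<Rightarrow> bool" where
  "matrix_algebra_iso s N \<Phi> \<longleftrightarrow> bij_betw \<Phi> UNIV (carrier_mat N N) \<and>
     \<Phi> (Finite_Cartesian_Product.mat 1) = 1\<^sub>m N \<and>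
     (\<forall>x y. \<Phi> (x + y) = \<Phi> x + \<Phi> y) \<and> (\<forall>x y. \<Phi> (x ** y) = \<Phi> x * \<Phi> y) \<and>
     (\<forall>c x. \<Phi> (map_matrix (s c) x) = c \<cdot>\<^sub>m \<Phi> x)"

definition is_symplectic_group ::
  "('k::field \<Rightarrow> 'b::ring_1 \<Rightarrow> 'b) \<Rightarrow> nat \<Rightarrow> ('b ^ 2 ^ 2) set \<Rightarrow> bool" where
  "is_symplectic_group s N S \<longleftrightarrow> (\<exists>\<Phi> b. matrix_algebra_iso s N \<Phi> \<and>
     bilinear_form N b \<and> nondegenerate_form N b \<and> alternating_form N b \<and>
     \<Phi> ` S = isometry_group N b)"

definition is_orthogonal_group ::
  "('k::field \<Rightarrow> 'b::ring_1 \<Rightarrow> 'b) \<Rightarrow> nat \<Rightarrow> ('b ^ 2 ^ 2) set \<Rightarrow> bool" where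
  "is_orthogonal_group s N S \<longleftrightarrow> (\<exists>\<Phi> b. matrix_algebra_iso s N \<Phi> \<and>
     bilinear_form N b \<and> nondegenerate_form N b \<and> symmetric_form N b \<and>
     \<Phi> ` S = isometry_group N b)"

end

theory Submission
  imports Defs "Jordan_Normal_Form.Determinant"
begin

text \<open>
  Over the algebraic closure \<open>K\<close> the algebra becomes \<open>Mat(n, K)\<close> by Wedderburn's theorem, so \<open>\<sigma>\<close>-hat
  becomes an involution \<open>\<tau>\<close> of \<open>Mat(2n, K)\<close>. By the Skolem--Noether argument
  \<open>\<tau> x = g\<inverse> x\<^sup>T g\<close> with \<open>g\<^sup>T = \<plusminus> g\<close>, so that the group \<open>x \<tau> x = 1\<close> is the isometry group of \<open>g\<close>.
  The Cayley transform is a birational map from the \<open>\<tau>\<close>-skew matrices to this group. It gives the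
  dimension, and it shows that the entries of \<open>x \<tau> x - 1\<close> generate the full vanishing ideal; for
  the passage from a generic denominator to \<open>1\<close> the group is translated and the Nullstellensatz is
  applied. As these equations have coefficients in \<open>F\<close>, the group is defined over \<open>F\<close>.
\<close>

no_notation Matrix.vec_index (infixl "$" 100)

section \<open>Rings of functions and their ideals\<close>

text \<open>The definition of a linear algebraic group asks that the vanishing ideal, not merely the
  zero set, be generated over \<open>F\<close>, so the coordinate ring defined by
  \<open>x \<tau> x = 1\<close> has to be shown reduced; the invertibility of \<open>2\<close>
  enters here. One Cayley chart is not enough: its denominator \<open>det (1 + x)\<close> is zero at
  \<open>-1\<close>, and at every isometry of determinant \<open>-1\<close> of a symmetric form,
  because the inverse of \<open>x\<close> is conjugate to the transpose of \<open>x\<close>.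
  Multiplying the chart by a group element \<open>x0\<close> moves its centre from \<open>1\<close>
  to \<open>x0\<close>, where the denominator is a power of \<open>2\<close>. Adjugates replace
  inverses, so that everything stays polynomial. Polynomials are treated as functions, which loses
  nothing over an infinite field. The upper bound of the dimension is a count: a chain of
  irreducible closed sets of length \<open>d\<close> yields \<open>d\<close> algebraically
  independent functions, and for \<open>d > D\<close> their \<open>(t + 1) ^ d\<close> monomials do
  not fit into the span of the \<open>(c t + 1) ^ D\<close> monomials in \<open>D\<close> variables
  when \<open>t\<close> is large.\<close>

locale function_ring =
  fixes R :: "('x \<Rightarrow> 'k::comm_ring_1) set"
  assumes const [intro]: "(\<lambda>_. c) \<in> R"
    and add [intro]: "p \<in> R \<Longrightarrow> q \<in> R \<Longrightarrow> (\<lambda>x. p x + q x) \<in> R"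
    and mult [intro]: "p \<in> R \<Longrightarrow> q \<in> R \<Longrightarrow> (\<lambda>x. p x * q x) \<in> R"
begin

lemma uminus: "p \<in> R \<Longrightarrow> (\<lambda>x. - p x) \<in> R"
  using mult[OF const[of "-1"], of p] by simp

lemma diff: "p \<in> R \<Longrightarrow> q \<in> R \<Longrightarrow> (\<lambda>x. p x - q x) \<in> R"
  using add[OF _ uminus, of p q] by simp

lemma sum: "(\<And>i. i \<in> I \<Longrightarrow> p i \<in> R) \<Longrightarrow> (\<lambda>x. \<Sum>i\<in>I. p i x) \<in> R"
  by (induction I rule: infinite_finite_induct) auto

lemma prod: "(\<And>i. i \<in> I \<Longrightarrow> p i \<in> R) \<Longrightarrow> (\<lambda>x. \<Prod>i\<in>I. p i x) \<in> R"
  by (induction I rule: infinite_finite_induct) auto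

lemma power: "p \<in> R \<Longrightarrow> (\<lambda>x. p x ^ k) \<in> R"
  by (induction k) auto

lemma generated_functions_subset:
  assumes "L \<subseteq> R"
  shows "generated_functions C L \<subseteq> R"
proof
  fix f assume "f \<in> generated_functions C L"
  then show "f \<in> R" by induction (use assms in auto)
qed

lemma det:
  assumes "\<And>x. M x \<in> carrier_mat n n"
    and "\<And>i j. i < n \<Longrightarrow> j < n \<Longrightarrow> (\<lambda>x. M x $$ (i, j)) \<in> R"
  shows "(\<lambda>x. Determinant.det (M x)) \<in> R"
proof -
  have "(\<lambda>x. Determinant.det (M x)) =
    (\<lambda>x. \<Sum>p\<in>{p. p permutes {0..<n}}. signof p * (\<Prod>i = 0..<n. M x $$ (i, p i)))"
    using assms(1) by (intro ext) (simp add: Determinant.det_def'[of _ n])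
  also have "\<dots> \<in> R"
    by (intro sum mult const prod assms(2)) (auto dest: permutes_in_image)
  finally show ?thesis .
qed

end

lemma function_ring_generated [intro!]: "function_ring (generated_functions UNIV L)"
  by unfold_locales (auto intro: generated_functions.intros)

section \<open>Matrices with entries in a ring of functions\<close>

definition matrix_over :: "('x \<Rightarrow> 'k::comm_ring_1) set \<Rightarrow> nat \<Rightarrow> ('x \<Rightarrow> 'k Matrix.mat) \<Rightarrow> bool" where
  "matrix_over R n M \<longleftrightarrow> (\<forall>x. M x \<in> carrier_mat n n) \<and> (\<forall>i<n. \<forall>j<n. (\<lambda>x. M x $$ (i, j)) \<in> R)"

lemma matrix_over_carrier:
  assumes "matrix_over R n M"
  shows "M x \<in> carrier_mat n n" "dim_row (M x) = n" "dim_col (M x) = n"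
  using assms by (auto simp: matrix_over_def dest: spec[of _ x])

context function_ring
begin

lemma matrix_over_det: "matrix_over R n M \<Longrightarrow> (\<lambda>x. Determinant.det (M x)) \<in> R"
  by (rule det[of _ n]) (auto simp: matrix_over_def)

lemma matrix_over_const: "A \<in> carrier_mat n n \<Longrightarrow> matrix_over R n (\<lambda>_. A)"
  by (auto simp: matrix_over_def)

lemma matrix_over_add:
  assumes M: "matrix_over R n M" and M': "matrix_over R n M'"
  shows "matrix_over R n (\<lambda>x. M x + M' x)"
  using M M' matrix_over_carrier[OF M] matrix_over_carrier[OF M']
  by (auto simp: matrix_over_def index_add_mat(1) intro!: add)

lemma matrix_over_diff:
  assumes M: "matrix_over R n M" and M': "matrix_over R n M'"
  shows "matrix_over R n (\<lambda>x. M x - M' x)"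
  using M M' matrix_over_carrier[OF M] matrix_over_carrier[OF M']
  by (auto simp: matrix_over_def index_minus_mat(1) intro!: diff minus_carrier_mat)

lemma matrix_over_mult:
  assumes M: "matrix_over R n M" and M': "matrix_over R n M'"
  shows "matrix_over R n (\<lambda>x. M x * M' x)"
proof -
  have "(\<lambda>x. (M x * M' x) $$ (i, j)) \<in> R" if "i < n" "j < n" for i j
  proof -
    have "(\<lambda>x. (M x * M' x) $$ (i, j)) = (\<lambda>x. \<Sum>k\<in>{0..<n}. M x $$ (i, k) * M' x $$ (k, j))"
      using that matrix_over_carrier[OF M] matrix_over_carrier[OF M']
      by (intro ext) (simp add: scalar_prod_def)
    also have "\<dots> \<in> R" using M M' that by (intro sum mult) (auto simp: matrix_over_def)
    finally show ?thesis .
  qed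
  then show ?thesis
    using mult_carrier_mat[OF matrix_over_carrier(1)[OF M] matrix_over_carrier(1)[OF M']]
    by (auto simp: matrix_over_def)
qed

lemma matrix_over_mat_delete:
  assumes M: "matrix_over R (Suc n) M" and "i < Suc n" "j < Suc n"
  shows "matrix_over R n (\<lambda>x. mat_delete (M x) i j)"
  using M mat_delete_index[OF matrix_over_carrier(1)[OF M] assms(2,3), symmetric]
    mat_delete_carrier[OF matrix_over_carrier(1)[OF M], of _ i j] assms(2,3)
  by (auto simp: matrix_over_def insert_index_def)

lemma matrix_over_cofactor:
  assumes M: "matrix_over R n M" and "i < n" "j < n"
  shows "(\<lambda>x. cofactor (M x) i j) \<in> R"
proof -
  obtain m where n: "n = Suc m" using assms by (cases n) auto
  show ?thesis
    using matrix_over_mat_delete[of m M i j] assms unfolding cofactor_def n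
    by (intro mult const matrix_over_det) auto
qed

lemma matrix_over_adj:
  assumes M: "matrix_over R n M"
  shows "matrix_over R n (\<lambda>x. adj_mat (M x))"
proof -
  have "(\<lambda>x. adj_mat (M x) $$ (i, j)) \<in> R" if "i < n" "j < n" for i j
  proof -
    have "(\<lambda>x. adj_mat (M x) $$ (i, j)) = (\<lambda>x. cofactor (M x) j i)"
      using that matrix_over_carrier[OF M] by (intro ext) (simp add: adj_mat_def)
    then show ?thesis using matrix_over_cofactor[OF M] that by simp
  qed
  then show ?thesis using adj_mat(1)[OF matrix_over_carrier(1)[OF M]] by (auto simp: matrix_over_def)
qed

end

section \<open>Congruence modulo an ideal of functions\<close>

locale function_ideal = function_ring R for R :: "('x \<Rightarrow> 'k::comm_ring_1) set" +
  fixes J :: "('x \<Rightarrow> 'k) set"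
  assumes ideal_subset: "J \<subseteq> R"
    and ideal_zero: "(\<lambda>_. 0) \<in> J"
    and ideal_add: "p \<in> J \<Longrightarrow> q \<in> J \<Longrightarrow> (\<lambda>x. p x + q x) \<in> J"
    and ideal_mult: "r \<in> R \<Longrightarrow> p \<in> J \<Longrightarrow> (\<lambda>x. r x * p x) \<in> J"
begin

text \<open>Membership of both sides in \<open>R\<close> is built in, so that congruences can be
  multiplied without side conditions.\<close>

definition congr :: "('x \<Rightarrow> 'k) \<Rightarrow> ('x \<Rightarrow> 'k) \<Rightarrow> bool" where
  "congr p q \<longleftrightarrow> p \<in> R \<and> q \<in> R \<and> (\<lambda>x. p x - q x) \<in> J"

lemma ideal_sum: "(\<And>i. i \<in> I \<Longrightarrow> p i \<in> J) \<Longrightarrow> (\<lambda>x. \<Sum>i\<in>I. p i x) \<in> J"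
  by (induction I rule: infinite_finite_induct) (auto intro: ideal_zero ideal_add)

lemma congr_refl: "p \<in> R \<Longrightarrow> congr p p"
  by (simp add: congr_def ideal_zero)

lemma congr_sym: "congr p q \<Longrightarrow> congr q p"
  using ideal_mult[OF const[of "-1"], of "\<lambda>x. p x - q x"] by (simp add: congr_def)

lemma congr_trans: "congr p q \<Longrightarrow> congr q r \<Longrightarrow> congr p r"
  using ideal_add[of "\<lambda>x. p x - q x" "\<lambda>x. q x - r x"] by (simp add: congr_def)

lemma congr_add: "congr p p' \<Longrightarrow> congr q q' \<Longrightarrow> congr (\<lambda>x. p x + q x) (\<lambda>x. p' x + q' x)"
  using ideal_add[of "\<lambda>x. p x - p' x" "\<lambda>x. q x - q' x"]
  by (auto simp: congr_def algebra_simps)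

lemma congr_mult: "congr p p' \<Longrightarrow> congr q q' \<Longrightarrow> congr (\<lambda>x. p x * q x) (\<lambda>x. p' x * q' x)"
  using ideal_add[OF ideal_mult[of p "\<lambda>x. q x - q' x"] ideal_mult[of q' "\<lambda>x. p x - p' x"]]
  by (auto simp: congr_def algebra_simps)

lemma congr_uminus: "congr p p' \<Longrightarrow> congr (\<lambda>x. - p x) (\<lambda>x. - p' x)"
  using congr_mult[OF congr_refl[OF const[of "-1"]], of p p'] by simp

lemma congr_diff: "congr p p' \<Longrightarrow> congr q q' \<Longrightarrow> congr (\<lambda>x. p x - q x) (\<lambda>x. p' x - q' x)"
  using congr_add[OF _ congr_uminus, of p p' q q'] by simp

lemma congr_sum: "(\<And>i. i \<in> I \<Longrightarrow> congr (p i) (q i)) \<Longrightarrow> congr (\<lambda>x. \<Sum>i\<in>I. p i x) (\<lambda>x. \<Sum>i\<in>I. q i x)"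
  by (induction I rule: infinite_finite_induct) (auto intro: congr_add congr_refl)

lemma congr_prod: "(\<And>i. i \<in> I \<Longrightarrow> congr (p i) (q i)) \<Longrightarrow> congr (\<lambda>x. \<Prod>i\<in>I. p i x) (\<lambda>x. \<Prod>i\<in>I. q i x)"
  by (induction I rule: infinite_finite_induct) (auto intro: congr_mult congr_refl)

lemma congr_power: "congr p q \<Longrightarrow> congr (\<lambda>x. p x ^ k) (\<lambda>x. q x ^ k)"
  by (induction k) (auto intro: congr_mult congr_refl)

lemma congr_ideal: "congr p q \<Longrightarrow> p \<in> J \<Longrightarrow> q \<in> J"
  using ideal_add[of p "\<lambda>x. q x - p x"] congr_sym[of p q] by (simp add: congr_def)

definition mcongr :: "nat \<Rightarrow> ('x \<Rightarrow> 'k Matrix.mat) \<Rightarrow> ('x \<Rightarrow> 'k Matrix.mat) \<Rightarrow> bool" where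
  "mcongr n M M' \<longleftrightarrow> (\<forall>x. M x \<in> carrier_mat n n) \<and> (\<forall>x. M' x \<in> carrier_mat n n) \<and>
     (\<forall>i<n. \<forall>j<n. congr (\<lambda>x. M x $$ (i, j)) (\<lambda>x. M' x $$ (i, j)))"

lemma mcongr_carrier:
  assumes "mcongr n M M'"
  shows "M x \<in> carrier_mat n n" "M' x \<in> carrier_mat n n"
    "dim_row (M x) = n" "dim_row (M' x) = n" "dim_col (M x) = n" "dim_col (M' x) = n"
  using assms by (auto simp: mcongr_def dest: spec[of _ x])

lemma mcongr_refl: "matrix_over R n M \<Longrightarrow> mcongr n M M"
  by (simp add: mcongr_def matrix_over_def congr_refl)

lemma mcongr_trans: "mcongr n M M' \<Longrightarrow> mcongr n M' M'' \<Longrightarrow> mcongr n M M''"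
  by (simp add: mcongr_def) (meson congr_trans)

lemma mcongr_add:
  assumes M: "mcongr n M M'" and L: "mcongr n L L'"
  shows "mcongr n (\<lambda>x. M x + L x) (\<lambda>x. M' x + L' x)"
  using M L mcongr_carrier[OF M] mcongr_carrier[OF L]
  by (auto simp: mcongr_def index_add_mat(1) intro!: congr_add)

lemma mcongr_diff:
  assumes M: "mcongr n M M'" and L: "mcongr n L L'"
  shows "mcongr n (\<lambda>x. M x - L x) (\<lambda>x. M' x - L' x)"
  using M L mcongr_carrier[OF M] mcongr_carrier[OF L]
  by (auto simp: mcongr_def index_minus_mat(1) intro!: congr_diff minus_carrier_mat)

lemma mcongr_smult:
  assumes M: "mcongr n M M'" and c: "congr c c'"
  shows "mcongr n (\<lambda>x. c x \<cdot>\<^sub>m M x) (\<lambda>x. c' x \<cdot>\<^sub>m M' x)"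
  using M c mcongr_carrier[OF M] by (auto simp: mcongr_def intro!: congr_mult)

lemma mcongr_mult:
  assumes M: "mcongr n M M'" and L: "mcongr n L L'"
  shows "mcongr n (\<lambda>x. M x * L x) (\<lambda>x. M' x * L' x)"
proof -
  have "congr (\<lambda>x. (M x * L x) $$ (i, j)) (\<lambda>x. (M' x * L' x) $$ (i, j))" if "i < n" "j < n" for i j
  proof -
    have "(\<lambda>x. (M x * L x) $$ (i, j)) = (\<lambda>x. \<Sum>k\<in>{0..<n}. M x $$ (i, k) * L x $$ (k, j))"
         "(\<lambda>x. (M' x * L' x) $$ (i, j)) = (\<lambda>x. \<Sum>k\<in>{0..<n}. M' x $$ (i, k) * L' x $$ (k, j))"
      using that mcongr_carrier[OF M] mcongr_carrier[OF L]
      by (auto simp: scalar_prod_def)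
    then show ?thesis using M L that
      by (auto simp: mcongr_def intro!: congr_sum congr_mult)
  qed
  then show ?thesis
    using mcongr_carrier[OF M] mcongr_carrier[OF L] by (auto simp: mcongr_def)
qed

lemma mcongr_det:
  assumes M: "mcongr n M M'"
  shows "congr (\<lambda>x. Determinant.det (M x)) (\<lambda>x. Determinant.det (M' x))"
proof -
  have *: "(\<lambda>x. Determinant.det (L x)) =
    (\<lambda>x. \<Sum>p\<in>{p. p permutes {0..<n}}. signof p * (\<Prod>i = 0..<n. L x $$ (i, p i)))"
    if "\<And>x. L x \<in> carrier_mat n n" for L :: "'x \<Rightarrow> 'k Matrix.mat"
    using that by (intro ext) (simp add: Determinant.det_def'[of _ n])
  show ?thesis
    unfolding *[OF mcongr_carrier(1)[OF M]] *[OF mcongr_carrier(2)[OF M]]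
    using M by (intro congr_sum congr_mult congr_refl const congr_prod)
      (auto simp: mcongr_def dest: permutes_in_image)
qed

text \<open>Inverses need not have entries in \<open>R\<close>; the entries of the adjugate are
  signed minors, hence polynomial in the entries of the matrix, and respect congruence.\<close>

lemma mcongr_adj:
  assumes M: "mcongr n M M'"
  shows "mcongr n (\<lambda>x. adj_mat (M x)) (\<lambda>x. adj_mat (M' x))"
proof -
  have "congr (\<lambda>x. adj_mat (M x) $$ (i, j)) (\<lambda>x. adj_mat (M' x) $$ (i, j))" if "i < n" "j < n" for i j
  proof -
    obtain m where n: "n = Suc m" using \<open>i < n\<close> by (cases n) auto
    have M2: "mcongr m (\<lambda>x. mat_delete (M x) j i) (\<lambda>x. mat_delete (M' x) j i)"
      using M that mat_delete_index[OF mcongr_carrier(1)[OF M[unfolded n]], of j i, symmetric]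
        mat_delete_index[OF mcongr_carrier(2)[OF M[unfolded n]], of j i, symmetric]
        mat_delete_carrier[OF mcongr_carrier(1)[OF M], of _ j i]
        mat_delete_carrier[OF mcongr_carrier(2)[OF M], of _ j i] unfolding n
      by (auto simp: mcongr_def insert_index_def)
    have "(\<lambda>x. adj_mat (M x) $$ (i, j)) = (\<lambda>x. (-1) ^ (j + i) * Determinant.det (mat_delete (M x) j i))"
      "(\<lambda>x. adj_mat (M' x) $$ (i, j)) = (\<lambda>x. (-1) ^ (j + i) * Determinant.det (mat_delete (M' x) j i))"
      using that mcongr_carrier[OF M] by (auto simp: adj_mat_def cofactor_def)
    then show ?thesis by (auto intro!: congr_mult congr_refl mcongr_det[OF M2])
  qed
  then show ?thesis
    using adj_mat(1)[OF mcongr_carrier(1)[OF M]] adj_mat(1)[OF mcongr_carrier(2)[OF M]]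
    by (auto simp: mcongr_def)
qed

text \<open>Substituting the rational map \<open>Y / \<Delta>\<close> into a polynomial and clearing denominators, while
  remembering that modulo \<open>J\<close> this map is \<open>Z\<close>.\<close>

lemma substitute_fraction:
  fixes L :: "('w \<Rightarrow> 'k) set"
  assumes f: "f \<in> generated_functions C L" and \<Delta>: "\<Delta> \<in> R"
    and Q: "\<And>l x. l \<in> L \<Longrightarrow> U x \<Longrightarrow> \<Delta> x * l (Q x) = l (Y x)"
    and Y: "\<And>l. l \<in> L \<Longrightarrow> congr (\<lambda>x. l (Y x)) (\<lambda>x. \<Delta> x * l (Z x))"
    and Z: "\<And>l. l \<in> L \<Longrightarrow> (\<lambda>x. l (Z x)) \<in> R"
  shows "\<exists>e p. (\<forall>x. U x \<longrightarrow> p x = \<Delta> x ^ e * f (Q x)) \<and> congr p (\<lambda>x. \<Delta> x ^ e * f (Z x)) \<and>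
    (\<lambda>x. f (Z x)) \<in> R"
  using f
proof induction
  case (const c)
  show ?case by (rule exI[of _ 0], rule exI[of _ "\<lambda>_. c"]) (auto intro: congr_refl)
next
  case (functional l)
  show ?case by (rule exI[of _ 1], rule exI[of _ "\<lambda>x. l (Y x)"]) (use functional Q Y Z in auto)
next
  case (add f1 f2)
  then obtain e1 p1 e2 p2 where
    1: "\<forall>x. U x \<longrightarrow> p1 x = \<Delta> x ^ e1 * f1 (Q x)" "congr p1 (\<lambda>x. \<Delta> x ^ e1 * f1 (Z x))" "(\<lambda>x. f1 (Z x)) \<in> R" and
    2: "\<forall>x. U x \<longrightarrow> p2 x = \<Delta> x ^ e2 * f2 (Q x)" "congr p2 (\<lambda>x. \<Delta> x ^ e2 * f2 (Z x))" "(\<lambda>x. f2 (Z x)) \<in> R"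
    by blast
  \<comment> \<open>Common denominator: each summand is multiplied by the power of
    \<open>\<Delta>\<close> that belongs to the other one.\<close>
  have "congr (\<lambda>x. \<Delta> x ^ e2 * p1 x + \<Delta> x ^ e1 * p2 x)
    (\<lambda>x. \<Delta> x ^ e2 * (\<Delta> x ^ e1 * f1 (Z x)) + \<Delta> x ^ e1 * (\<Delta> x ^ e2 * f2 (Z x)))"
    by (intro congr_add congr_mult 1 2 congr_refl power \<Delta>)
  then show ?case
    by (intro exI[of _ "e1 + e2"] exI[of _ "\<lambda>x. \<Delta> x ^ e2 * p1 x + \<Delta> x ^ e1 * p2 x"])
      (use 1 2 in \<open>auto simp: power_add algebra_simps\<close>)
next
  case (mult f1 f2)
  then obtain e1 p1 e2 p2 where
    1: "\<forall>x. U x \<longrightarrow> p1 x = \<Delta> x ^ e1 * f1 (Q x)" "congr p1 (\<lambda>x. \<Delta> x ^ e1 * f1 (Z x))" "(\<lambda>x. f1 (Z x)) \<in> R" and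
    2: "\<forall>x. U x \<longrightarrow> p2 x = \<Delta> x ^ e2 * f2 (Q x)" "congr p2 (\<lambda>x. \<Delta> x ^ e2 * f2 (Z x))" "(\<lambda>x. f2 (Z x)) \<in> R"
    by blast
  have "congr (\<lambda>x. p1 x * p2 x)
    (\<lambda>x. (\<Delta> x ^ e1 * f1 (Z x)) * (\<Delta> x ^ e2 * f2 (Z x)))"
    by (intro congr_mult 1 2)
  then show ?case
    by (intro exI[of _ "e1 + e2"] exI[of _ "\<lambda>x. p1 x * p2 x"])
      (use 1 2 in \<open>auto simp: power_add algebra_simps\<close>)
qed

end

section \<open>Hilbert's Nullstellensatz\<close>

text \<open>Over a finite field, \<open>1\<close> plus the product of all \<open>X - a\<close> has
  no root.\<close>

lemma infinite_alg_closed_field: "infinite (UNIV :: 'k::alg_closed_field set)"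
proof
  assume fin: "finite (UNIV :: 'k set)"
  define q :: "'k poly" where "q = (\<Prod>a\<in>UNIV. [:-a, 1:])"
  have "Polynomial.degree q = card (UNIV :: 'k set)"
    unfolding q_def by (subst degree_prod_eq_sum_degree) auto
  then have "Polynomial.degree (q + 1) > 0" using fin
    by (metis UNIV_not_empty card_gt_0_iff degree_1 degree_add_eq_left)
  then obtain x where "poly (q + 1) x = 0" using alg_closed_imp_poly_has_root by blast
  moreover have "poly q x = 0" unfolding q_def poly_prod using fin by (auto intro!: prod_zero)
  ultimately show False by simp
qed

lemma poly_all_zero:
  fixes p :: "'k::alg_closed_field poly"
  assumes "\<And>t. poly p t = 0"
  shows "p = 0"
  using poly_roots_finite[of p] infinite_alg_closed_field[where 'k = 'k] assms by auto

lemma generated_along_curve: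
  fixes f :: "'w \<Rightarrow> 'k::comm_ring_1"
  assumes "f \<in> generated_functions C L" and "\<And>l. l \<in> L \<Longrightarrow> \<exists>q. \<forall>t. l (\<gamma> t) = poly q t"
  shows "\<exists>q. \<forall>t. f (\<gamma> t) = poly q t"
  using assms(1)
proof induction
  case (const c)
  show ?case by (rule exI[of _ "[:c:]"]) simp
next
  case (add p q)
  then obtain p' q' where "\<forall>t. p (\<gamma> t) = poly p' t" "\<forall>t. q (\<gamma> t) = poly q' t" by blast
  then show ?case by (intro exI[of _ "p' + q'"]) simp
next
  case (mult p q)
  then obtain p' q' where "\<forall>t. p (\<gamma> t) = poly p' t" "\<forall>t. q (\<gamma> t) = poly q' t" by blast
  then show ?case by (intro exI[of _ "p' * q'"]) simp
qed (use assms(2) in blast)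

text \<open>Restricted to the curve, both functions are nonzero polynomials in one variable, so
  their product has a non-root. With lines as curves this shows that two nonempty open conditions on
  a linear space can be met together.\<close>

lemma common_nonzero_on_curve:
  fixes f g :: "'w \<Rightarrow> 'k::alg_closed_field"
  assumes "f \<in> generated_functions C L" "g \<in> generated_functions C L"
    and "\<And>l. l \<in> L \<Longrightarrow> \<exists>q. \<forall>t. l (\<gamma> t) = poly q t"
    and "f (\<gamma> a) \<noteq> 0" "g (\<gamma> b) \<noteq> 0"
  shows "\<exists>t. f (\<gamma> t) \<noteq> 0 \<and> g (\<gamma> t) \<noteq> 0"
proof -
  obtain p where p: "\<forall>t. f (\<gamma> t) = poly p t"
    using generated_along_curve[OF assms(1), of \<gamma>] assms(3) by blast
  obtain q where q: "\<forall>t. g (\<gamma> t) = poly q t"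
    using generated_along_curve[OF assms(2), of \<gamma>] assms(3) by blast
  have "p * q \<noteq> 0" using assms(4,5) p q by auto
  then obtain t where "poly (p * q) t \<noteq> 0" using poly_all_zero by blast
  then show ?thesis using p q by auto
qed

section \<open>Polynomial functions in finitely many variables\<close>

text \<open>Points are sequences on all of \<open>nat\<close>, so the functions of \<open>m\<close>
  variables are among those of \<open>m + 1\<close> variables, and an induction on \<open>m\<close>
  stays in one ambient space.\<close>

definition poly_fun :: "nat \<Rightarrow> ((nat \<Rightarrow> 'k::comm_ring_1) \<Rightarrow> 'k) set" where
  "poly_fun m = generated_functions UNIV {\<lambda>x. x i |i. i < m}"

lemma function_ring_poly_fun [intro!]: "function_ring (poly_fun m)"
  unfolding poly_fun_def by blast

interpretation PF: function_ring "poly_fun m" for m by blast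

lemma poly_fun_var: "i < m \<Longrightarrow> (\<lambda>x. x i) \<in> poly_fun m"
  unfolding poly_fun_def by (rule generated_functions.functional) auto

lemma poly_fun_mono: "m \<le> n \<Longrightarrow> poly_fun m \<subseteq> poly_fun n"
  unfolding poly_fun_def[of m]
  by (rule PF.generated_functions_subset) (auto intro!: poly_fun_var)

lemma poly_fun_fun_upd: "f \<in> poly_fun m \<Longrightarrow> f (x(m := t)) = f x"
  unfolding poly_fun_def by (induction rule: generated_functions.induct) auto

lemma poly_fun_compose:
  assumes R: "function_ring R" and "f \<in> poly_fun m" "\<And>i. i < m \<Longrightarrow> (\<lambda>x. \<gamma> x i) \<in> R"
  shows "(\<lambda>x. f (\<gamma> x)) \<in> R"
proof -
  interpret function_ring R by (rule R)
  show ?thesis using assms(2) unfolding poly_fun_def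
    by (induction rule: generated_functions.induct) (use assms(3) in auto)
qed

text \<open>Polynomials in \<open>x 0, \<dots>, x m\<close> of degree less than \<open>d\<close> in \<open>x m\<close>.\<close>

inductive_set low :: "nat \<Rightarrow> nat \<Rightarrow> ((nat \<Rightarrow> 'k::comm_ring_1) \<Rightarrow> 'k) set" for m d where
  low_zero: "(\<lambda>_. 0) \<in> low m d"
| low_monom: "r \<in> poly_fun m \<Longrightarrow> i < d \<Longrightarrow> (\<lambda>x. r x * x m ^ i) \<in> low m d"
| low_add: "p \<in> low m d \<Longrightarrow> q \<in> low m d \<Longrightarrow> (\<lambda>x. p x + q x) \<in> low m d"

lemma low_mono: "d \<le> d' \<Longrightarrow> low m d \<subseteq> low m d'"
proof
  fix f :: "(nat \<Rightarrow> 'k::comm_ring_1) \<Rightarrow> 'k" assume d: "d \<le> d'" and f: "f \<in> low m d"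
  from f show "f \<in> low m d'" by induction (use d in \<open>auto intro: low.intros\<close>)
qed

lemma low_shift:
  assumes "p \<in> low m d" "r \<in> poly_fun m" "d + j \<le> d'"
  shows "(\<lambda>x. r x * x m ^ j * p x) \<in> low m d'"
  using assms(1)
proof induction
  case (low_monom s i)
  have "(\<lambda>x. (r x * s x) * x m ^ (j + i)) \<in> low m d'"
    by (intro low.low_monom) (use assms low_monom in auto)
  then show ?case by (simp add: power_add mult_ac)
next
  case (low_add p q)
  then show ?case using low.low_add by (force simp: distrib_left)
qed (auto intro: low.intros)

lemma low_mult:
  assumes "p \<in> low m d" "q \<in> low m e"
  shows "(\<lambda>x. p x * q x) \<in> low m (d + e)"
  using assms(1)
proof induction
  case (low_monom s i)
  then show ?case by (intro low_shift[OF assms(2)]) auto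
next
  case (low_add p1 p2)
  then show ?case using low.low_add by (force simp: distrib_right)
qed (auto intro: low.intros)

lemma low_sum: "(\<And>i. i \<in> I \<Longrightarrow> p i \<in> low m d) \<Longrightarrow> (\<lambda>x. \<Sum>i\<in>I. p i x) \<in> low m d"
  by (induction I rule: infinite_finite_induct) (auto intro: low.intros)

lemma low_expand:
  assumes "p \<in> low m d"
  shows "\<exists>c. (\<forall>i. c i \<in> poly_fun m) \<and> p = (\<lambda>x. \<Sum>i<d. c i x * x m ^ i)"
  using assms
proof induction
  case low_zero
  show ?case by (rule exI[of _ "\<lambda>_ _. 0"]) auto
next
  case (low_monom r i)
  have "(\<Sum>k<d. (if k = i then r else (\<lambda>_. 0)) x * x m ^ k) = (\<Sum>k<d. if k = i then r x * x m ^ k else 0)" for x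
    by (intro sum.cong) auto
  then have "(\<Sum>k<d. (if k = i then r else (\<lambda>_. 0)) x * x m ^ k) = r x * x m ^ i" for x
    using low_monom by simp
  then show ?case using low_monom
    by (intro exI[of _ "\<lambda>k. if k = i then r else (\<lambda>_. 0)"]) auto
next
  case (low_add p q)
  then obtain c c' where "\<forall>i. c i \<in> poly_fun m" "p = (\<lambda>x. \<Sum>i<d. c i x * x m ^ i)"
    "\<forall>i. c' i \<in> poly_fun m" "q = (\<lambda>x. \<Sum>i<d. c' i x * x m ^ i)" by blast
  then show ?case
    by (intro exI[of _ "\<lambda>i x. c i x + c' i x"]) (auto simp: sum.distrib distrib_right)
qed

text \<open>The linear change of variables of Noether normalization. It fixes \<open>x m\<close>,
  and for \<open>u m = 1\<close> it sends the \<open>m\<close>-th unit vector to \<open>u\<close> as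
  far as the coordinates up to \<open>m\<close> are concerned.\<close>

definition shear :: "nat \<Rightarrow> (nat \<Rightarrow> 'k::comm_ring_1) \<Rightarrow> (nat \<Rightarrow> 'k) \<Rightarrow> nat \<Rightarrow> 'k" where
  "shear m u x = (\<lambda>i. if i < m then x i + u i * x m else x i)"

lemma shear_inverse: "shear m u (shear m (\<lambda>i. - u i) x) = x"
  by (auto simp: shear_def)

lemma poly_fun_shear:
  assumes "f \<in> poly_fun (Suc m)"
  shows "(\<lambda>x. f (shear m u x)) \<in> poly_fun (Suc m)"
proof (rule poly_fun_compose[OF _ assms])
  show "(\<lambda>x. shear m u x i) \<in> poly_fun (Suc m)" if "i < Suc m" for i
    using that by (cases "i < m") (auto simp: shear_def intro!: poly_fun_var PF.add PF.mult)
qed auto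

text \<open>The second condition says that the coefficient of the highest power of \<open>x m\<close> in the sheared
  form is the constant \<open>f u\<close>.\<close>

definition homogeneous :: "nat \<Rightarrow> nat \<Rightarrow> ((nat \<Rightarrow> 'k::comm_ring_1) \<Rightarrow> 'k) set" where
  "homogeneous m j = {f \<in> poly_fun (Suc m). (\<forall>c x. f (\<lambda>i. c * x i) = c ^ j * f x) \<and>
     (\<forall>u. u m = 1 \<longrightarrow> (\<lambda>x. f (shear m u x) - f u * x m ^ j) \<in> low m j)}"

lemma homogeneous_zero: "(\<lambda>_. 0) \<in> homogeneous m j"
  by (auto simp: homogeneous_def low_zero)

lemma homogeneous_const: "(\<lambda>_. c) \<in> homogeneous m 0"
  by (auto simp: homogeneous_def low_zero)

lemma homogeneous_var:
  assumes "i \<le> m"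
  shows "(\<lambda>x. x i :: 'k::comm_ring_1) \<in> homogeneous m 1"
proof -
  have "(\<lambda>x. shear m u x i - u i * x m ^ 1) \<in> low m 1" if "u m = 1" for u :: "nat \<Rightarrow> 'k"
  proof (cases "i < m")
    case True
    then show ?thesis using low_monom[of "\<lambda>x. x i" m 0 1] poly_fun_var[of i m]
      by (simp add: shear_def)
  next
    case False
    then show ?thesis using assms that by (simp add: shear_def low_zero)
  qed
  then show ?thesis using assms by (auto simp: homogeneous_def intro: poly_fun_var)
qed

lemma homogeneous_add:
  assumes "f \<in> homogeneous m j" "g \<in> homogeneous m j"
  shows "(\<lambda>x. f x + g x) \<in> homogeneous m j"
proof -
  have "(\<lambda>x. f (shear m u x) + g (shear m u x) - (f u + g u) * x m ^ j) \<in> low m j" if "u m = 1" for u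
    using low_add[of "\<lambda>x. f (shear m u x) - f u * x m ^ j" m j "\<lambda>x. g (shear m u x) - g u * x m ^ j"]
      assms that by (simp add: homogeneous_def algebra_simps)
  then show ?thesis using assms by (auto simp: homogeneous_def distrib_left)
qed

lemma homogeneous_mult:
  assumes "f \<in> homogeneous m i" "g \<in> homogeneous m j"
  shows "(\<lambda>x. f x * g x) \<in> homogeneous m (i + j)"
proof -
  have "(\<lambda>x. f (shear m u x) * g (shear m u x) - (f u * g u) * x m ^ (i + j)) \<in> low m (i + j)"
    if "u m = 1" for u
  proof -
    define p q where "p = (\<lambda>x. f (shear m u x) - f u * x m ^ i)"
      and "q = (\<lambda>x. g (shear m u x) - g u * x m ^ j)"
    have pq: "p \<in> low m i" "q \<in> low m j" using assms that by (auto simp: homogeneous_def p_def q_def)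
    \<comment> \<open>The sheared factors are \<open>p + f u * x m ^ i\<close> and
      \<open>q + g u * x m ^ j\<close>; every term of their product except the leading one contains
      \<open>p\<close> or \<open>q\<close>.\<close>
    have "(\<lambda>x. (p x * q x + f u * x m ^ i * q x) + g u * x m ^ j * p x) \<in> low m (i + j)"
      by (intro low_add low_mult low_shift pq) (auto intro: pq low_shift)
    moreover have "(\<lambda>x. (p x * q x + f u * x m ^ i * q x) + g u * x m ^ j * p x) =
      (\<lambda>x. f (shear m u x) * g (shear m u x) - (f u * g u) * x m ^ (i + j))"
      by (intro ext) (simp add: p_def q_def power_add algebra_simps)
    ultimately show ?thesis by simp
  qed
  then show ?thesis using assms by (auto simp: homogeneous_def power_add mult_ac)
qed

text \<open>The components form a sequence that vanishes from \<open>k\<close> on, so that two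
  decompositions can be padded to a common length and added degree by degree.\<close>

definition homogeneous_sum :: "nat \<Rightarrow> ((nat \<Rightarrow> 'k::comm_ring_1) \<Rightarrow> 'k) set" where
  "homogeneous_sum m = {f. \<exists>k h. (\<forall>j. h j \<in> homogeneous m j) \<and> (\<forall>j\<ge>k. h j = (\<lambda>_. 0)) \<and>
     f = (\<lambda>x. \<Sum>j<k. h j x)}"

lemma homogeneous_sum_homogeneous:
  assumes "f \<in> homogeneous m j" shows "f \<in> homogeneous_sum m"
  unfolding homogeneous_sum_def
  by (rule CollectI, rule exI[of _ "Suc j"], rule exI[of _ "\<lambda>i. if i = j then f else (\<lambda>_. 0)"])
    (use assms in \<open>auto simp: homogeneous_zero\<close>)

lemma homogeneous_sum_add:
  assumes "f \<in> homogeneous_sum m" "g \<in> homogeneous_sum m"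
  shows "(\<lambda>x. f x + g x) \<in> homogeneous_sum m"
proof -
  obtain k h where h: "\<forall>j. h j \<in> homogeneous m j" "\<forall>j\<ge>k. h j = (\<lambda>_. 0)" "f = (\<lambda>x. \<Sum>j<k. h j x)"
    using assms(1) unfolding homogeneous_sum_def by blast
  obtain l h' where h': "\<forall>j. h' j \<in> homogeneous m j" "\<forall>j\<ge>l. h' j = (\<lambda>_. 0)" "g = (\<lambda>x. \<Sum>j<l. h' j x)"
    using assms(2) unfolding homogeneous_sum_def by blast
  have "(\<Sum>j<k. h j x) = (\<Sum>j<max k l. h j x)" for x
    by (rule sum.mono_neutral_left) (use h in auto)
  moreover have "(\<Sum>j<l. h' j x) = (\<Sum>j<max k l. h' j x)" for x
    by (rule sum.mono_neutral_left) (use h' in auto)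
  ultimately show ?thesis unfolding homogeneous_sum_def
    using h h' by (intro CollectI exI[of _ "max k l"] exI[of _ "\<lambda>j x. h j x + h' j x"])
      (auto simp: sum.distrib homogeneous_add)
qed

lemma homogeneous_sum_sum:
  "(\<And>i. i \<in> I \<Longrightarrow> f i \<in> homogeneous_sum m) \<Longrightarrow> (\<lambda>x. \<Sum>i\<in>I. f i x) \<in> homogeneous_sum m"
  by (induction I rule: infinite_finite_induct)
    (auto intro: homogeneous_sum_add homogeneous_sum_homogeneous[OF homogeneous_zero])

lemma homogeneous_sum_mult:
  assumes "f \<in> homogeneous_sum m" "g \<in> homogeneous_sum m"
  shows "(\<lambda>x. f x * g x) \<in> homogeneous_sum m"
proof -
  obtain k h where h: "\<forall>j. h j \<in> homogeneous m j" "f = (\<lambda>x. \<Sum>j<k. h j x)"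
    using assms(1) unfolding homogeneous_sum_def by blast
  obtain l h' where h': "\<forall>j. h' j \<in> homogeneous m j" "g = (\<lambda>x. \<Sum>j<l. h' j x)"
    using assms(2) unfolding homogeneous_sum_def by blast
  have "(\<lambda>x. \<Sum>i<k. \<Sum>j<l. h i x * h' j x) \<in> homogeneous_sum m"
    by (intro homogeneous_sum_sum)
      (use h h' in \<open>blast intro: homogeneous_sum_homogeneous homogeneous_mult\<close>)
  then show ?thesis by (simp add: h h' sum_product)
qed

lemma poly_fun_homogeneous_sum: "poly_fun (Suc m) \<subseteq> homogeneous_sum m"
proof
  fix f :: "(nat \<Rightarrow> 'k::comm_ring_1) \<Rightarrow> 'k" assume "f \<in> poly_fun (Suc m)"
  then show "f \<in> homogeneous_sum m" unfolding poly_fun_def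
    by induction (auto intro: homogeneous_sum_mult homogeneous_sum_add
      homogeneous_sum_homogeneous[OF homogeneous_const] homogeneous_sum_homogeneous[OF homogeneous_var])
qed

text \<open>The top nonzero homogeneous component \<open>h j\<close> is nonzero at some point with
  nonzero last coordinate, and homogeneity rescales this point to a \<open>u\<close> with
  \<open>u m = 1\<close>. After shearing along \<open>u\<close> the coefficient of
  \<open>x m ^ j\<close> is \<open>h j u\<close>, and the lower components contribute lower powers
  only.\<close>

lemma exists_monic_shear:
  fixes f :: "(nat \<Rightarrow> 'k::alg_closed_field) \<Rightarrow> 'k"
  assumes f: "f \<in> poly_fun (Suc m)" and nz: "f x0 \<noteq> 0"
  shows "\<exists>u d c. c \<noteq> 0 \<and> (\<lambda>x. f (shear m u x) - c * x m ^ d) \<in> low m d"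
proof -
  have "f \<in> homogeneous_sum m" using f poly_fun_homogeneous_sum by auto
  then obtain k h where h: "\<forall>j. h j \<in> homogeneous m j" "f = (\<lambda>x. \<Sum>j<k. h j x)"
    unfolding homogeneous_sum_def by (elim CollectE exE conjE)
  define A where "A = {j. j < k \<and> (\<exists>x. h j x \<noteq> 0)}"
  have "A \<noteq> {}"
  proof
    assume "A = {}"
    then have "h j x0 = 0" if "j < k" for j using that by (auto simp: A_def)
    then show False using nz by (simp add: h(2))
  qed
  moreover have fin: "finite A" by (simp add: A_def)
  moreover define j where "j = Max A"
  ultimately have "j \<in> A" by simp
  then have j: "j < k" "\<exists>x. h j x \<noteq> 0" by (auto simp: A_def)
  have above: "h i x = 0" if "j < i" "i < k" for i x
  proof (rule ccontr)
    assume "h i x \<noteq> 0"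
    then have "i \<in> A" using that by (auto simp: A_def)
    then show False using Max_ge[OF fin] that(1) by (force simp: j_def)
  qed
  obtain x1 where x1: "h j x1 \<noteq> 0" using j by blast
  \<comment> \<open>Possibly \<open>x1 m = 0\<close>. Only the last coordinate is moved:
    \<open>h j\<close> is nonzero at \<open>t = x1 m\<close> and \<open>x m\<close> is nonzero at
    \<open>t = 1\<close>, so some \<open>t\<close> serves both.\<close>
  define \<gamma> where "\<gamma> t = x1(m := t)" for t
  have "\<exists>t. h j (\<gamma> t) \<noteq> 0 \<and> \<gamma> t m \<noteq> 0"
  proof (rule common_nonzero_on_curve[where f = "h j" and g = "\<lambda>x. x m" and \<gamma> = \<gamma>])
    show "h j \<in> generated_functions UNIV {\<lambda>x. x i |i. i < Suc m}"
      using h(1) by (auto simp: homogeneous_def poly_fun_def)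
    show "(\<lambda>x. x m) \<in> generated_functions UNIV {\<lambda>x. x i |i. i < Suc m}"
      by (rule generated_functions.functional) auto
    show "h j (\<gamma> (x1 m)) \<noteq> 0" using x1 by (simp add: \<gamma>_def)
    show "\<gamma> 1 m \<noteq> 0" by (simp add: \<gamma>_def)
    show "\<exists>q. \<forall>t. l (\<gamma> t) = poly q t" if l: "l \<in> {\<lambda>x. x i |i. i < Suc m}" for l
    proof -
      obtain i where "l = (\<lambda>x. x i)" using l by auto
      then show ?thesis
        by (intro exI[of _ "if i = m then [:0, 1:] else [:x1 i:]"]) (auto simp: \<gamma>_def)
    qed
  qed
  then obtain t where "h j (\<gamma> t) \<noteq> 0" "\<gamma> t m \<noteq> 0" by (elim exE conjE)
  moreover define v where "v = \<gamma> t"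
  ultimately have v: "h j v \<noteq> 0" "v m \<noteq> 0" by simp_all
  define u where "u = (\<lambda>i. inverse (v m) * v i)"
  have "h j (\<lambda>i. inverse (v m) * v i) = inverse (v m) ^ j * h j v"
    using h(1) unfolding homogeneous_def by blast
  then have u: "u m = 1" "h j u \<noteq> 0"
    using v by (auto simp: u_def)
  have "(\<lambda>x. (h j (shear m u x) - h j u * x m ^ j) + (\<Sum>i<j. h i (shear m u x))) \<in> low m j"
  proof (intro low_add low_sum)
    show "(\<lambda>x. h j (shear m u x) - h j u * x m ^ j) \<in> low m j"
      using h(1) u by (auto simp: homogeneous_def)
    fix i assume i: "i \<in> {..<j}"
    have "(\<lambda>x. (h i (shear m u x) - h i u * x m ^ i) + h i u * x m ^ i) \<in> low m j"
    proof (intro low_add low_monom)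
      show "(\<lambda>x. h i (shear m u x) - h i u * x m ^ i) \<in> low m j"
        using h(1) u i low_mono[of i j m] by (auto simp: homogeneous_def)
    qed (use i in auto)
    then show "(\<lambda>x. h i (shear m u x)) \<in> low m j" by simp
  qed
  moreover have "(h j (shear m u x) - h j u * x m ^ j) + (\<Sum>i<j. h i (shear m u x)) =
    f (shear m u x) - h j u * x m ^ j" for x
  proof -
    have "(\<Sum>i<k. h i y) = (\<Sum>i<Suc j. h i y)" for y
      by (rule sum.mono_neutral_right) (use j above in auto)
    then show ?thesis by (simp add: h(2))
  qed
  ultimately show ?thesis using u by auto
qed

text \<open>The set \<open>S\<close> of functions that can be divided by \<open>g\<close> contains
  \<open>1\<close> and is stable under addition, under multiplication by functions of the first
  \<open>m\<close> variables and under multiplication by \<open>x m\<close>. For the last property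
  only the power \<open>x m ^ d\<close> has to be reduced.\<close>

lemma monic_division:
  assumes g: "g \<in> poly_fun (Suc m)" "(\<lambda>x. g x - x m ^ d) \<in> low m d" and d: "d > 0"
    and h: "h \<in> poly_fun (Suc m)"
  shows "\<exists>r q. r \<in> low m d \<and> q \<in> poly_fun (Suc m) \<and> h = (\<lambda>x. r x + g x * q x)"
proof -
  define S where "S = {a. \<exists>r q. r \<in> low m d \<and> q \<in> poly_fun (Suc m) \<and> a = (\<lambda>x. r x + g x * q x)}"
  have S_I: "a \<in> S" if "r \<in> low m d" "q \<in> poly_fun (Suc m)" "\<And>x. a x = r x + g x * q x" for a r q
    unfolding S_def by (intro CollectI exI[of _ r] exI[of _ q] conjI ext that)
  have S_E: thesis
    if "a \<in> S" and "\<And>r q. r \<in> low m d \<Longrightarrow> q \<in> poly_fun (Suc m) \<Longrightarrow> \<forall>x. a x = r x + g x * q x \<Longrightarrow> thesis"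
    for a thesis
  proof -
    from that(1) obtain r q where "r \<in> low m d" "q \<in> poly_fun (Suc m)" "a = (\<lambda>x. r x + g x * q x)"
      unfolding S_def by (elim CollectE exE conjE)
    then show thesis by (intro that(2)[of r q]) simp_all
  qed
  have S_add: "(\<lambda>x. a x + b x) \<in> S" if a: "a \<in> S" and b: "b \<in> S" for a b
  proof -
    obtain r q where 1: "r \<in> low m d" "q \<in> poly_fun (Suc m)" "\<forall>x. a x = r x + g x * q x"
      by (rule S_E[OF a])
    obtain r' q' where 2: "r' \<in> low m d" "q' \<in> poly_fun (Suc m)" "\<forall>x. b x = r' x + g x * q' x"
      by (rule S_E[OF b])
    show ?thesis
      by (rule S_I[OF low_add[OF 1(1) 2(1)] PF.add[OF 1(2) 2(2)]]) (simp add: 1(3) 2(3) algebra_simps)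
  qed
  have S_low: "r \<in> S" if "r \<in> low m d" for r
    by (rule S_I[OF that PF.const[of 0]]) simp
  have S_scale: "(\<lambda>x. r x * a x) \<in> S" if r: "r \<in> poly_fun m" and a: "a \<in> S" for r a
  proof -
    obtain r' q where 1: "r' \<in> low m d" "q \<in> poly_fun (Suc m)" "\<forall>x. a x = r' x + g x * q x"
      by (rule S_E[OF a])
    have r2: "r \<in> poly_fun (Suc m)" using r poly_fun_mono[of m "Suc m"] by auto
    show ?thesis
      by (rule S_I[OF low_shift[OF 1(1) r, of 0 d] PF.mult[OF r2 1(2)]]) (simp_all add: 1(3) algebra_simps)
  qed
  have S_var: "(\<lambda>x. x m * a x) \<in> S" if a: "a \<in> S" for a
  proof -
    have low: "(\<lambda>x. x m * r x) \<in> S" if "r \<in> low m d" for r using that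
    proof induction
      case low_zero
      then show ?case using S_low[OF low.low_zero] by simp
    next
      case (low_monom r i)
      show ?case
      proof (cases "Suc i < d")
        case True
        have "(\<lambda>x. r x * x m ^ Suc i) \<in> S" by (rule S_low[OF low.low_monom[OF low_monom(1) True]])
        then show ?thesis by (simp add: mult_ac)
      next
        case False
        then have i: "d = Suc i" using low_monom by simp
        \<comment> \<open>\<open>x m ^ d\<close> has quotient \<open>1\<close>, and its remainder
          \<open>-(g - x m ^ d)\<close> is of low degree.\<close>
        have "(\<lambda>x. x m ^ d) \<in> S"
          by (rule S_I[OF low_shift[OF g(2) PF.const[of "-1"], of 0 d] PF.const[of 1]]) simp_all
        from S_scale[OF low_monom(1) this] show ?thesis by (simp add: i mult_ac)
      qed
    next
      case (low_add p q)
      show ?case using S_add[OF low_add(3,4)] by (simp add: distrib_left)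
    qed
    obtain r q where 1: "r \<in> low m d" "q \<in> poly_fun (Suc m)" "\<forall>x. a x = r x + g x * q x"
      by (rule S_E[OF a])
    have "(\<lambda>x. g x * (x m * q x)) \<in> S"
      by (rule S_I[OF low_zero PF.mult[OF poly_fun_var[of m] 1(2)]]) simp_all
    from S_add[OF low[OF 1(1)] this] show ?thesis by (simp add: 1(3) algebra_simps)
  qed
  \<comment> \<open>That \<open>h\<close> maps \<open>S\<close> into itself passes to products of
    such \<open>h\<close>, which \<open>h \<in> S\<close> alone would not; it is applied to
    \<open>1\<close> afterwards.\<close>
  have "\<forall>a\<in>S. (\<lambda>x. h x * a x) \<in> S" using h unfolding poly_fun_def
  proof induction
    case (const c)
    show ?case using S_scale[OF PF.const[of c]] by blast
  next
    case (functional l)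
    then obtain i where i: "l = (\<lambda>x. x i)" "i < Suc m" by auto
    show ?case
    proof (cases "i = m")
      case True
      then show ?thesis using S_var i(1) by simp
    next
      case False
      then show ?thesis using S_scale[OF poly_fun_var[of i m]] i by simp
    qed
  next
    case (add p q)
    then show ?case using S_add by (simp add: distrib_right)
  next
    case (mult p q)
    show ?case
    proof
      fix a assume "a \<in> S"
      then have "(\<lambda>x. p x * (q x * a x)) \<in> S" using mult(3,4) by auto
      then show "(\<lambda>x. p x * q x * a x) \<in> S" by (simp add: mult.assoc)
    qed
  qed
  moreover have "(\<lambda>_. 1) \<in> S" using S_low[OF low_monom[OF PF.const[of 1] d]] by simp
  ultimately have "(\<lambda>x. h x * 1) \<in> S" by (rule bspec)
  then show ?thesis unfolding S_def by simp
qed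

text \<open>\<open>K[t]\<close> is a principal ideal domain: a nonzero member of least degree
  divides all members, and it is not constant because \<open>1\<close> is not a member, so it has a
  root.\<close>

lemma poly_ideal_root:
  fixes Q :: "'k::alg_closed_field poly set"
  assumes add: "\<And>p q. p \<in> Q \<Longrightarrow> q \<in> Q \<Longrightarrow> p + q \<in> Q" and mult: "\<And>p q. q \<in> Q \<Longrightarrow> p * q \<in> Q"
    and nz: "p0 \<in> Q" "p0 \<noteq> 0" and one: "1 \<notin> Q"
  shows "\<exists>t. \<forall>q\<in>Q. poly q t = 0"
proof -
  obtain q where q: "q \<in> Q" "q \<noteq> 0" and min: "\<And>p. p \<in> Q \<Longrightarrow> p \<noteq> 0 \<Longrightarrow> Polynomial.degree q \<le> Polynomial.degree p"
    using nz ex_has_least_nat[of "\<lambda>p. p \<in> Q \<and> p \<noteq> 0" p0 Polynomial.degree] by auto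
  have "Polynomial.degree q > 0"
  proof (rule ccontr)
    assume "\<not> 0 < Polynomial.degree q"
    then obtain c where "q = [:c:]" by (auto elim: degree_eq_zeroE)
    then show False using mult[of q "[:inverse c:]"] q one by (simp add: one_pCons)
  qed
  then obtain t where t: "poly q t = 0" using alg_closed_imp_poly_has_root by blast
  have "poly p t = 0" if p: "p \<in> Q" for p
  proof -
    have "p mod q = p + (- (p div q)) * q" by (simp add: minus_div_mult_eq_mod[symmetric])
    then have "p mod q \<in> Q" using add[OF p mult[OF q(1)]] by metis
    then have "p mod q = 0" using min[of "p mod q"] degree_mod_less[OF q(2), of p] \<open>Polynomial.degree q > 0\<close> by force
    then have "q dvd p" by (simp add: mod_eq_0_iff_dvd)
    then show ?thesis using t by auto
  qed
  then show ?thesis by blast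
qed

text \<open>The Nullstellensatz for an ideal containing a monic \<open>g\<close> follows from the one in fewer variables:
  a zero \<open>a\<close> of \<open>I \<inter> K[x 0, \<dots>, x (m-1)]\<close> lifts, since otherwise some \<open>h \<in> I\<close> is \<open>1\<close> on the line over
  \<open>a\<close>, and the determinant of the multiplication by \<open>h\<close> on \<open>K[x 0, \<dots>, x m] / g\<close> lies in \<open>I\<close>
  but is \<open>1\<close> at \<open>a\<close>.\<close>

lemma monic_lift_zero:
  fixes I :: "((nat \<Rightarrow> 'k::alg_closed_field) \<Rightarrow> 'k) set"
  assumes I: "function_ideal (poly_fun (Suc m)) I" and one: "(\<lambda>_. 1) \<notin> I"
    and g: "g \<in> I" "(\<lambda>x. g x - x m ^ d) \<in> low m d"
    and a: "\<And>f. f \<in> I \<Longrightarrow> f \<in> poly_fun m \<Longrightarrow> f a = 0"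
  shows "\<exists>t. \<forall>f\<in>I. f (a(m := t)) = 0"
proof -
  interpret I: function_ideal "poly_fun (Suc m)" I by (rule I)
  have gP: "g \<in> poly_fun (Suc m)" using g I.ideal_subset by auto
  obtain cg where cg: "\<forall>i. cg i \<in> poly_fun m" "(\<lambda>x. g x - x m ^ d) = (\<lambda>x. \<Sum>i<d. cg i x * x m ^ i)"
    using low_expand[OF g(2)] by (elim exE conjE)
  have g_eq: "g x = x m ^ d + (\<Sum>i<d. cg i x * x m ^ i)" for x
    using fun_cong[OF cg(2), of x] by (simp add: diff_eq_eq add.commute)
  have d: "d > 0"
  proof (rule ccontr)
    assume "\<not> d > 0"
    then have "g = (\<lambda>_. 1)" using g_eq by (intro ext) simp
    then show False using g(1) one by simp
  qed
  have on_line: "\<exists>q. \<forall>t. f (a(m := t)) = poly q t" if "f \<in> poly_fun (Suc m)" for f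
  proof (rule generated_along_curve[where f = f and \<gamma> = "\<lambda>t. a(m := t)"])
    show "f \<in> generated_functions UNIV {\<lambda>x. x i |i. i < Suc m}"
      using that by (simp add: poly_fun_def)
  next
    fix l :: "(nat \<Rightarrow> 'k) \<Rightarrow> 'k" assume "l \<in> {\<lambda>x. x i |i. i < Suc m}"
    then obtain i where "l = (\<lambda>x. x i)" by auto
    then show "\<exists>q. \<forall>t. l (a(m := t)) = poly q t"
      by (intro exI[of _ "if i = m then [:0, 1:] else [:a i:]"]) auto
  qed
  \<comment> \<open>\<open>G\<close> is \<open>g\<close> on the line over \<open>a\<close>. The
    coefficients \<open>cg i\<close> do not involve \<open>x m\<close>, so \<open>G\<close> is still
    monic of degree \<open>d\<close>.\<close>
  define G where "G = Polynomial.monom 1 d + (\<Sum>i<d. Polynomial.monom (cg i a) i)"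
  have G: "poly G t = g (a(m := t))" for t
    by (simp add: G_def g_eq poly_monom poly_sum poly_fun_fun_upd[OF cg(1)[rule_format]])
  have "Polynomial.degree (\<Sum>i<d. Polynomial.monom (cg i a) i) < d"
    using d by (intro degree_sum_less) (auto intro: le_less_trans[OF degree_monom_le])
  then have degG: "Polynomial.degree G = d" unfolding G_def
    by (subst degree_add_eq_left) (auto simp: degree_monom_eq)
  then have Gnz: "G \<noteq> 0" using d by auto
  \<comment> \<open>The restrictions of \<open>I\<close> to the line over \<open>a\<close> form an
    ideal of \<open>K[t]\<close>, and a common root is the coordinate \<open>t\<close> that is
    sought. The point to prove is \<open>1 \<notin> Q\<close>.\<close>
  define Q where "Q = {q. \<exists>h\<in>I. \<forall>t. poly q t = h (a(m := t))}"
  have "\<exists>t. \<forall>q\<in>Q. poly q t = 0"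
  proof (rule poly_ideal_root)
    fix p q assume "p \<in> Q" "q \<in> Q"
    then obtain h h' where "h \<in> I" "\<forall>t. poly p t = h (a(m := t))" "h' \<in> I" "\<forall>t. poly q t = h' (a(m := t))"
      unfolding Q_def by blast
    then show "p + q \<in> Q" unfolding Q_def using I.ideal_add[of h h'] by auto
  next
    fix p q :: "'k poly" assume "q \<in> Q"
    then obtain h where h: "h \<in> I" "\<forall>t. poly q t = h (a(m := t))" unfolding Q_def by blast
    have "(\<lambda>x. poly p (x m)) \<in> poly_fun (Suc m)"
      unfolding poly_altdef by (intro PF.sum PF.mult PF.const PF.power poly_fun_var) auto
    then show "p * q \<in> Q" unfolding Q_def using I.ideal_mult[of "\<lambda>x. poly p (x m)" h] h
      by (auto intro!: bexI[of _ "\<lambda>x. poly p (x m) * h x"])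
  next
    show "G \<in> Q" using g G by (auto simp: Q_def)
    show "G \<noteq> 0" by (rule Gnz)
    show "1 \<notin> Q"
    proof
      assume "1 \<in> Q"
      then obtain h where h: "h \<in> I" and h1: "\<And>t. h (a(m := t)) = 1" unfolding Q_def by auto
      have hP: "h \<in> poly_fun (Suc m)" using h I.ideal_subset by auto
      have "\<exists>c q. (\<forall>i. c i \<in> poly_fun m) \<and> q \<in> poly_fun (Suc m) \<and>
        (\<forall>x. x m ^ j * h x = (\<Sum>i<d. c i x * x m ^ i) + g x * q x)" for j
      proof -
        have "(\<lambda>x. x m ^ j * h x) \<in> poly_fun (Suc m)"
          by (intro PF.mult PF.power poly_fun_var hP) auto
        from monic_division[OF gP g(2) d this] obtain r q where rq: "r \<in> low m d"
          "q \<in> poly_fun (Suc m)" "(\<lambda>x. x m ^ j * h x) = (\<lambda>x. r x + g x * q x)" by (elim exE conjE)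
        from low_expand[OF rq(1)] obtain c
          where c: "\<forall>i. c i \<in> poly_fun m" "r = (\<lambda>x. \<Sum>i<d. c i x * x m ^ i)" by (elim exE conjE)
        show ?thesis
          by (intro exI[of _ c] exI[of _ q] conjI c rq(2) allI) (use fun_cong[OF rq(3)] in \<open>simp add: c(2)\<close>)
      qed
      then have "\<exists>c. \<forall>j. \<exists>q. (\<forall>i. c j i \<in> poly_fun m) \<and> q \<in> poly_fun (Suc m) \<and>
        (\<forall>x. x m ^ j * h x = (\<Sum>i<d. c j i x * x m ^ i) + g x * q x)" by (intro choice allI)
      then obtain c where "\<forall>j. \<exists>q. (\<forall>i. c j i \<in> poly_fun m) \<and> q \<in> poly_fun (Suc m) \<and>
        (\<forall>x. x m ^ j * h x = (\<Sum>i<d. c j i x * x m ^ i) + g x * q x)" ..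
      from choice[OF this] obtain q where cq': "\<forall>j. (\<forall>i. c j i \<in> poly_fun m) \<and> q j \<in> poly_fun (Suc m) \<and>
        (\<forall>x. x m ^ j * h x = (\<Sum>i<d. c j i x * x m ^ i) + g x * q j x)" ..
      then have c: "\<And>i j. c j i \<in> poly_fun m" and q: "\<And>j. q j \<in> poly_fun (Suc m)"
        and cq: "\<And>j x. x m ^ j * h x = (\<Sum>i<d. c j i x * x m ^ i) + g x * q j x" by simp_all
      \<comment> \<open>Row \<open>j\<close> holds the remainder of \<open>x m ^ j * h\<close>
        modulo \<open>g\<close>.\<close>
      define M where "M x = Matrix.mat d d (\<lambda>(j, i). c j i x)" for x
      have M: "matrix_over (poly_fun m) d M" by (auto simp: matrix_over_def M_def c)
      have "matrix_over (poly_fun (Suc m)) d M"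
        using M poly_fun_mono[of m "Suc m"] by (auto simp: matrix_over_def)
      then have adj: "matrix_over (poly_fun (Suc m)) d (\<lambda>x. adj_mat (M x))" by (rule PF.matrix_over_adj)
      \<comment> \<open>Cramer's rule. For the vector \<open>v\<close> of the powers
        \<open>x m ^ i\<close>, the brackets are the entries of \<open>M v\<close> and lie in
        \<open>I\<close>; row \<open>0\<close> of the adjugate turns them into
        \<open>det M * x m ^ 0\<close>.\<close>
      have "(\<lambda>x. \<Sum>j<d. adj_mat (M x) $$ (0, j) * (x m ^ j * h x + (- q j x) * g x)) \<in> I"
        by (intro I.ideal_sum I.ideal_mult I.ideal_add h g PF.power PF.uminus q poly_fun_var)
          (use adj d in \<open>auto simp: matrix_over_def\<close>)
      moreover have "(\<Sum>j<d. adj_mat (M x) $$ (0, j) * (x m ^ j * h x + (- q j x) * g x)) = Determinant.det (M x)" for x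
      proof -
        have Mc: "M x \<in> carrier_mat d d" by (simp add: M_def)
        have "(\<Sum>j<d. adj_mat (M x) $$ (0, j) * (x m ^ j * h x + (- q j x) * g x)) =
          (\<Sum>j<d. \<Sum>i<d. adj_mat (M x) $$ (0, j) * (c j i x * x m ^ i))"
        proof (intro sum.cong refl)
          fix j
          have "x m ^ j * h x + (- q j x) * g x = (\<Sum>i<d. c j i x * x m ^ i)"
            using cq[of x j] by (simp add: mult.commute)
          then show "adj_mat (M x) $$ (0, j) * (x m ^ j * h x + (- q j x) * g x) =
            (\<Sum>i<d. adj_mat (M x) $$ (0, j) * (c j i x * x m ^ i))" by (simp add: sum_distrib_left)
        qed
        also have "\<dots> = (\<Sum>i<d. (\<Sum>j<d. adj_mat (M x) $$ (0, j) * c j i x) * x m ^ i)"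
          by (subst sum.swap) (simp add: sum_distrib_right mult.assoc)
        also have "\<dots> = (\<Sum>i<d. (adj_mat (M x) * M x) $$ (0, i) * x m ^ i)"
          using adj_mat(1)[OF Mc] d
          by (intro sum.cong refl) (auto simp: scalar_prod_def M_def atLeast0LessThan)
        also have "\<dots> = (\<Sum>i<d. (if i = 0 then Determinant.det (M x) else 0) * x m ^ i)"
          unfolding adj_mat(3)[OF Mc] using d by (intro sum.cong refl) auto
        also have "\<dots> = Determinant.det (M x)" using d
          by (simp add: if_distrib[of "\<lambda>z. z * _"] cong: if_cong)
        finally show ?thesis .
      qed
      ultimately have "(\<lambda>x. Determinant.det (M x)) \<in> I" by simp
      moreover have "(\<lambda>x. Determinant.det (M x)) \<in> poly_fun m" by (rule PF.matrix_over_det[OF M])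
      ultimately have det0: "Determinant.det (M a) = 0" using a by blast
      have "c j i a = (if i = j then 1 else 0)" if j: "j < d" and i: "i < d" for i j
      proof -
        obtain qj where qj: "\<forall>t. q j (a(m := t)) = poly qj t" using on_line[OF q] by blast
        \<comment> \<open>On the line \<open>h\<close> is \<open>1\<close>, so \<open>p\<close> is a
          multiple of \<open>G\<close>. As its degree is below \<open>d\<close>, it is zero, and row
          \<open>j\<close> of \<open>M a\<close> is a row of the identity matrix.\<close>
        define p where "p = Polynomial.monom 1 j - (\<Sum>i<d. Polynomial.monom (c j i a) i)"
        have "poly (p - G * qj) t = 0" for t
          using cq[of "a(m := t)" j] h1[of t] qj G[of t]
          by (simp add: p_def poly_monom poly_sum poly_fun_fun_upd[OF c])
        then have "p = G * qj" using poly_all_zero by fastforce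
        moreover have "Polynomial.degree p < d" unfolding p_def
          using j by (intro degree_diff_less degree_sum_less) (auto intro: le_less_trans[OF degree_monom_le])
        ultimately have "p = 0" using degree_mult_eq[OF Gnz, of qj] degG by (cases "qj = 0") auto
        then have "Polynomial.coeff (Polynomial.monom 1 j) i = Polynomial.coeff (\<Sum>i<d. Polynomial.monom (c j i a) i) i" by (simp add: p_def)
        also have "\<dots> = c j i a" using i by (simp add: coeff_sum)
        finally show ?thesis by (simp add: eq_commute)
      qed
      then have "M a = 1\<^sub>m d" by (intro eq_matI) (auto simp: M_def)
      then show False using det0 by simp
    qed
  qed
  then obtain t where t: "\<And>q. q \<in> Q \<Longrightarrow> poly q t = 0" by blast
  have "f (a(m := t)) = 0" if f: "f \<in> I" for f
  proof -
    obtain q where q: "\<forall>t. f (a(m := t)) = poly q t" using on_line[of f] f I.ideal_subset by auto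
    then have "q \<in> Q" unfolding Q_def by (intro CollectI bexI[OF _ f]) simp
    then show ?thesis using t[of q] q by simp
  qed
  then show ?thesis by blast
qed

text \<open>Induction on the number of variables. A nonzero member of \<open>I\<close> becomes monic
  in the last variable after a shear and a rescaling. The elimination ideal of the sheared ideal
  \<open>I'\<close> has a zero by induction, \<open>monic_lift_zero\<close> lifts it to a zero of
  \<open>I'\<close>, and the shear carries it to a zero of \<open>I\<close>.\<close>

theorem nullstellensatz:
  fixes I :: "((nat \<Rightarrow> 'k::alg_closed_field) \<Rightarrow> 'k) set"
  assumes "function_ideal (poly_fun m) I" and "(\<lambda>_. 1) \<notin> I"
  shows "\<exists>x. \<forall>f\<in>I. f x = 0"
  using assms
proof (induction m arbitrary: I)
  case 0
  interpret I: function_ideal "poly_fun 0" I by (rule 0)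
  have "f x = 0" if f: "f \<in> I" for f x
  proof (rule ccontr)
    assume nz: "f x \<noteq> 0"
    have "\<exists>c. f = (\<lambda>_. c)" using f I.ideal_subset unfolding poly_fun_def
    proof -
      assume "f \<in> I" "I \<subseteq> generated_functions UNIV {\<lambda>x. x i |i. i < 0}"
      then have "f \<in> generated_functions UNIV {\<lambda>x. x i |i. i < 0}" by blast
      then show ?thesis by induction auto
    qed
    then obtain c where "f = (\<lambda>_. c)" by blast
    then show False using I.ideal_mult[OF PF.const[of "inverse c"] f] nz 0 by simp
  qed
  then show ?case by blast
next
  case (Suc m)
  interpret I: function_ideal "poly_fun (Suc m)" I by (rule Suc)
  show ?case
  proof (cases "\<forall>f\<in>I. \<forall>x. f x = 0")
    case False
    then obtain f x0 where f: "f \<in> I" "f x0 \<noteq> 0" by auto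
    have "f \<in> poly_fun (Suc m)" using f(1) I.ideal_subset by (rule subsetD[rotated])
    from exists_monic_shear[OF this f(2)] obtain u d c
      where c: "c \<noteq> 0" and low: "(\<lambda>x. f (shear m u x) - c * x m ^ d) \<in> low m d" by (elim exE conjE)
    have inv: "shear m u (shear m (\<lambda>i. - u i) x) = x" "shear m (\<lambda>i. - u i) (shear m u x) = x" for x
      using shear_inverse[of m u x] shear_inverse[of m "\<lambda>i. - u i" x] by auto
    define I' where "I' = {h \<in> poly_fun (Suc m). (\<lambda>x. h (shear m (\<lambda>i. - u i) x)) \<in> I}"
    have I'_I: "h \<in> I'" if "h \<in> poly_fun (Suc m)" "(\<lambda>x. h (shear m (\<lambda>i. - u i) x)) \<in> I" for h
      using that by (simp add: I'_def)
    have I'_D: "h \<in> poly_fun (Suc m)" "(\<lambda>x. h (shear m (\<lambda>i. - u i) x)) \<in> I" if "h \<in> I'" for h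
      using that by (simp_all add: I'_def)
    have I': "function_ideal (poly_fun (Suc m)) I'"
    proof unfold_locales
      show "I' \<subseteq> poly_fun (Suc m)" using I'_D(1) by (rule subsetI)
      show "(\<lambda>_. 0) \<in> I'" by (rule I'_I[OF PF.const I.ideal_zero])
      show "(\<lambda>x. p x + q x) \<in> I'" if "p \<in> I'" "q \<in> I'" for p q
        by (rule I'_I[OF PF.add[OF I'_D(1) I'_D(1)] I.ideal_add[OF I'_D(2) I'_D(2)], OF that that])
      show "(\<lambda>x. r x * p x) \<in> I'" if "r \<in> poly_fun (Suc m)" "p \<in> I'" for p r
        by (rule I'_I[OF PF.mult[OF that(1) I'_D(1)[OF that(2)]]
          I.ideal_mult[OF poly_fun_shear[OF that(1)] I'_D(2)[OF that(2)]]])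
    qed
    then interpret I': function_ideal "poly_fun (Suc m)" I' .
    have sheared: "(\<lambda>x. h (shear m u x)) \<in> I'" if "h \<in> I" for h
    proof (rule I'_I)
      show "(\<lambda>x. h (shear m u x)) \<in> poly_fun (Suc m)"
        using that I.ideal_subset by (intro poly_fun_shear) (rule subsetD)
    qed (simp add: inv that)
    define g where "g x = inverse c * f (shear m u x)" for x
    have g: "g \<in> I'" unfolding g_def by (rule I'.ideal_mult[OF PF.const sheared[OF f(1)]])
    have "(\<lambda>x. inverse c * x m ^ 0 * (f (shear m u x) - c * x m ^ d)) \<in> low m d"
      by (rule low_shift[OF low PF.const]) simp
    moreover have "inverse c * x m ^ 0 * (f (shear m u x) - c * x m ^ d) = g x - x m ^ d" for x
      using c by (simp add: g_def right_diff_distrib)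
    ultimately have g': "(\<lambda>x. g x - x m ^ d) \<in> low m d" by simp
    have one: "(\<lambda>_. 1) \<notin> I'" using I'_D(2)[of "\<lambda>_. 1"] Suc.prems(2) by blast
    have "function_ideal (poly_fun m) (I' \<inter> poly_fun m)"
    proof unfold_locales
      show "(\<lambda>x. r x * p x) \<in> I' \<inter> poly_fun m" if "r \<in> poly_fun m" "p \<in> I' \<inter> poly_fun m" for r p
        using that poly_fun_mono[of m "Suc m"] I'.ideal_mult[of r p] PF.mult[of r m p] by auto
    qed (simp_all add: I'.ideal_zero PF.const I'.ideal_add PF.add)
    from Suc.IH[OF this] obtain a where a: "\<forall>f\<in>I' \<inter> poly_fun m. f a = 0" using one by auto
    have "\<exists>t. \<forall>f\<in>I'. f (a(m := t)) = 0"
      by (rule monic_lift_zero[OF I' one g g']) (use a in simp)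
    then obtain t where t: "\<And>f. f \<in> I' \<Longrightarrow> f (a(m := t)) = 0" by auto
    show ?thesis using t[OF sheared] by (intro exI[of _ "shear m u (a(m := t))"] ballI)
  qed auto
qed

section \<open>Zariski dimension\<close>

text \<open>The head of the list is the exponent of the variable of highest index,
  \<open>length as\<close>, so that prepending an exponent adjoins a new last variable and leaves
  the others in place.\<close>

primrec monomial_at :: "(nat \<Rightarrow> 'k::comm_ring_1) \<Rightarrow> nat list \<Rightarrow> 'k" where
  "monomial_at f [] = 1"
| "monomial_at f (a # as) = f (length as) ^ a * monomial_at f as"

text \<open>Each exponent is bounded separately, not their sum, which makes the number of monomials
  exactly \<open>(t + 1) ^ d\<close>.\<close>

definition exponents :: "nat \<Rightarrow> nat \<Rightarrow> nat list set" where
  "exponents d t = {xs. set xs \<subseteq> {..t} \<and> length xs = d}"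

lemma finite_exponents: "finite (exponents d t)"
  unfolding exponents_def by (rule finite_lists_length_eq) simp

lemma card_exponents: "card (exponents d t) = (t + 1) ^ d"
  unfolding exponents_def by (subst card_lists_length_eq) simp_all

lemma exponents_0: "exponents 0 t = {[]}"
  by (auto simp: exponents_def)

lemma sum_exponents_Suc:
  "(\<Sum>xs\<in>exponents (Suc d) t. h xs) = (\<Sum>a\<le>t. \<Sum>xs\<in>exponents d t. h (a # xs))"
proof -
  have "exponents (Suc d) t = (\<lambda>(a, xs). a # xs) ` ({..t} \<times> exponents d t)"
    by (auto simp: exponents_def image_iff length_Suc_conv)
  then have "(\<Sum>xs\<in>exponents (Suc d) t. h xs) = (\<Sum>(a, xs)\<in>{..t} \<times> exponents d t. h (a # xs))"
    by (simp add: sum.reindex inj_on_def case_prod_unfold)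
  then show ?thesis by (simp add: sum.cartesian_product)
qed

lemma monomial_at_mult:
  "length as = length bs \<Longrightarrow> monomial_at f as * monomial_at f bs = monomial_at f (map2 (+) as bs)"
proof (induction as bs rule: list_induct2)
  case (Cons x xs y ys)
  show ?case using Cons(1) by (simp add: Cons(2)[symmetric] power_add mult_ac)
qed simp

text \<open>Gaussian elimination by induction on the set \<open>J\<close> of equations;
  \<open>I\<close> indexes the unknowns.\<close>

lemma homogeneous_system_solution:
  fixes a :: "'i \<Rightarrow> 'j \<Rightarrow> 'k::field"
  assumes "finite J" "finite I" "card J < card I"
  shows "\<exists>c. (\<exists>i\<in>I. c i \<noteq> 0) \<and> (\<forall>j\<in>J. (\<Sum>i\<in>I. c i * a i j) = 0)"
  using assms
proof (induction J arbitrary: I a rule: finite_induct)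
  case empty
  then have "I \<noteq> {}" by auto
  then show ?case by (intro exI[of _ "\<lambda>_. 1"]) auto
next
  case (insert j J)
  show ?case
  proof (cases "\<forall>i\<in>I. a i j = 0")
    case True
    obtain c where "\<exists>i\<in>I. c i \<noteq> 0" "\<forall>j\<in>J. (\<Sum>i\<in>I. c i * a i j) = 0"
      using insert.IH[of I a] insert.prems insert.hyps by auto
    then show ?thesis using True by (intro exI[of _ c]) auto
  next
    case False
    then obtain i0 where i0: "i0 \<in> I" "a i0 j \<noteq> 0" by auto
    \<comment> \<open>The system after elimination of \<open>i0\<close> through equation
      \<open>j\<close>. The value that \<open>c'\<close> gives to \<open>i0\<close> below is the one
      forced by equation \<open>j\<close>.\<close>
    define a' where "a' i k = a i k - a i j / a i0 j * a i0 k" for i k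
    have "card J < card (I - {i0})" using insert i0 by auto
    then obtain c where c: "\<exists>i\<in>I - {i0}. c i \<noteq> 0" "\<forall>k\<in>J. (\<Sum>i\<in>I - {i0}. c i * a' i k) = 0"
      using insert.IH[of "I - {i0}" a'] insert.prems by auto
    define c' where "c' = c(i0 := - (\<Sum>i\<in>I - {i0}. c i * a i j) / a i0 j)"
    have sum_c': "(\<Sum>i\<in>I. c' i * a i k) = (\<Sum>i\<in>I - {i0}. c i * a' i k)" for k
    proof -
      have "(\<Sum>i\<in>I. c' i * a i k) = c' i0 * a i0 k + (\<Sum>i\<in>I - {i0}. c' i * a i k)"
        using insert.prems i0 by (simp add: sum.remove)
      also have "(\<Sum>i\<in>I - {i0}. c' i * a i k) = (\<Sum>i\<in>I - {i0}. c i * a i k)"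
        by (intro sum.cong) (auto simp: c'_def)
      also have "c' i0 * a i0 k = - (\<Sum>i\<in>I - {i0}. c i * (a i j / a i0 j * a i0 k))"
        by (simp add: c'_def sum_distrib_right sum_divide_distrib mult.assoc)
      finally show ?thesis by (simp add: a'_def right_diff_distrib sum_subtractf)
    qed
    have "(\<Sum>i\<in>I. c' i * a i j) = 0"
      unfolding sum_c' using i0 by (intro sum.neutral) (auto simp: a'_def)
    moreover have "\<exists>i\<in>I. c' i \<noteq> 0" using c(1) by (auto simp: c'_def)
    ultimately show ?thesis using c(2) sum_c' by (intro exI[of _ c']) auto
  qed
qed

definition poly_span :: "nat \<Rightarrow> nat \<Rightarrow> ((nat \<Rightarrow> 'k::comm_ring_1) \<Rightarrow> 'k) set" where
  "poly_span D T = {f. \<exists>c. \<forall>y. f y = (\<Sum>b\<in>exponents D T. c b * monomial_at y b)}"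

lemma poly_span_add:
  assumes "p \<in> poly_span D T" "q \<in> poly_span D T"
  shows "(\<lambda>y. p y + q y) \<in> poly_span D T"
proof -
  from assms(1) obtain c where c: "\<forall>y. p y = (\<Sum>b\<in>exponents D T. c b * monomial_at y b)"
    unfolding poly_span_def by (elim CollectE exE)
  from assms(2) obtain c' where c': "\<forall>y. q y = (\<Sum>b\<in>exponents D T. c' b * monomial_at y b)"
    unfolding poly_span_def by (elim CollectE exE)
  show ?thesis unfolding poly_span_def
    by (intro CollectI exI[of _ "\<lambda>b. c b + c' b"]) (simp add: c c' distrib_right sum.distrib)
qed

lemma poly_span_scale:
  assumes "p \<in> poly_span D T" shows "(\<lambda>y. a * p y) \<in> poly_span D T"
proof -
  from assms obtain c where c: "\<forall>y. p y = (\<Sum>b\<in>exponents D T. c b * monomial_at y b)"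
    unfolding poly_span_def by (elim CollectE exE)
  show ?thesis unfolding poly_span_def
    by (intro CollectI exI[of _ "\<lambda>b. a * c b"]) (simp add: c sum_distrib_left mult.assoc)
qed

lemma poly_span_monomial:
  assumes "b \<in> exponents D T"
  shows "(\<lambda>y. monomial_at y b :: 'a::comm_ring_1) \<in> poly_span D T"
proof -
  have "(\<Sum>x\<in>exponents D T. (if x = b then 1 else 0) * monomial_at y x) =
    (\<Sum>x\<in>exponents D T. if x = b then monomial_at y x else 0)" for y :: "nat \<Rightarrow> 'a"
    by (intro sum.cong) auto
  then show ?thesis using assms finite_exponents unfolding poly_span_def
    by (intro CollectI exI[of _ "\<lambda>x. if x = b then 1 else 0"]) simp
qed

lemma poly_span_zero: "(\<lambda>_. 0) \<in> poly_span D T"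
  unfolding poly_span_def by (intro CollectI exI[of _ "\<lambda>_. 0"]) simp

lemma poly_span_sum: "(\<And>i. i \<in> I \<Longrightarrow> p i \<in> poly_span D T) \<Longrightarrow> (\<lambda>y. \<Sum>i\<in>I. p i y) \<in> poly_span D T"
  by (induction I rule: infinite_finite_induct) (simp_all add: poly_span_zero poly_span_add)

lemma poly_span_mult:
  assumes "p \<in> poly_span D T" "q \<in> poly_span D T'"
  shows "(\<lambda>y. p y * q y) \<in> poly_span D (T + T')"
proof -
  from assms(1) obtain c where c: "\<forall>y. p y = (\<Sum>b\<in>exponents D T. c b * monomial_at y b)"
    unfolding poly_span_def by (elim CollectE exE)
  from assms(2) obtain c' where c': "\<forall>y. q y = (\<Sum>b\<in>exponents D T'. c' b * monomial_at y b)"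
    unfolding poly_span_def by (elim CollectE exE)
  have "(\<lambda>y. \<Sum>b\<in>exponents D T. \<Sum>b'\<in>exponents D T'.
      (c b * c' b') * monomial_at y (map2 (+) b b')) \<in> poly_span D (T + T')"
  proof (intro poly_span_sum poly_span_scale poly_span_monomial)
    fix b b' assume "b \<in> exponents D T" "b' \<in> exponents D T'"
    then show "map2 (+) b b' \<in> exponents D (T + T')"
      by (force simp: exponents_def dest: set_zip_leftD set_zip_rightD intro: add_mono)
  qed
  moreover have "(\<Sum>b\<in>exponents D T. \<Sum>b'\<in>exponents D T'.
      (c b * c' b') * monomial_at y (map2 (+) b b')) = p y * q y" for y
    by (simp add: c c' sum_product)
      (intro sum.cong refl, auto simp: exponents_def monomial_at_mult[symmetric] mult_ac)
  ultimately show ?thesis by simp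
qed

lemma poly_span_one: "(\<lambda>_. 1 :: 'a::comm_ring_1) \<in> poly_span D T"
proof -
  have "monomial_at y (replicate D 0) = 1" for y :: "nat \<Rightarrow> 'a" by (induction D) auto
  moreover have "(\<lambda>y. monomial_at y (replicate D 0) :: 'a) \<in> poly_span D T"
    by (rule poly_span_monomial) (auto simp: exponents_def)
  ultimately show ?thesis by simp
qed

lemma poly_span_var:
  assumes "i < D" "T > 0" shows "(\<lambda>y. y i :: 'a::comm_ring_1) \<in> poly_span D T"
proof -
  define b where "b = rec_nat [] (\<lambda>D xs. (if D = i then 1 else 0 :: nat) # xs)"
  have b: "b 0 = []" "b (Suc D) = (if D = i then 1 else 0) # b D" for D by (simp_all add: b_def)
  have "length (b D) = D \<and> set (b D) \<subseteq> {..1} \<and>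
    (\<forall>y :: nat \<Rightarrow> 'a. monomial_at y (b D) = (if i < D then y i else 1))" for D
    by (induction D) (auto simp: b less_Suc_eq)
  then have len: "length (b D) = D" and set: "set (b D) \<subseteq> {..1}"
    and val: "monomial_at y (b D) = (if i < D then y i else 1)" for y :: "nat \<Rightarrow> 'a" and D by auto
  have "(\<lambda>y. monomial_at y (b D) :: 'a) \<in> poly_span D T"
    by (rule poly_span_monomial) (use assms len set[of D] in \<open>auto simp: exponents_def\<close>)
  then show ?thesis using assms val by simp
qed

lemma poly_span_mono:
  assumes "p \<in> poly_span D T" "T \<le> T'" shows "p \<in> poly_span D T'"
  using poly_span_mult[OF assms(1) poly_span_one, of "T' - T"] assms(2) by simp

lemma poly_fun_in_poly_span:
  assumes "p \<in> poly_fun D" shows "\<exists>T. p \<in> poly_span D T"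
  using assms unfolding poly_fun_def
proof induction
  case (const c)
  show ?case using poly_span_scale[OF poly_span_one, of c] by auto
next
  case (functional l)
  then show ?case using poly_span_var by blast
next
  case (add p q)
  then obtain T T' where "p \<in> poly_span D T" "q \<in> poly_span D T'" by auto
  then have "p \<in> poly_span D (max T T')" "q \<in> poly_span D (max T T')"
    by (simp_all add: poly_span_mono)
  then show ?case using poly_span_add by blast
next
  case (mult p q)
  then show ?case using poly_span_mult by blast
qed

lemma poly_span_power:
  "p \<in> poly_span D T \<Longrightarrow> (\<lambda>y. p y ^ k) \<in> poly_span D (k * T)"
  by (induction k) (auto simp: poly_span_one intro: poly_span_mult)

lemma poly_span_monomial_at:
  assumes "\<And>i. i < length xs \<Longrightarrow> p i \<in> poly_span D T" "set xs \<subseteq> {..t}"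
  shows "(\<lambda>y. monomial_at (\<lambda>i. p i y) xs) \<in> poly_span D (length xs * (t * T))"
  using assms
proof (induction xs)
  case Nil
  show ?case using poly_span_one by simp
next
  case (Cons a xs)
  have "(\<lambda>y. p (length xs) y ^ a) \<in> poly_span D (a * T)"
    using Cons by (intro poly_span_power) auto
  then have "(\<lambda>y. p (length xs) y ^ a) \<in> poly_span D (t * T)"
    by (rule poly_span_mono) (use Cons.prems in auto)
  from poly_span_mult[OF this Cons.IH] Cons.prems show ?case by (simp add: algebra_simps)
qed

lemma power_growth:
  assumes "\<And>t::nat. (t + 1) ^ d \<le> (c * t + 1) ^ D"
  shows "d \<le> D"
proof (rule ccontr)
  assume "\<not> d \<le> D"
  \<comment> \<open>With this choice the constant \<open>(c + 1) ^ D\<close> of the upper bound is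
    \<open>t\<close> itself, which is less than the factor \<open>t + 1\<close> gained from the
    exponent \<open>Suc D\<close>.\<close>
  define t where "t = (c + 1) ^ D"
  have "(t + 1) ^ Suc D \<le> (t + 1) ^ d" using \<open>\<not> d \<le> D\<close> by (intro power_increasing) auto
  also have "\<dots> \<le> (c * t + 1) ^ D" by (rule assms)
  also have "\<dots> \<le> ((c + 1) * (t + 1)) ^ D" by (intro power_mono) (auto simp: algebra_simps)
  also have "\<dots> = t * (t + 1) ^ D" unfolding power_mult_distrib by (simp only: t_def)
  finally have "(t + 1) * (t + 1) ^ D \<le> t * (t + 1) ^ D" by simp
  then show False by simp
qed

text \<open>If the monomials in the fractions \<open>p i / q\<close> are linearly independent, then there are at most
  as many fractions as variables.\<close>

lemma independent_monomials_bound: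
  fixes p :: "nat \<Rightarrow> (nat \<Rightarrow> 'k::field) \<Rightarrow> 'k"
  assumes p: "\<And>i. i < d \<Longrightarrow> p i \<in> poly_fun D" and q: "q \<in> poly_fun D"
    and indep: "\<And>t c. (\<And>y. (\<Sum>xs\<in>exponents d t. c xs *
        (monomial_at (\<lambda>i. p i y) xs * monomial_at (\<lambda>_. q y) (map (\<lambda>a. t - a) xs))) = 0) \<Longrightarrow>
      (\<forall>xs\<in>exponents d t. c xs = 0)"
  shows "d \<le> D"
proof -
  have "\<exists>T. \<forall>i<d. p i \<in> poly_span D T" using p
  proof (induction d)
    case (Suc d)
    then obtain T where T: "\<forall>i<d. p i \<in> poly_span D T" by auto
    obtain T' where T': "p d \<in> poly_span D T'" using poly_fun_in_poly_span Suc.prems by blast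
    have "p i \<in> poly_span D (max T T')" if "i < Suc d" for i
      using T T' that poly_span_mono[of "p i" D T "max T T'"] poly_span_mono[of "p i" D T' "max T T'"]
      by (cases "i = d") auto
    then show ?case by blast
  qed simp
  then obtain T0 where "\<forall>i<d. p i \<in> poly_span D T0" ..
  moreover obtain T1 where "q \<in> poly_span D T1" using poly_fun_in_poly_span q by blast
  moreover define T where "T = max T0 T1"
  ultimately have T: "\<And>i. i < d \<Longrightarrow> p i \<in> poly_span D T" "q \<in> poly_span D T"
    by (auto intro: poly_span_mono)
  show ?thesis
  proof (rule power_growth[of _ "2 * d * T"])
    fix t
    \<comment> \<open>A monomial in the fractions \<open>p i / q\<close>, multiplied by
      \<open>q ^ (t * d)\<close>: an exponent \<open>a\<close> of some \<open>p i\<close> is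
      accompanied by \<open>q ^ (t - a)\<close>. Numerators and denominators each contribute
      exponents of at most \<open>d * t * T\<close>, whence the bound
      \<open>2 * d * T * t\<close>.\<close>
    define F where "F xs y = monomial_at (\<lambda>i. p i y) xs * monomial_at (\<lambda>_. q y) (map (\<lambda>a. t - a) xs)" for xs y
    have "\<exists>c. \<forall>y. F xs y = (\<Sum>b\<in>exponents D (2 * d * T * t). c b * monomial_at y b)"
      if xs: "xs \<in> exponents d t" for xs
    proof -
      have "(\<lambda>y. monomial_at (\<lambda>i. p i y) xs) \<in> poly_span D (length xs * (t * T))"
        by (rule poly_span_monomial_at) (use xs T in \<open>auto simp: exponents_def\<close>)
      moreover have "(\<lambda>y. monomial_at (\<lambda>_. q y) (map (\<lambda>a. t - a) xs)) \<in>
          poly_span D (length (map (\<lambda>a. t - a) xs) * (t * T))"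
        by (rule poly_span_monomial_at) (use T in auto)
      ultimately have "F xs \<in> poly_span D (length xs * (t * T) + length (map (\<lambda>a. t - a) xs) * (t * T))"
        unfolding F_def by (rule poly_span_mult)
      moreover have "length xs * (t * T) + length (map (\<lambda>a. t - a) xs) * (t * T) = 2 * d * T * t"
        using xs by (simp add: exponents_def)
      ultimately have "F xs \<in> poly_span D (2 * d * T * t)" by simp
      then show ?thesis unfolding poly_span_def by (elim CollectE)
    qed
    then have "\<forall>xs. \<exists>c. xs \<in> exponents d t \<longrightarrow>
      (\<forall>y. F xs y = (\<Sum>b\<in>exponents D (2 * d * T * t). c b * monomial_at y b))" by simp
    from choice[OF this] obtain a where a: "\<And>xs y. xs \<in> exponents d t \<Longrightarrow>
      F xs y = (\<Sum>b\<in>exponents D (2 * d * T * t). a xs b * monomial_at y b)" by auto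
    show "(t + 1) ^ d \<le> (2 * d * T * t + 1) ^ D"
    proof (rule ccontr)
      assume "\<not> (t + 1) ^ d \<le> (2 * d * T * t + 1) ^ D"
      then have "card (exponents D (2 * d * T * t)) < card (exponents d t)"
        by (simp add: card_exponents)
      from homogeneous_system_solution[OF finite_exponents finite_exponents this, of a] obtain c where
        c: "\<exists>xs\<in>exponents d t. c xs \<noteq> 0"
          "\<forall>b\<in>exponents D (2 * d * T * t). (\<Sum>xs\<in>exponents d t. c xs * a xs b) = 0" by (elim exE conjE)
      have "(\<Sum>xs\<in>exponents d t. c xs * F xs y) = 0" for y
      proof -
        have "(\<Sum>xs\<in>exponents d t. c xs * F xs y) =
          (\<Sum>xs\<in>exponents d t. \<Sum>b\<in>exponents D (2 * d * T * t). c xs * a xs b * monomial_at y b)"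
          by (intro sum.cong refl) (simp add: a sum_distrib_left mult.assoc)
        also have "\<dots> = (\<Sum>b\<in>exponents D (2 * d * T * t). (\<Sum>xs\<in>exponents d t. c xs * a xs b) * monomial_at y b)"
          by (subst sum.swap) (simp add: sum_distrib_right)
        also have "\<dots> = 0" using c(2) by (intro sum.neutral) simp
        finally show ?thesis .
      qed
      then have "\<forall>xs\<in>exponents d t. c xs = 0" using indep[where t = t and c = c] by (simp add: F_def)
      then show False using c(1) by blast
    qed
  qed
qed

section \<open>Polynomial functions on irreducible closed sets\<close>

lemma functionals_on_line:
  assumes "vector_space s" "l \<in> functionals s"
  shows "\<exists>q. \<forall>t. l (x + s t v) = poly q t"
proof -
  have "Vector_Spaces.linear s (*) l" using assms by (simp add: functionals_def)
  then have "l (x + s t v) = l x + t * l v" for t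
    by (simp add: linear_iff_module_hom module_hom.add module_hom.scale)
  then show ?thesis by (intro exI[of _ "[:l x, l v:]"]) (simp add: mult.commute)
qed

lemma function_ring_polynomials [intro!]: "function_ring (polynomials s)"
  unfolding polynomials_def by blast

interpretation PW: function_ring "polynomials s" for s by blast

lemma functional_in_polynomials: "l \<in> functionals s \<Longrightarrow> l \<in> polynomials s"
  unfolding polynomials_def by (rule generated_functions.functional)

text \<open>The coordinate ring of an irreducible set has no zero divisors: the zero sets of
  \<open>p\<close> and \<open>q\<close> cover \<open>V\<close>, and \<open>z\<close> excludes the
  second one.\<close>

lemma zariski_irreducible_mult:
  assumes V: "zariski_irreducible s V" and p: "p \<in> polynomials s" and q: "q \<in> polynomials s"
    and pq: "\<And>x. x \<in> V \<Longrightarrow> p x * q x = 0"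
    and nz: "z \<in> V" "q z \<noteq> 0" and x: "x \<in> V"
  shows "p (x :: 'w::ab_group_add) = (0 :: 'k::field)"
proof -
  have closed: "zariski_closed s {x. p x = 0}" if "p \<in> polynomials s" for p
    unfolding zariski_closed_def using that by (intro exI[of _ "{p}"]) auto
  have "V \<subseteq> {x. p x = 0} \<union> {x. q x = 0}" using pq by auto
  then have "V \<subseteq> {x. p x = 0} \<or> V \<subseteq> {x. q x = 0}"
    using V closed[OF p] closed[OF q] unfolding zariski_irreducible_def by blast
  then show ?thesis using nz x by auto
qed

text \<open>A relation \<open>\<Sum> f ^ a * g a = 0\<close> on \<open>V\<close> reduces to
  \<open>g 0 = 0\<close> on \<open>C\<close>, where \<open>f\<close> vanishes. The hypothesis on
  \<open>g\<close> carries this over to \<open>V\<close>; then one factor \<open>f\<close> can be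
  cancelled, as \<open>V\<close> is irreducible, and the argument is repeated with the shifted
  coefficients.\<close>

lemma vanishing_coefficients:
  assumes V: "zariski_irreducible s V" and f: "f \<in> polynomials s" and g: "\<And>a. g a \<in> polynomials s"
    and C: "C \<subseteq> V" "\<And>x. x \<in> C \<Longrightarrow> f x = 0" and z: "z \<in> V" "f z \<noteq> 0"
    and ext: "\<And>a. (\<And>x. x \<in> C \<Longrightarrow> g a x = 0) \<Longrightarrow> (\<And>x. x \<in> V \<Longrightarrow> g a x = 0)"
    and sum: "\<And>x. x \<in> V \<Longrightarrow> (\<Sum>a\<le>t. f x ^ a * g a x) = 0"
  shows "a \<le> t \<Longrightarrow> x \<in> C \<Longrightarrow> g a x = (0 :: 'k::field)"
  using g ext sum
proof (induction t arbitrary: a x g)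
  case 0
  then show ?case using C by auto
next
  case (Suc t)
  have g0: "g 0 y = 0" if "y \<in> C" for y
  proof -
    have "(\<Sum>a\<le>Suc t. f y ^ a * g a y) = g 0 y"
      using C(2)[OF that] by (simp add: sum.atMost_Suc_shift del: sum.atMost_Suc)
    then show ?thesis using Suc.prems(5)[of y] C(1) that by auto
  qed
  then have g0V: "g 0 y = 0" if "y \<in> V" for y using Suc.prems(4)[of 0] that by blast
  have "(\<Sum>a\<le>t. f y ^ a * g (Suc a) y) = 0" if "y \<in> V" for y
  proof (rule zariski_irreducible_mult[OF V _ f _ z that, where p = "\<lambda>y. \<Sum>a\<le>t. f y ^ a * g (Suc a) y"])
    show "(\<lambda>y. \<Sum>a\<le>t. f y ^ a * g (Suc a) y) \<in> polynomials s"
      by (intro PW.sum PW.mult PW.power f Suc.prems)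
    fix y assume y: "y \<in> V"
    have "(\<Sum>a\<le>Suc t. f y ^ a * g a y) = (\<Sum>a\<le>t. f y ^ a * g (Suc a) y) * f y"
      using g0V[OF y] by (simp add: sum.atMost_Suc_shift sum_distrib_left mult.assoc mult.commute[of _ "f y"] del: sum.atMost_Suc)
    then show "(\<Sum>a\<le>t. f y ^ a * g (Suc a) y) * f y = 0" using Suc.prems(5)[OF y] by simp
  qed
  then have IH: "b \<le> t \<Longrightarrow> y \<in> C \<Longrightarrow> g (Suc b) y = 0" for b y
    using Suc.IH[of b y "\<lambda>a. g (Suc a)"] Suc.prems(3,4) by blast
  show ?case
  proof (cases a)
    case 0
    then show ?thesis using g0 Suc.prems by simp
  next
    case (Suc b)
    then show ?thesis using IH[of b x] Suc.prems by simp
  qed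
qed

lemma polynomials_monomial_at:
  assumes "\<And>i. i < length xs \<Longrightarrow> f i \<in> polynomials s"
  shows "(\<lambda>x. monomial_at (\<lambda>i. f i x) xs) \<in> polynomials s"
  using assms by (induction xs) (auto intro!: PW.mult PW.power)

text \<open>Functions \<open>f i\<close> that vanish on \<open>C i\<close> but not on \<open>C (i + 1)\<close> are algebraically independent on the
  top member of a chain of irreducible closed sets.\<close>

lemma chain_independent:
  assumes "\<And>i. i \<le> d \<Longrightarrow> zariski_irreducible s (C i)" "\<And>i. i < d \<Longrightarrow> C i \<subseteq> C (Suc i)"
    and "\<And>i. i < d \<Longrightarrow> f i \<in> polynomials s"
    and "\<And>i x. i < d \<Longrightarrow> x \<in> C i \<Longrightarrow> f i x = 0" "\<And>i. i < d \<Longrightarrow> \<exists>x\<in>C (Suc i). f i x \<noteq> 0"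
    and "\<And>x. x \<in> C d \<Longrightarrow> (\<Sum>xs\<in>exponents d t. c xs * monomial_at (\<lambda>i. f i x) xs) = (0 :: 'k::field)"
    and "xs \<in> exponents d t"
  shows "c xs = 0"
  using assms
proof (induction d arbitrary: c xs)
  case 0
  obtain x where "x \<in> C 0" using 0(1)[of 0] by (auto simp: zariski_irreducible_def)
  then show ?case using 0(6)[of x] 0(7) by (simp add: exponents_0)
next
  case (Suc d)
  \<comment> \<open>The relation is sorted by powers of the newest function \<open>f d\<close>,
    whose exponent is the head of the list. The coefficients \<open>g a\<close> involve only the
    earlier functions.\<close>
  define g where "g a = (\<lambda>x. \<Sum>xs\<in>exponents d t. c (a # xs) * monomial_at (\<lambda>i. f i x) xs)" for a
  obtain z where z: "z \<in> C (Suc d)" "f d z \<noteq> 0" using Suc.prems(5)[of d] by auto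
  have IH: "c (a # ys) = 0" if "\<And>x. x \<in> C d \<Longrightarrow> g a x = 0" "ys \<in> exponents d t" for a ys
    by (rule Suc.IH[of "\<lambda>ys. c (a # ys)"]) (use that Suc.prems in \<open>auto simp: g_def\<close>)
  obtain a ys where xs: "xs = a # ys" "a \<le> t" "ys \<in> exponents d t"
    using Suc.prems(7) by (auto simp: exponents_def length_Suc_conv)
  have "g a x = 0" if "x \<in> C d" for x
  proof (rule vanishing_coefficients[of s "C (Suc d)" "f d" g "C d" z t])
    show "g a \<in> polynomials s" for a unfolding g_def
      by (intro PW.sum PW.mult PW.const polynomials_monomial_at) (auto simp: exponents_def intro: Suc.prems)
    \<comment> \<open>By the induction hypothesis on \<open>C d\<close>, a coefficient that vanishes
      on \<open>C d\<close> has only zero scalars, so it vanishes everywhere.\<close>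
    show "g a y = 0" if "\<And>x. x \<in> C d \<Longrightarrow> g a x = 0" for a y
      unfolding g_def using IH[OF that] by simp
    fix y assume y: "y \<in> C (Suc d)"
    have "(\<Sum>a\<le>t. f d y ^ a * g a y) = (\<Sum>xs\<in>exponents (Suc d) t. c xs * monomial_at (\<lambda>i. f i y) xs)"
      unfolding sum_exponents_Suc g_def
      by (intro sum.cong refl) (simp add: sum_distrib_left exponents_def mult_ac)
    then show "(\<Sum>a\<le>t. f d y ^ a * g a y) = 0" using Suc.prems(6)[OF y] by simp
  qed (use Suc.prems z xs that in auto)
  then show ?case using IH xs by blast
qed

section \<open>Bounds for the Krull dimension\<close>

text \<open>A chain of length \<open>d\<close> gives \<open>d\<close> functions that are independent
  on its top member. Near a point of that member the chart pulls them back to fractions in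
  \<open>D\<close> variables with a common denominator, which remain independent, so
  \<open>d \<le> D\<close> by counting.\<close>

lemma zariski_dim_le:
  fixes V :: "'w::ab_group_add set" and s :: "'k::alg_closed_field \<Rightarrow> 'w \<Rightarrow> 'w"
  assumes chart: "\<And>x0. x0 \<in> V \<Longrightarrow> \<exists>(\<phi> :: (nat \<Rightarrow> 'k) \<Rightarrow> 'w) \<delta> h. h \<in> polynomials s \<and> h x0 \<noteq> 0 \<and>
      \<delta> \<in> poly_fun D \<and> (\<forall>x\<in>V. h x \<noteq> 0 \<longrightarrow> (\<exists>y. \<delta> y \<noteq> 0 \<and> \<phi> y = x)) \<and>
      (\<forall>f\<in>polynomials s. \<exists>e. \<exists>p\<in>poly_fun D. \<forall>y. \<delta> y \<noteq> 0 \<longrightarrow> p y = \<delta> y ^ e * f (\<phi> y))"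
  shows "zariski_dim s V \<le> enat D"
  unfolding zariski_dim_def
proof (rule Sup_least)
  fix m assume "m \<in> {enat d | d. \<exists>C. (\<forall>i\<le>d. zariski_closed s (C i) \<and> zariski_irreducible s (C i) \<and> C i \<subseteq> V) \<and>
     (\<forall>i<d. C i \<subset> C (Suc i))}"
  then obtain d C where m: "m = enat d" and
    C': "\<forall>i\<le>d. zariski_closed s (C i) \<and> zariski_irreducible s (C i) \<and> C i \<subseteq> V" "\<forall>i<d. C i \<subset> C (Suc i)"
    by (elim CollectE exE conjE)
  then have C: "\<And>i. i \<le> d \<Longrightarrow> zariski_closed s (C i)" "\<And>i. i \<le> d \<Longrightarrow> zariski_irreducible s (C i)"
    "\<And>i. i \<le> d \<Longrightarrow> C i \<subseteq> V" "\<And>i. i < d \<Longrightarrow> C i \<subset> C (Suc i)" by simp_all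
  have "\<exists>p. i < d \<longrightarrow> p \<in> polynomials s \<and> (\<forall>x\<in>C i. p x = 0) \<and> (\<exists>x\<in>C (Suc i). p x \<noteq> 0)" for i
  proof (cases "i < d")
    case i: True
    obtain P where P: "P \<subseteq> polynomials s" "C i = {x. \<forall>p\<in>P. p x = 0}"
      using C(1)[of i] i unfolding zariski_closed_def by auto
    obtain x where x: "x \<in> C (Suc i)" "x \<notin> C i" using C(4)[OF i] by auto
    then obtain p where "p \<in> P" "p x \<noteq> 0" using P(2) by auto
    then show ?thesis using P x by (intro exI[of _ p]) auto
  qed simp
  then have "\<forall>i. \<exists>p. i < d \<longrightarrow> p \<in> polynomials s \<and> (\<forall>x\<in>C i. p x = 0) \<and> (\<exists>x\<in>C (Suc i). p x \<noteq> 0)" by (rule allI)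
  from choice[OF this] obtain f where
    "\<forall>i. i < d \<longrightarrow> f i \<in> polynomials s \<and> (\<forall>x\<in>C i. f i x = 0) \<and> (\<exists>x\<in>C (Suc i). f i x \<noteq> 0)" ..
  then have f: "\<And>i. i < d \<Longrightarrow> f i \<in> polynomials s"
    "\<And>i x. i < d \<Longrightarrow> x \<in> C i \<Longrightarrow> f i x = 0" "\<And>i. i < d \<Longrightarrow> \<exists>x\<in>C (Suc i). f i x \<noteq> 0" by simp_all
  obtain x0 where x0: "x0 \<in> C d" using C(2)[of d] by (auto simp: zariski_irreducible_def)
  then have "x0 \<in> V" using C(3)[of d] by auto
  from chart[OF this] obtain \<phi> :: "(nat \<Rightarrow> 'k) \<Rightarrow> 'w" and \<delta> h where h: "h \<in> polynomials s" "h x0 \<noteq> 0"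
    and \<delta>: "\<delta> \<in> poly_fun D" and onto: "\<forall>x\<in>V. h x \<noteq> 0 \<longrightarrow> (\<exists>y. \<delta> y \<noteq> 0 \<and> \<phi> y = x)"
    and pull: "\<forall>f\<in>polynomials s. \<exists>e. \<exists>p\<in>poly_fun D. \<forall>y. \<delta> y \<noteq> 0 \<longrightarrow> p y = \<delta> y ^ e * f (\<phi> y)"
    by (elim exE conjE)
  have "\<exists>e. i < d \<longrightarrow> (\<exists>p\<in>poly_fun D. \<forall>y. \<delta> y \<noteq> 0 \<longrightarrow> p y = \<delta> y ^ e * f i (\<phi> y))" for i
    using bspec[OF pull f(1)[of i]] by (cases "i < d") simp_all
  then have "\<forall>i. \<exists>e. i < d \<longrightarrow> (\<exists>p\<in>poly_fun D. \<forall>y. \<delta> y \<noteq> 0 \<longrightarrow> p y = \<delta> y ^ e * f i (\<phi> y))"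
    by (rule allI)
  from choice[OF this] obtain e where e: "\<forall>i. i < d \<longrightarrow> (\<exists>p\<in>poly_fun D. \<forall>y. \<delta> y \<noteq> 0 \<longrightarrow> p y = \<delta> y ^ e i * f i (\<phi> y))" ..
  \<comment> \<open>One exponent for all functions: the sum is at least every
    \<open>e i\<close>.\<close>
  define E where "E = (\<Sum>i<d. e i)"
  have "\<exists>p. i < d \<longrightarrow> p \<in> poly_fun D \<and> (\<forall>y. \<delta> y \<noteq> 0 \<longrightarrow> p y = \<delta> y ^ E * f i (\<phi> y))" for i
  proof (cases "i < d")
    case True
    with e have "\<exists>p\<in>poly_fun D. \<forall>y. \<delta> y \<noteq> 0 \<longrightarrow> p y = \<delta> y ^ e i * f i (\<phi> y)" by simp
    then obtain p where p: "p \<in> poly_fun D" "\<forall>y. \<delta> y \<noteq> 0 \<longrightarrow> p y = \<delta> y ^ e i * f i (\<phi> y)" ..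
    have "E = (E - e i) + e i" unfolding E_def using True member_le_sum[of i "{..<d}" e] by simp
    then have E: "\<delta> y ^ E = \<delta> y ^ (E - e i) * \<delta> y ^ e i" for y by (metis power_add)
    show ?thesis
      by (intro exI[of _ "\<lambda>y. \<delta> y ^ (E - e i) * p y"] impI conjI PF.mult PF.power \<delta> p allI) (simp add: p(2) E)
  qed simp
  then have "\<forall>i. \<exists>p. i < d \<longrightarrow> p \<in> poly_fun D \<and> (\<forall>y. \<delta> y \<noteq> 0 \<longrightarrow> p y = \<delta> y ^ E * f i (\<phi> y))" by (rule allI)
  from choice[OF this] obtain p where
    "\<forall>i. i < d \<longrightarrow> p i \<in> poly_fun D \<and> (\<forall>y. \<delta> y \<noteq> 0 \<longrightarrow> p i y = \<delta> y ^ E * f i (\<phi> y))" ..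
  then have p: "\<And>i. i < d \<Longrightarrow> p i \<in> poly_fun D"
    "\<And>i y. i < d \<Longrightarrow> \<delta> y \<noteq> 0 \<Longrightarrow> p i y = \<delta> y ^ E * f i (\<phi> y)" by simp_all
  have "d \<le> D"
  proof (rule independent_monomials_bound[OF p(1) PF.power[OF \<delta>, of E]])
    fix t c assume zero: "\<And>y. (\<Sum>xs\<in>exponents d t. c xs *
        (monomial_at (\<lambda>i. p i y) xs * monomial_at (\<lambda>_. \<delta> y ^ E) (map (\<lambda>a. t - a) xs))) = 0"
    define G where "G = (\<lambda>x. \<Sum>xs\<in>exponents d t. c xs * monomial_at (\<lambda>i. f i x) xs)"
    have G0: "G x = 0" if x: "x \<in> C d" "h x \<noteq> 0" for x
    proof -
      obtain y where y: "\<delta> y \<noteq> 0" "\<phi> y = x" using onto x C(3)[of d] by auto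
      \<comment> \<open>An exponent \<open>a\<close> brings the factor
        \<open>(\<delta> y ^ E) ^ a\<close> and its complement brings
        \<open>(\<delta> y ^ E) ^ (t - a)\<close>, so all monomials of the same length are scaled by
        the same power.\<close>
      have "monomial_at (\<lambda>i. p i y) xs * monomial_at (\<lambda>_. \<delta> y ^ E) (map (\<lambda>a. t - a) xs) =
        (\<delta> y ^ E) ^ (t * length xs) * monomial_at (\<lambda>i. f i x) xs"
        if "length xs \<le> d" "set xs \<subseteq> {..t}" for xs using that
      proof (induction xs)
        case (Cons a xs)
        have "(\<delta> y ^ E) ^ t = (\<delta> y ^ E) ^ a * (\<delta> y ^ E) ^ (t - a)"
          using Cons.prems by (simp add: power_add[symmetric])
        then show ?case using Cons p(2)[of "length xs" y] y
          by (simp add: power_mult_distrib power_add mult_ac)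
      qed simp
      then have "(\<Sum>xs\<in>exponents d t. c xs *
          (monomial_at (\<lambda>i. p i y) xs * monomial_at (\<lambda>_. \<delta> y ^ E) (map (\<lambda>a. t - a) xs))) =
        (\<Sum>xs\<in>exponents d t. (\<delta> y ^ E) ^ (t * d) * (c xs * monomial_at (\<lambda>i. f i x) xs))"
        by (intro sum.cong refl) (auto simp: exponents_def mult_ac)
      also have "\<dots> = (\<delta> y ^ E) ^ (t * d) * G x" by (simp add: G_def sum_distrib_left)
      finally show ?thesis using zero[of y] y(1) by auto
    qed
    \<comment> \<open>So far the relation is known only where \<open>h\<close> is nonzero;
      irreducibility of \<open>C d\<close> extends it to all of \<open>C d\<close>.\<close>
    have "G x = 0" if x: "x \<in> C d" for x
    proof (rule zariski_irreducible_mult[OF C(2)[of d] _ h(1) _ x0 h(2) x, where p = G])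
      show "G \<in> polynomials s" unfolding G_def
        by (intro PW.sum PW.mult PW.const polynomials_monomial_at) (auto simp: exponents_def intro: f)
      show "G x * h x = 0" if "x \<in> C d" for x using G0[OF that] by auto
    qed simp
    then have *: "\<And>x. x \<in> C d \<Longrightarrow> (\<Sum>xs\<in>exponents d t. c xs * monomial_at (\<lambda>i. f i x) xs) = 0"
      by (simp add: G_def)
    show "\<forall>xs\<in>exponents d t. c xs = 0"
      by (intro ballI chain_independent[where d = d and C = C and f = f and t = t and c = c, OF C(2) psubset_imp_subset[OF C(4)] f(1) f(2) f(3) *])
  qed
  then show "m \<le> enat D" by (simp add: m)
qed

text \<open>\<open>C i\<close> is the closure of the image under \<open>\<phi>\<close> of the part
  of the linear space \<open>L i\<close> where \<open>\<delta>\<close> is nonzero. It is irreducible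
  since a linear space is. The inclusions are strict because \<open>\<phi>\<close> is its own
  inverse: the function \<open>l i\<close> of \<open>\<phi>\<close>, freed of denominators,
  separates \<open>C (Suc i)\<close> from \<open>C i\<close>.\<close>

lemma zariski_dim_ge:
  fixes V :: "'w::ab_group_add set" and s :: "'k::alg_closed_field \<Rightarrow> 'w \<Rightarrow> 'w"
  assumes vs: "vector_space s" and V: "zariski_closed s V"
    and \<delta>: "\<delta> \<in> polynomials s" "\<delta> 0 \<noteq> 0"
    and pull: "\<And>f. f \<in> polynomials s \<Longrightarrow>
      \<exists>e. \<exists>p\<in>polynomials s. \<forall>x. \<delta> x \<noteq> 0 \<longrightarrow> p x = \<delta> x ^ e * f (\<phi> x)"
    and L: "\<And>i. i \<le> D \<Longrightarrow> module.subspace s (L i)" "\<And>i. i < D \<Longrightarrow> L i \<subseteq> L (Suc i)"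
    and l: "\<And>i. i < D \<Longrightarrow> l i \<in> functionals s" "\<And>i x. i < D \<Longrightarrow> x \<in> L i \<Longrightarrow> l i x = 0"
      "\<And>i. i < D \<Longrightarrow> \<exists>v\<in>L (Suc i). l i v \<noteq> 0"
    and \<phi>: "\<And>x. x \<in> L D \<Longrightarrow> \<delta> x \<noteq> 0 \<Longrightarrow> \<phi> x \<in> V \<and> \<delta> (\<phi> x) \<noteq> 0 \<and> \<phi> (\<phi> x) = x"
  shows "enat D \<le> zariski_dim s V"
proof -
  interpret vector_space s by (rule vs)
  have LD: "i \<le> D \<Longrightarrow> L i \<subseteq> L D" for i
    by (rule inc_induct[of i D]) (use L(2) in auto)
  define I where "I i = {p \<in> polynomials s. \<forall>x\<in>L i. \<delta> x \<noteq> 0 \<longrightarrow> p (\<phi> x) = 0}" for i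
  define C where "C i = {w. \<forall>p\<in>I i. p w = 0}" for i
  have closed: "zariski_closed s (C i)" for i
    unfolding zariski_closed_def C_def by (intro exI[of _ "I i"] conjI refl) (simp add: I_def subset_iff)
  have \<phi>C: "\<phi> x \<in> C i" if "x \<in> L i" "\<delta> x \<noteq> 0" for x i using that by (auto simp: C_def I_def)
  \<comment> \<open>The line through \<open>a\<close> and \<open>b\<close> lies in
    \<open>L i\<close>, and on it neither \<open>p\<close> nor \<open>q\<close> is identically
    zero.\<close>
  have common: "\<exists>x\<in>L i. p x \<noteq> 0 \<and> q x \<noteq> 0"
    if i: "i \<le> D" and pq: "p \<in> polynomials s" "q \<in> polynomials s" and ab: "a \<in> L i" "p a \<noteq> 0" "b \<in> L i" "q b \<noteq> 0"
    for p q a b i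
  proof -
    have "\<exists>t. p (a + s t (b - a)) \<noteq> 0 \<and> q (a + s t (b - a)) \<noteq> 0"
      by (rule common_nonzero_on_curve[where \<gamma> = "\<lambda>t. a + s t (b - a)" and a = 0 and b = 1,
          OF pq[unfolded polynomials_def]])
        (use ab in \<open>auto intro: functionals_on_line[OF vs]\<close>)
    then obtain t where "p (a + s t (b - a)) \<noteq> 0" "q (a + s t (b - a)) \<noteq> 0" by auto
    moreover have "a + s t (b - a) \<in> L i"
      using L(1)[OF i] ab by (intro subspace_add subspace_scale subspace_diff) auto
    ultimately show ?thesis by blast
  qed
  have irr: "zariski_irreducible s (C i)" if i: "i \<le> D" for i
    unfolding zariski_irreducible_def
  proof (intro conjI allI impI)
    have "0 \<in> L i" using L(1)[OF i] by (rule subspace_0)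
    then show "C i \<noteq> {}" using \<phi>C[of 0 i] \<delta>(2) by auto
    fix S T assume S: "zariski_closed s S" and T: "zariski_closed s T" and sub: "C i \<subseteq> S \<union> T"
    show "C i \<subseteq> S \<or> C i \<subseteq> T"
    proof (rule ccontr)
      assume neg: "\<not> (C i \<subseteq> S \<or> C i \<subseteq> T)"
      have ex: "\<exists>p\<in>polynomials s. (\<forall>x\<in>S. p x = 0) \<and> (\<exists>x\<in>L i. \<delta> x \<noteq> 0 \<and> p (\<phi> x) \<noteq> 0)"
        if "zariski_closed s S" "\<not> C i \<subseteq> S" for S
      proof -
        obtain P where P: "P \<subseteq> polynomials s" "S = {x. \<forall>p\<in>P. p x = 0}"
          using \<open>zariski_closed s S\<close> unfolding zariski_closed_def by auto
        obtain w where w: "w \<in> C i" "w \<notin> S" using \<open>\<not> C i \<subseteq> S\<close> by auto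
        then have "\<exists>p\<in>P. p w \<noteq> 0" using P(2) by simp
        then obtain p where p: "p \<in> P" "p w \<noteq> 0" ..
        then have pp: "p \<in> polynomials s" using P(1) by auto
        have "p \<notin> I i" using w(1) p(2) by (auto simp: C_def)
        then have "\<exists>x\<in>L i. \<delta> x \<noteq> 0 \<and> p (\<phi> x) \<noteq> 0" using pp by (simp add: I_def)
        then show ?thesis using P(2) p(1) by (intro bexI[OF _ pp] conjI) simp_all
      qed
      have nST: "\<not> C i \<subseteq> S" "\<not> C i \<subseteq> T" using neg by simp_all
      from ex[OF S nST(1)] obtain f x where f: "f \<in> polynomials s" "\<forall>x\<in>S. f x = 0" "x \<in> L i" "\<delta> x \<noteq> 0" "f (\<phi> x) \<noteq> 0"
        by (elim bexE conjE)
      from ex[OF T nST(2)] obtain g y where g: "g \<in> polynomials s" "\<forall>x\<in>T. g x = 0" "y \<in> L i" "\<delta> y \<noteq> 0" "g (\<phi> y) \<noteq> 0"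
        by (elim bexE conjE)
      from pull[OF f(1)] obtain e p
        where p: "p \<in> polynomials s" "\<forall>x. \<delta> x \<noteq> 0 \<longrightarrow> p x = \<delta> x ^ e * f (\<phi> x)" by (elim exE bexE)
      from pull[OF g(1)] obtain e' q
        where q: "q \<in> polynomials s" "\<forall>x. \<delta> x \<noteq> 0 \<longrightarrow> q x = \<delta> x ^ e' * g (\<phi> x)" by (elim exE bexE)
      have "\<exists>z\<in>L i. \<delta> z * p z \<noteq> 0 \<and> q z \<noteq> 0"
        by (rule common[OF i PW.mult[OF \<delta>(1) p(1)] q(1) f(3) _ g(3)]) (use f g p q in auto)
      then obtain z where z: "z \<in> L i" "\<delta> z \<noteq> 0" "p z \<noteq> 0" "q z \<noteq> 0" by auto
      then have "f (\<phi> z) \<noteq> 0" "g (\<phi> z) \<noteq> 0" using p(2) q(2) by auto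
      moreover have "\<phi> z \<in> S \<union> T" using \<phi>C[OF z(1,2)] sub by auto
      ultimately show False using f(2) g(2) by auto
    qed
  qed
  have CV: "C i \<subseteq> V" if i: "i \<le> D" for i
  proof -
    obtain P where P: "P \<subseteq> polynomials s" "V = {x. \<forall>p\<in>P. p x = 0}"
      using V unfolding zariski_closed_def by auto
    have "P \<subseteq> I i"
    proof
      fix p assume p: "p \<in> P"
      have "p (\<phi> x) = 0" if "x \<in> L i" "\<delta> x \<noteq> 0" for x
      proof -
        have "\<phi> x \<in> V" using \<phi>[of x] LD[OF i] that by auto
        then show ?thesis using P(2) p by auto
      qed
      then show "p \<in> I i" using p P(1) by (auto simp: I_def)
    qed
    then show ?thesis unfolding P(2) C_def by auto
  qed
  have strict: "C i \<subset> C (Suc i)" if i: "i < D" for i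
  proof -
    have "I (Suc i) \<subseteq> I i" using L(2)[OF i] by (auto simp: I_def)
    then have "C i \<subseteq> C (Suc i)" by (auto simp: C_def)
    moreover have "\<exists>w\<in>C (Suc i). w \<notin> C i"
    proof -
      from pull[OF functional_in_polynomials[OF l(1)[OF i]]] obtain e p
        where p: "p \<in> polynomials s" "\<forall>x. \<delta> x \<noteq> 0 \<longrightarrow> p x = \<delta> x ^ e * l i (\<phi> x)" by (elim exE bexE)
      \<comment> \<open>At \<open>\<phi> x\<close> the polynomial \<open>p\<close> has the value
        \<open>l i (\<phi> (\<phi> x)) = l i x\<close> up to a power of the nonzero number
        \<open>\<delta> (\<phi> x)\<close>.\<close>
      have val: "\<delta> (\<phi> x) * p (\<phi> x) = 0 \<longleftrightarrow> l i x = 0" if "x \<in> L D" "\<delta> x \<noteq> 0" for x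
        using \<phi>[OF that] p(2) by auto
      have "(\<lambda>w. \<delta> w * p w) \<in> I i"
        unfolding I_def
      proof (intro CollectI conjI ballI impI PW.mult \<delta>(1) p(1))
        fix x assume x: "x \<in> L i" "\<delta> x \<noteq> 0"
        then have "x \<in> L D" using LD[of i] i by auto
        then show "\<delta> (\<phi> x) * p (\<phi> x) = 0" using val[of x] x l(2)[OF i x(1)] by blast
      qed
      obtain v where v: "v \<in> L (Suc i)" "l i v \<noteq> 0" using l(3)[OF i] by auto
      have "0 \<in> L (Suc i)" using L(1)[of "Suc i"] i by (intro subspace_0) auto
      from common[OF _ \<delta>(1) functional_in_polynomials[OF l(1)[OF i]] this \<delta>(2) v] i
      obtain z where z: "z \<in> L (Suc i)" "\<delta> z \<noteq> 0" "l i z \<noteq> 0" by auto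
      have nz: "\<delta> (\<phi> z) * p (\<phi> z) \<noteq> 0" using val[of z] z LD[of "Suc i"] i by auto
      have "\<phi> z \<notin> C i"
      proof
        assume "\<phi> z \<in> C i"
        then have "\<forall>q\<in>I i. q (\<phi> z) = 0" by (simp add: C_def)
        from bspec[OF this \<open>(\<lambda>w. \<delta> w * p w) \<in> I i\<close>] show False using nz by simp
      qed
      then show ?thesis using \<phi>C[OF z(1,2)] by auto
    qed
    ultimately show ?thesis by auto
  qed
  show ?thesis unfolding zariski_dim_def
    by (rule Sup_upper, rule CollectI, rule exI[of _ D], rule conjI[OF refl], rule exI[of _ C])
      (simp add: closed irr CV strict)
qed

section \<open>Central simple algebras over the algebraic closure\<close>

text \<open>The factors \<open>0\<close> and \<open>-1\<close> supply zero and negatives, so a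
  nonempty set of this kind is an ideal.\<close>

definition two_sided :: "'a::ring_1 set \<Rightarrow> bool" where
  "two_sided I \<longleftrightarrow> (\<forall>u\<in>I. \<forall>v\<in>I. u + v \<in> I) \<and> (\<forall>u\<in>I. \<forall>x y. x * u * y \<in> I)"

definition simple_ring :: "'a::ring_1 itself \<Rightarrow> bool" where
  "simple_ring _ \<longleftrightarrow> (\<forall>I :: 'a set. two_sided I \<longrightarrow> (\<exists>u\<in>I. u \<noteq> 0) \<longrightarrow> 1 \<in> I)"

lemma simple_ringD:
  "simple_ring TYPE('a::ring_1) \<Longrightarrow> two_sided (I :: 'a set) \<Longrightarrow> u \<in> I \<Longrightarrow> u \<noteq> 0 \<Longrightarrow> 1 \<in> I"
  unfolding simple_ring_def by auto

lemma ring_ring_of_type_algebra: "ring (ring_of_type_algebra :: 'a::ring_1 ring)"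
proof -
  have "\<exists>y. x + y = 0" for x :: 'a by (rule exI[of _ "- x"]) simp
  then show ?thesis
    unfolding ring_of_type_algebra_def
    by unfold_locales (auto simp: algebra_simps Units_def)
qed

lemma ideal_ring_of_type_algebra:
  assumes I: "two_sided (I :: 'a::ring_1 set)" and "u \<in> I"
  shows "ideal I (ring_of_type_algebra :: 'a ring)"
proof (rule idealI[OF ring_ring_of_type_algebra])
  have add: "a + b \<in> I" and mult: "x * a * y \<in> I" if "a \<in> I" "b \<in> I" for a b x y
    using I that by (auto simp: two_sided_def)
  have "0 \<in> I" using mult[OF assms(2,2), of 0 0] by simp
  moreover have minv: "- a \<in> I" if "a \<in> I" for a using mult[OF that that, of "-1" 1] by simp
  moreover have "inv\<^bsub>add_monoid ring_of_type_algebra\<^esub> a = - a" for a :: 'a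
  proof -
    interpret ring "ring_of_type_algebra :: 'a ring" by (rule ring_ring_of_type_algebra)
    show ?thesis using minus_equality[of "- a" a] by (simp add: ring_of_type_algebra_def a_inv_def)
  qed
  ultimately show "subgroup I (add_monoid ring_of_type_algebra)"
    by (intro subgroup.intro) (auto simp: ring_of_type_algebra_def add)
  show "x \<otimes>\<^bsub>ring_of_type_algebra\<^esub> a \<in> I" "a \<otimes>\<^bsub>ring_of_type_algebra\<^esub> x \<in> I"
    if "a \<in> I" for a x
    using mult[OF that that, of x 1] mult[OF that that, of 1 x] by (auto simp: ring_of_type_algebra_def)
qed

lemma simple_ring_central_simple_algebra:
  fixes s :: "'k::field \<Rightarrow> 'a::ring_1 \<Rightarrow> 'a"
  assumes "central_simple_algebra s"
  shows "simple_ring TYPE('a)"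
  unfolding simple_ring_def
proof (intro allI impI)
  fix I :: "'a set"
  assume I: "two_sided I" "\<exists>u\<in>I. u \<noteq> 0"
  then have "ideal I (ring_of_type_algebra :: 'a ring)" using ideal_ring_of_type_algebra by blast
  then have "I = {0} \<or> I = UNIV" using assms by (simp add: central_simple_algebra_def)
  then show "1 \<in> I" using I(2) by auto
qed

text \<open>The image of the enveloping algebra of \<open>A\<close>, that is of \<open>A\<close>
  tensored with its opposite, in the endomorphisms of \<open>A\<close>.\<close>

inductive_set multiplication_maps :: "('a::ring_1 \<Rightarrow> 'a) set" where
  mm_base: "(\<lambda>z. x * z * y) \<in> multiplication_maps"
| mm_add: "T \<in> multiplication_maps \<Longrightarrow> U \<in> multiplication_maps \<Longrightarrow> (\<lambda>z. T z + U z) \<in> multiplication_maps"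

lemma mm_mult: "T \<in> multiplication_maps \<Longrightarrow> (\<lambda>z. x * T z * y) \<in> multiplication_maps"
proof (induction rule: multiplication_maps.induct)
  case (mm_base u v)
  then show ?case using multiplication_maps.mm_base[of "x * u" "v * y"] by (simp add: mult.assoc)
next
  case (mm_add T U)
  then show ?case using multiplication_maps.mm_add by (simp add: distrib_left distrib_right)
qed

lemma mm_diff:
  assumes "T \<in> multiplication_maps" "U \<in> multiplication_maps"
  shows "(\<lambda>z. T z - U z) \<in> multiplication_maps"
  using mm_add[OF assms(1) mm_mult[OF assms(2), of "-1" 1]] by simp

lemma mm_linear:
  assumes s: "is_algebra s" and T: "T \<in> multiplication_maps"
  shows "T (z - s c w) = T z - s c (T w)"
  using T
proof (induction rule: multiplication_maps.induct)
  case (mm_base x y)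
  then show ?case using s by (simp add: is_algebra_def left_diff_distrib right_diff_distrib)
next
  case (mm_add T U)
  interpret vector_space s using s by (simp add: is_algebra_def)
  show ?case using mm_add by (simp add: scale_right_distrib)
qed

text \<open>The values at \<open>b\<close> of the multiplication maps that kill \<open>S\<close>
  form a two-sided ideal; it is nonzero, so it contains \<open>1\<close>.\<close>

lemma mm_normalize:
  assumes simple: "simple_ring TYPE('a::ring_1)"
    and T: "T \<in> multiplication_maps" "T b \<noteq> 0" "\<forall>z\<in>S. T z = 0"
  shows "\<exists>T\<in>multiplication_maps. T b = (1 :: 'a) \<and> (\<forall>z\<in>S. T z = 0)"
proof -
  define I where "I = {U b |U. U \<in> multiplication_maps \<and> (\<forall>z\<in>S. U z = 0)}"
  have "two_sided I" unfolding two_sided_def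
  proof (intro conjI ballI allI)
    fix u v assume "u \<in> I" "v \<in> I"
    then obtain U V where U: "u = U b" "U \<in> multiplication_maps" "\<forall>z\<in>S. U z = 0"
      and V: "v = V b" "V \<in> multiplication_maps" "\<forall>z\<in>S. V z = 0"
      unfolding I_def by (elim CollectE exE conjE)
    then show "u + v \<in> I" unfolding I_def
      by (intro CollectI exI[of _ "\<lambda>z. U z + V z"] conjI mm_add) simp_all
  next
    fix u x y assume "u \<in> I"
    then obtain U where U: "u = U b" "U \<in> multiplication_maps" "\<forall>z\<in>S. U z = 0"
      unfolding I_def by (elim CollectE exE conjE)
    then show "x * u * y \<in> I" unfolding I_def
      by (intro CollectI exI[of _ "\<lambda>z. x * U z * y"] conjI mm_mult) simp_all
  qed
  moreover have "T b \<in> I" unfolding I_def using T by (intro CollectI exI[of _ T]) simp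
  ultimately have "1 \<in> I" using simple_ringD[OF simple] T(2) by blast
  then obtain U where "1 = U b" "U \<in> multiplication_maps" "\<forall>z\<in>S. U z = 0"
    unfolding I_def by (elim CollectE exE conjE)
  then show ?thesis by (intro bexI[of _ U]) simp_all
qed

text \<open>The density theorem for the algebra as a bimodule over itself, whose endomorphisms are the
  multiplications by central elements, that is by scalars.\<close>

lemma mm_separates:
  fixes s :: "'k::field \<Rightarrow> 'a::ring_1 \<Rightarrow> 'a"
  assumes csa: "central_simple_algebra s"
  assumes "finite S" "\<not> module.dependent s (insert b S)" "b \<notin> S"
  shows "\<exists>T\<in>multiplication_maps. T b = 1 \<and> (\<forall>z\<in>S. T z = 0)"
proof -
  have alg: "is_algebra s" using csa by (simp add: central_simple_algebra_def)
  then interpret vector_space s by (simp add: is_algebra_def)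
  note normalize = mm_normalize[OF simple_ring_central_simple_algebra[OF csa]]
  show ?thesis using assms(2-)
  proof (induction S arbitrary: b rule: finite_induct)
    case empty
    have "b \<noteq> 0" using empty dependent_zero[of "{b}"] by auto
    then show ?case using normalize[OF mm_base[of 1 1], of b "{}"] by simp
  next
    case (insert z S)
    have z_indep: "independent (insert z S)" and b_span: "b \<notin> span (insert z S)"
      using insert.prems by (simp_all add: independent_insert)
    from insert.IH[OF z_indep insert.hyps(2)] obtain Tz
      where Tz: "Tz \<in> multiplication_maps" "Tz z = 1" "\<forall>w\<in>S. Tz w = 0" by auto
    have "\<exists>T\<in>multiplication_maps. T b \<noteq> 0 \<and> (\<forall>w\<in>insert z S. T w = 0)"
    proof (rule ccontr)
      assume "\<not> ?thesis"
      then have "\<forall>T\<in>multiplication_maps. T z = 0 \<longrightarrow> T b = 0 \<or> (\<exists>w\<in>S. T w \<noteq> 0)" by auto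
      from bspec[OF this] have none: "T b = 0"
        if "T \<in> multiplication_maps" "T z = 0" "\<forall>w\<in>S. T w = 0" for T using that by auto
      \<comment> \<open>The map \<open>w \<mapsto> x * Tz w - Tz w * x\<close> kills
        \<open>z\<close> and \<open>S\<close>, hence also \<open>b\<close>. So \<open>Tz b\<close>
        is central, that is, a scalar \<open>c\<close>.\<close>
      have "x * Tz b = Tz b * x" for x
        using none[OF mm_diff[OF mm_mult[OF Tz(1), of x 1] mm_mult[OF Tz(1), of 1 x]]] Tz by simp
      then have "Tz b \<in> {z. \<forall>x. z * x = x * z}" by simp
      then have "Tz b \<in> range (\<lambda>c. s c 1)" using csa unfolding central_simple_algebra_def by blast
      then obtain c where c: "Tz b = s c 1" by auto
      \<comment> \<open>The induction hypothesis applies to \<open>b - c z\<close> and gives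
        \<open>T\<close> with value \<open>1\<close> there. But
        \<open>w \<mapsto> T w - T z * Tz w\<close> kills \<open>z\<close> and \<open>S\<close>,
        hence \<open>b\<close>, which means \<open>T b = c (T z)\<close> and
        \<open>T (b - c z) = 0\<close>.\<close>
      have "b - s c z \<notin> span S" using b_span by (auto simp: span_breakdown_eq)
      moreover have "independent S" using z_indep insert.hyps by (simp add: independent_insert)
      ultimately have "independent (insert (b - s c z) S)" "b - s c z \<notin> S"
        by (auto simp: independent_insert span_base)
      from insert.IH[OF this] obtain T where
        T: "T \<in> multiplication_maps" "T (b - s c z) = 1" "\<forall>w\<in>S. T w = 0" by auto
      have "T b - T z * Tz b * 1 = 0"
        by (rule none[OF mm_diff[OF T(1) mm_mult[OF Tz(1), of "T z" 1]]]) (use T Tz in auto)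
      moreover have "T z * Tz b = s c (T z)" using alg c by (simp add: is_algebra_def)
      moreover have "T (b - s c z) = T b - s c (T z)" by (rule mm_linear[OF alg T(1)])
      ultimately show False using T(2) by simp
    qed
    then obtain T where "T \<in> multiplication_maps" "T b \<noteq> 0" "\<forall>w\<in>insert z S. T w = 0" by auto
    then show ?case by (rule normalize)
  qed
qed

lemma basis_expansion:
  assumes "vector_space s" "finite B" "is_basis s B"
  shows "x = (\<Sum>b\<in>B. s (module.representation s B x b) b)"
proof -
  interpret vector_space s by (rule assms)
  show ?thesis
    using assms by (intro sum_representation_eq[symmetric]) (auto simp: is_basis_def)
qed

text \<open>Let \<open>u\<close> be a nonzero member of the ideal, with coordinate
  \<open>c b0\<close> nonzero. A multiplication map of \<open>A\<close> that sends \<open>b0\<close>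
  to \<open>1\<close> and the rest of the basis to \<open>0\<close> acts on the extension as well;
  it keeps \<open>u\<close> in the ideal and turns it into the nonzero scalar
  \<open>c b0\<close>.\<close>

lemma simple_ring_scalar_extension:
  fixes s :: "'f::field \<Rightarrow> 'a::ring_1 \<Rightarrow> 'a" and s' :: "'f alg_closure \<Rightarrow> 'b::ring_1 \<Rightarrow> 'b"
  assumes csa: "central_simple_algebra s" and ext: "scalar_extension s s' \<iota>"
  shows "simple_ring TYPE('b)"
  unfolding simple_ring_def
proof (intro allI impI)
  fix I :: "'b set"
  assume I: "two_sided I" and "\<exists>u\<in>I. u \<noteq> 0"
  then obtain u where u: "u \<in> I" "u \<noteq> 0" by auto
  obtain B where B: "finite B" "is_basis s B" using csa by (auto simp: central_simple_algebra_def)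
  have alg': "is_algebra s'" and B': "inj_on \<iota> B" "is_basis s' (\<iota> ` B)"
    and \<iota>: "\<iota> 1 = 1" "\<And>x y. \<iota> (x + y) = \<iota> x + \<iota> y" "\<And>x y. \<iota> (x * y) = \<iota> x * \<iota> y"
    using ext B(2) by (auto simp: scalar_extension_def)
  interpret B: vector_space s' using alg' by (simp add: is_algebra_def)
  have \<iota>0: "\<iota> 0 = 0" using \<iota>(2)[of 0 0] by simp
  define c where "c b = B.representation (\<iota> ` B) u (\<iota> b)" for b
  have u_eq: "u = (\<Sum>b\<in>B. s' (c b) (\<iota> b))"
    using basis_expansion[OF B.vector_space_axioms _ B'(2), of u] B(1) B'(1)
    by (simp add: sum.reindex c_def)
  have "\<exists>b\<in>B. c b \<noteq> 0"
  proof (rule ccontr)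
    assume "\<not> ?thesis"
    then have "u = 0" unfolding u_eq by (intro sum.neutral) simp
    then show False using u(2) by simp
  qed
  then obtain b0 where b0: "b0 \<in> B" "c b0 \<noteq> 0" by auto
  have "insert b0 (B - {b0}) = B" using b0 by auto
  then obtain T where T: "T \<in> multiplication_maps" "T b0 = 1" "\<forall>z\<in>B - {b0}. T z = 0"
    using mm_separates[OF csa, of "B - {b0}" b0] B by (auto simp: is_basis_def)
  have "(\<Sum>b\<in>B. s' (c b) (\<iota> (T b))) \<in> I" using T(1)
  proof (induction rule: multiplication_maps.induct)
    case (mm_base x y)
    have "\<iota> x * u * \<iota> y \<in> I" using I u(1) by (simp add: two_sided_def)
    moreover have "\<iota> x * u * \<iota> y = (\<Sum>b\<in>B. s' (c b) (\<iota> (x * b * y)))"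
      unfolding u_eq using alg' by (simp add: sum_distrib_left sum_distrib_right is_algebra_def \<iota>)
    ultimately show ?case by simp
  next
    case (mm_add T U)
    then have "(\<Sum>b\<in>B. s' (c b) (\<iota> (T b))) + (\<Sum>b\<in>B. s' (c b) (\<iota> (U b))) \<in> I"
      using I by (simp add: two_sided_def)
    then show ?case by (simp add: \<iota> B.scale_right_distrib sum.distrib)
  qed
  moreover have "(\<Sum>b\<in>B. s' (c b) (\<iota> (T b))) = s' (c b0) 1"
    using B(1) b0(1) T by (simp add: sum.remove \<iota> \<iota>0)
  ultimately have "s' (c b0) 1 \<in> I" by simp
  then have "s' (inverse (c b0)) 1 * s' (c b0) 1 * 1 \<in> I" using I unfolding two_sided_def by blast
  moreover have "s' (inverse (c b0)) 1 * s' (c b0) 1 * 1 = s' (inverse (c b0)) (s' (c b0) 1)"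
    using alg' by (simp add: is_algebra_def)
  ultimately show "1 \<in> I" using b0 by simp
qed

section \<open>Minimal left ideals and Wedderburn's theorem\<close>

definition poly_act :: "('k::field \<Rightarrow> 'v::ab_group_add \<Rightarrow> 'v) \<Rightarrow> ('v \<Rightarrow> 'v) \<Rightarrow> 'v \<Rightarrow> 'k poly \<Rightarrow> 'v" where
  "poly_act s T v p = (\<Sum>i\<le>Polynomial.degree p. s (Polynomial.coeff p i) ((T ^^ i) v))"

text \<open>The \<open>N + 1\<close> vectors \<open>v, T v, ...\<close> exceed the dimension, so
  some nonzero polynomial \<open>p\<close> has \<open>p(T) v = 0\<close>. For \<open>p\<close> of
  least degree and a root \<open>l\<close> of it, \<open>p = (X - l) q\<close>, and
  \<open>q(T) v\<close> is an eigenvector, nonzero by minimality and inside the invariant subspace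
  \<open>S\<close>.\<close>

lemma exists_eigenvector:
  fixes s :: "'k::alg_closed_field \<Rightarrow> 'v::ab_group_add \<Rightarrow> 'v"
  assumes vs: "vector_space s" and B: "finite B" "is_basis s B"
    and T: "\<And>x y. T (x + y) = T x + T y" "\<And>c x. T (s c x) = s c (T x)"
    and S: "module.subspace s S" "\<And>x. x \<in> S \<Longrightarrow> T x \<in> S" and v: "v \<in> S" "v \<noteq> 0"
  shows "\<exists>c. \<exists>w\<in>S. w \<noteq> 0 \<and> T w = s c w"
proof -
  interpret vector_space s by (rule vs)
  define act where "act = poly_act s T v"
  have act_n: "act p = (\<Sum>i\<le>n. s (Polynomial.coeff p i) ((T ^^ i) v))" if "Polynomial.degree p \<le> n" for p n
    unfolding act_def poly_act_def
    by (rule sum.mono_neutral_left) (use that in \<open>auto simp: coeff_eq_0\<close>)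
  have T0: "T 0 = 0" using T(1)[of 0 0] by simp
  have T_sum: "T (sum f A) = (\<Sum>a\<in>A. T (f a))" for f :: "nat \<Rightarrow> 'v" and A
    by (induction A rule: infinite_finite_induct) (simp_all add: T T0)
  have act_linear: "act ([:-c, 1:] * q) = T (act q) - s c (act q)" for c q
  proof -
    define n where "n = Polynomial.degree q"
    have n: "Polynomial.degree ([:-c, 1:] * q) \<le> Suc n" "Polynomial.degree q \<le> n"
      using degree_mult_le[of "[:-c, 1:]" q] by (auto simp: n_def)
    have co: "Polynomial.coeff ([:-c, 1:] * q) i = (if i = 0 then 0 else Polynomial.coeff q (i - 1)) - c * Polynomial.coeff q i" for i
      by (cases i) (simp_all add: Polynomial.coeff_pCons)
    have "act ([:-c, 1:] * q) =
      (\<Sum>i\<le>Suc n. s (if i = 0 then 0 else Polynomial.coeff q (i - 1)) ((T ^^ i) v)) -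
      (\<Sum>i\<le>Suc n. s c (s (Polynomial.coeff q i) ((T ^^ i) v)))"
      unfolding act_n[OF n(1)] co by (simp add: scale_left_diff_distrib sum_subtractf)
    also have "(\<Sum>i\<le>Suc n. s (if i = 0 then 0 else Polynomial.coeff q (i - 1)) ((T ^^ i) v)) = T (act q)"
      unfolding act_n[OF n(2)] T_sum by (simp add: sum.atMost_Suc_shift T del: sum.atMost_Suc)
    also have "(\<Sum>i\<le>Suc n. s c (s (Polynomial.coeff q i) ((T ^^ i) v))) = s c (act q)"
      unfolding act_n[of q "Suc n", OF le_SucI[OF n(2)]] by (simp only: scale_sum_right)
    finally show ?thesis .
  qed
  define N where "N = card B"
  have "\<exists>c. (\<exists>i\<in>{..N}. c i \<noteq> 0) \<and> (\<forall>b\<in>B. (\<Sum>i\<in>{..N}. c i * representation B ((T ^^ i) v) b) = 0)"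
    by (rule homogeneous_system_solution) (use B in \<open>auto simp: N_def\<close>)
  then obtain c where c: "\<exists>i\<in>{..N}. c i \<noteq> 0" "\<forall>b\<in>B. (\<Sum>i\<in>{..N}. c i * representation B ((T ^^ i) v) b) = 0"
    by (elim exE conjE)
  define p0 where "p0 = (\<Sum>i\<le>N. Polynomial.monom (c i) i)"
  have p0c: "Polynomial.coeff p0 i = (if i \<le> N then c i else 0)" for i
    unfolding p0_def by (simp add: coeff_sum)
  have p0d: "Polynomial.degree p0 \<le> N" by (rule degree_le) (simp add: p0c)
  have p0: "p0 \<noteq> 0" using c(1) p0c by (metis atMost_iff coeff_0)
  have "act p0 = (\<Sum>i\<le>N. s (c i) (\<Sum>b\<in>B. s (representation B ((T ^^ i) v) b) b))"
    unfolding act_n[OF p0d] using basis_expansion[OF vs B] p0c by (intro sum.cong refl) simp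
  also have "\<dots> = (\<Sum>b\<in>B. s (\<Sum>i\<le>N. c i * representation B ((T ^^ i) v) b) b)"
    unfolding scale_sum_right scale_sum_left by (subst sum.swap) simp
  also have "\<dots> = 0" using c(2) by simp
  finally have "act p0 = 0" .
  then obtain p where p: "p \<noteq> 0" "act p = 0" and min: "\<And>q. q \<noteq> 0 \<Longrightarrow> act q = 0 \<Longrightarrow> Polynomial.degree p \<le> Polynomial.degree q"
    using p0 ex_has_least_nat[of "\<lambda>q. q \<noteq> 0 \<and> act q = 0" p0 Polynomial.degree] by auto
  have "Polynomial.degree p > 0"
  proof (rule ccontr)
    assume "\<not> ?thesis"
    then obtain a where "p = [:a:]" by (auto elim: degree_eq_zeroE)
    then show False using p v by (simp add: act_def poly_act_def)
  qed
  then obtain l where "poly p l = 0" using alg_closed_imp_poly_has_root by blast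
  then obtain q where q: "p = [:-l, 1:] * q" by (auto simp: poly_eq_0_iff_dvd elim: dvdE)
  have qnz: "q \<noteq> 0" using p q by auto
  have "Polynomial.degree p = Suc (Polynomial.degree q)"
    unfolding q by (subst degree_mult_eq) (use qnz in auto)
  then have "act q \<noteq> 0" using min[OF qnz] by auto
  moreover have "T (act q) = s l (act q)" using p(2) unfolding q act_linear by simp
  moreover have "act q \<in> S"
  proof -
    have "(T ^^ i) v \<in> S" for i by (induction i) (auto simp: S v)
    then show ?thesis unfolding act_def poly_act_def
      by (intro subspace_sum subspace_scale S(1))
  qed
  ultimately show ?thesis by blast
qed

text \<open>A minimal left ideal is generated by an idempotent \<open>e\<close>, and its endomorphisms are scalars.\<close>

lemma exists_minimal_idempotent:
  fixes s :: "'k::alg_closed_field \<Rightarrow> 'b::ring_1 \<Rightarrow> 'b"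
  assumes alg: "is_algebra s" and B: "finite B" "is_basis s B" and simple: "simple_ring TYPE('b)"
  shows "\<exists>e. e \<noteq> 0 \<and> e * e = e \<and> (\<forall>x. \<exists>c. e * x * e = s c e)"
proof -
  interpret vector_space s using alg by (simp add: is_algebra_def)
  have sm: "s c x * y = s c (x * y)" "x * s c y = s c (x * y)" for c x y
    using alg by (auto simp: is_algebra_def)
  interpret finite_dimensional_vector_space s B
    by unfold_locales (use B in \<open>auto simp: is_basis_def\<close>)
  define lid where "lid M \<longleftrightarrow> subspace M \<and> (\<forall>m\<in>M. \<forall>x. x * m \<in> M)" for M
  have "lid UNIV" by (simp add: lid_def)
  moreover have "(UNIV :: 'b set) \<noteq> {0}" by (metis UNIV_I singletonD zero_neq_one)
  ultimately have "lid UNIV \<and> (UNIV :: 'b set) \<noteq> {0}" by (rule conjI)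
  from ex_has_least_nat[of "\<lambda>N. lid N \<and> N \<noteq> {0}" UNIV dim, OF this] have "\<exists>M. (lid M \<and> M \<noteq> {0}) \<and> (\<forall>N. lid N \<and> N \<noteq> {0} \<longrightarrow> dim M \<le> dim N)" .
  then obtain M where M: "lid M" "M \<noteq> {0}"
    and min: "\<forall>N. lid N \<and> N \<noteq> {0} \<longrightarrow> dim M \<le> dim N" by (elim exE conjE)
  have sub: "subspace M" and left: "\<And>m x. m \<in> M \<Longrightarrow> x * m \<in> M" using M(1) by (auto simp: lid_def)
  have minimal: "N = M" if "lid N" "N \<subseteq> M" "n \<in> N" "n \<noteq> 0" for N n
  proof -
    have "N \<noteq> {0}" using that(3,4) by auto
    then have "dim M \<le> dim N" using min that(1) by simp
    moreover have "subspace N" using that(1) by (simp add: lid_def)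
    ultimately show ?thesis using subspace_dim_equal[of N M] that(2) sub by simp
  qed
  obtain m0 where m0: "m0 \<in> M" "m0 \<noteq> 0" using M(2) subspace_0[OF sub] by blast
  \<comment> \<open>If \<open>M\<close> had square zero, the two-sided ideal \<open>I\<close> of all
    \<open>u\<close> with \<open>m * x * u = 0\<close> for every \<open>m\<close> in
    \<open>M\<close> and every \<open>x\<close> would contain \<open>M\<close>, hence
    \<open>1\<close>, and \<open>M\<close> would be zero.\<close>
  have "\<exists>a\<in>M. \<exists>m\<in>M. m * a \<noteq> 0"
  proof (rule ccontr)
    assume "\<not> ?thesis"
    then have zero: "m * a = 0" if "m \<in> M" "a \<in> M" for m a using that by blast
    define I where "I = {u. \<forall>m\<in>M. \<forall>x. m * x * u = 0}"
    have "two_sided I" unfolding two_sided_def I_def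
    proof (intro conjI ballI allI CollectI)
      fix u x y m z assume u: "u \<in> {u. \<forall>m\<in>M. \<forall>x. m * x * u = 0}" and m: "m \<in> M"
      have "m * z * (x * u * y) = (m * (z * x) * u) * y" by (simp add: mult.assoc)
      then show "m * z * (x * u * y) = 0" using u m by simp
    qed (simp add: distrib_left)
    moreover have "m0 \<in> I" using zero left m0 by (auto simp: I_def mult.assoc)
    ultimately have "1 \<in> I" using simple_ringD[OF simple] m0 by blast
    then have "m0 * 1 * 1 = 0" using m0 unfolding I_def by blast
    then show False using m0 by simp
  qed
  then obtain a m1 where a: "a \<in> M" "m1 \<in> M" "m1 * a \<noteq> 0" by auto
  \<comment> \<open>By minimality, right multiplication by \<open>a\<close> maps \<open>M\<close>
    onto \<open>M\<close>, and its kernel is zero. The preimage \<open>e\<close> of \<open>a\<close>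
    is idempotent since \<open>e * e - e\<close> lies in that kernel.\<close>
  have "(\<lambda>m. m * a) ` M = M"
  proof (rule minimal[of _ "m1 * a"])
    show "lid ((\<lambda>m. m * a) ` M)" unfolding lid_def
    proof (intro conjI ballI allI subspaceI)
      show "0 \<in> (\<lambda>m. m * a) ` M" using subspace_0[OF sub] by force
    next
      fix x y assume "x \<in> (\<lambda>m. m * a) ` M" "y \<in> (\<lambda>m. m * a) ` M"
      then show "x + y \<in> (\<lambda>m. m * a) ` M"
        using subspace_add[OF sub] by (auto simp: distrib_right[symmetric])
    next
      fix x c assume "x \<in> (\<lambda>m. m * a) ` M"
      then show "s c x \<in> (\<lambda>m. m * a) ` M"
        using subspace_scale[OF sub] by (auto simp: sm(1)[symmetric])
    next
      fix m x assume "m \<in> (\<lambda>m. m * a) ` M"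
      then show "x * m \<in> (\<lambda>m. m * a) ` M" using left by (auto simp: mult.assoc[symmetric])
    qed
    show "(\<lambda>m. m * a) ` M \<subseteq> M" using left a by auto
  qed (use a in auto)
  then obtain e where e: "e \<in> M" "e * a = a" using a by (metis imageE)
  \<comment> \<open>The eigenspaces in \<open>M\<close> of a right multiplication are left ideals;
    the case \<open>c = 0\<close> is its kernel.\<close>
  have lid_ker: "lid {m \<in> M. m * x = s c m}" for x c
    unfolding lid_def
  proof (intro conjI ballI allI subspaceI)
    show "0 \<in> {m \<in> M. m * x = s c m}" using subspace_0[OF sub] by simp
    show "m + m' \<in> {m \<in> M. m * x = s c m}"
      if "m \<in> {m \<in> M. m * x = s c m}" "m' \<in> {m \<in> M. m * x = s c m}" for m m'
      using that subspace_add[OF sub] by (simp add: distrib_right scale_right_distrib)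
    show "s a m \<in> {m \<in> M. m * x = s c m}" if "m \<in> {m \<in> M. m * x = s c m}" for a m
      using that subspace_scale[OF sub] by (simp add: sm(1) mult.commute)
    show "y * m \<in> {m \<in> M. m * x = s c m}" if "m \<in> {m \<in> M. m * x = s c m}" for y m
      using that left by (simp add: sm(2) mult.assoc)
  qed
  have "{m \<in> M. m * a = s 0 m} = {0}"
  proof (rule ccontr)
    assume "\<not> ?thesis"
    then obtain n where "n \<in> {m \<in> M. m * a = s 0 m}" "n \<noteq> 0" using subspace_0[OF sub] by fastforce
    from minimal[OF lid_ker _ this] have "m1 \<in> {m \<in> M. m * a = s 0 m}" using a by auto
    then show False using a by simp
  qed
  moreover have "e * e - e \<in> {m \<in> M. m * a = s 0 m}"
    using e left subspace_diff[OF sub] by (simp add: left_diff_distrib mult.assoc)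
  ultimately have ee: "e * e = e" by auto
  have e0: "e \<noteq> 0" using e a by auto
  have "\<exists>c. e * x * e = s c e" for x
  proof -
    define z where "z = e * x * e"
    have z: "z \<in> M" "e * z = z"
      using left[OF e(1)] ee by (simp_all add: z_def mult.assoc[symmetric])
    \<comment> \<open>Schur's lemma: the eigenspace of right multiplication by \<open>z\<close> is a
      nonzero left ideal, hence all of \<open>M\<close>, and it contains \<open>e\<close>.\<close>
    have "\<exists>c. \<exists>w\<in>M. w \<noteq> 0 \<and> w * z = s c w"
      by (rule exists_eigenvector[of s B "\<lambda>m. m * z" M e, OF vector_space_axioms B _ _ sub _ e(1) e0])
        (simp_all add: distrib_right sm left[OF z(1)])
    then obtain c w where w: "w \<in> M" "w \<noteq> 0" "w * z = s c w" by auto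
    have "{m \<in> M. m * z = s c m} = M" by (rule minimal[OF lid_ker _ _ w(2)]) (use w in auto)
    then have "e * z = s c e" using e by blast
    then show ?thesis using z(2) by (intro exI[of _ c]) (simp add: z_def)
  qed
  then show ?thesis using e0 ee by blast
qed

text \<open>With \<open>e\<close> as above, \<open>1\<close> is a sum of elements \<open>u e v\<close>, so that every endomorphism of the left
  ideal \<open>R e\<close> is a sum of rank one maps \<open>y \<mapsto> T (u e) v y\<close>.\<close>

lemma wedderburn:
  fixes s :: "'k::alg_closed_field \<Rightarrow> 'b::ring_1 \<Rightarrow> 'b"
  assumes alg: "is_algebra s" and B: "finite B" "is_basis s B" and simple: "simple_ring TYPE('b)"
  shows "\<exists>r \<phi>. bij_betw \<phi> (UNIV :: 'b set) (carrier_mat r r) \<and> \<phi> 1 = 1\<^sub>m r \<and>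
    (\<forall>x y. \<phi> (x + y) = \<phi> x + \<phi> y) \<and> (\<forall>x y. \<phi> (x * y) = \<phi> x * \<phi> y) \<and> (\<forall>c x. \<phi> (s c x) = c \<cdot>\<^sub>m \<phi> x)"
proof -
  interpret vector_space s using alg by (simp add: is_algebra_def)
  have sm: "s c x * y = s c (x * y)" "x * s c y = s c (x * y)" for c x y
    using alg by (auto simp: is_algebra_def)
  interpret finite_dimensional_vector_space s B
    by unfold_locales (use B in \<open>auto simp: is_basis_def\<close>)
  from exists_minimal_idempotent[OF assms] obtain e
    where e: "e \<noteq> 0" "e * e = e" "\<forall>x. \<exists>c. e * x * e = s c e" by (elim exE conjE)
  \<comment> \<open>This is the left ideal \<open>R e\<close>, because \<open>e\<close> is
    idempotent.\<close>
  define M where "M = {m. m * e = m}"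
  have sub: "subspace M" by (rule subspaceI) (simp_all add: M_def distrib_right sm)
  have left: "x * m \<in> M" if "m \<in> M" for x m using that by (simp add: M_def mult.assoc)
  have eM: "e \<in> M" using e by (simp add: M_def)
  have endo: "\<exists>b. \<forall>y\<in>M. T y = b * y"
    if T: "\<And>x y. x \<in> M \<Longrightarrow> y \<in> M \<Longrightarrow> T (x + y) = T x + T y" "\<And>c x. x \<in> M \<Longrightarrow> T (s c x) = s c (T x)"
      "\<And>x. x \<in> M \<Longrightarrow> T x \<in> M" for T
  proof -
    \<comment> \<open>\<open>Q w\<close> says that \<open>y \<mapsto> T (w * y)\<close> is a left
      multiplication on \<open>M\<close>. The elements all of whose two-sided multiples satisfy
      \<open>Q\<close> form an ideal; once it contains \<open>e\<close> it contains
      \<open>1\<close>, and \<open>Q 1\<close> is the claim.\<close>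
    define Q where "Q w \<longleftrightarrow> (\<exists>b. \<forall>y\<in>M. T (w * y) = b * y)" for w
    have Q_add: "Q (w + w')" if qq: "Q w" "Q w'" for w w'
    proof -
      obtain b b' where b: "\<forall>y\<in>M. T (w * y) = b * y" "\<forall>y\<in>M. T (w' * y) = b' * y"
        using qq unfolding Q_def by (elim exE)
      have "T ((w + w') * y) = (b + b') * y" if "y \<in> M" for y
        using T(1)[OF left[OF that] left[OF that], of w w'] b that by (simp add: distrib_right)
      then show ?thesis unfolding Q_def by (intro exI[of _ "b + b'"] ballI)
    qed
    define I where "I = {w. \<forall>x z. Q (x * w * z)}"
    have "two_sided I" unfolding two_sided_def
    proof (intro conjI ballI allI)
      show "w + w' \<in> I" if "w \<in> I" "w' \<in> I" for w w'
        using that Q_add unfolding I_def by (simp add: distrib_left distrib_right)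
      show "x' * w * z' \<in> I" if "w \<in> I" for w x' z'
        unfolding I_def
      proof (intro CollectI allI)
        fix x z
        have "Q ((x * x') * w * (z' * z))" using that by (simp add: I_def)
        then show "Q (x * (x' * w * z') * z)" by (simp add: mult.assoc)
      qed
    qed
    moreover have "e \<in> I"
    proof -
      \<comment> \<open>For \<open>y\<close> in \<open>M\<close> the element
        \<open>e * z * y = e * (z * y) * e\<close> is a scalar multiple \<open>c e\<close>, and
        \<open>T\<close> commutes with the scalar \<open>c\<close>.\<close>
      have "T (x * e * z * y) = (T (x * e) * z) * y" if y: "y \<in> M" for x z y
      proof -
        obtain c where c: "e * (z * y) * e = s c e" using e(3) by (elim allE exE)
        have "y * e = y" using y by (simp add: M_def)
        then have ezy: "e * z * y = s c e" using c by (simp add: mult.assoc)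
        have xe: "x * e \<in> M" using left eM by blast
        have Txe: "T (x * e) * e = T (x * e)" using T(3)[OF xe] by (simp add: M_def)
        have "T (x * e * z * y) = T (s c (x * e))" using ezy by (simp add: mult.assoc sm)
        also have "\<dots> = T (x * e) * (e * z * y)" using T(2)[OF xe] ezy Txe by (simp add: sm)
        also have "\<dots> = (T (x * e) * z) * y" using Txe by (simp add: mult.assoc[symmetric])
        finally show ?thesis .
      qed
      then show ?thesis unfolding I_def Q_def by (intro CollectI allI exI ballI)
    qed
    ultimately have "1 \<in> I" using simple_ringD[OF simple _ _ e(1)] by simp
    then have "Q (1 * 1 * 1)" unfolding I_def by (elim CollectE allE)
    then show ?thesis by (simp add: Q_def)
  qed
  have faithful: "b = 0" if b: "\<And>y. y \<in> M \<Longrightarrow> b * y = 0" for b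
  proof (rule ccontr)
    assume "b \<noteq> 0"
    define I where "I = {b. \<forall>y\<in>M. b * y = 0}"
    have "two_sided I" unfolding two_sided_def
    proof (intro conjI ballI allI)
      show "u + v \<in> I" if "u \<in> I" "v \<in> I" for u v using that by (simp add: I_def distrib_right)
      show "x * u * y \<in> I" if "u \<in> I" for u x y using that left by (simp add: I_def mult.assoc)
    qed
    moreover have "b \<in> I" using b by (simp add: I_def)
    ultimately have "1 \<in> I" using simple_ringD[OF simple _ _ \<open>b \<noteq> 0\<close>] by simp
    then have "\<forall>y\<in>M. 1 * y = 0" by (simp add: I_def)
    from bspec[OF this eM] show False using e(1) by simp
  qed
  obtain Y where Y: "Y \<subseteq> M" "independent Y" "M \<subseteq> span Y" by (rule basis_exists)
  have finY: "finite Y" using Y(2) by (rule finiteI_independent)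
  obtain h where h: "bij_betw h {0..<card Y} Y" using ex_bij_betw_nat_finite[OF finY] ..
  define r where "r = card Y"
  have hY: "i < r \<Longrightarrow> h i \<in> Y" for i using h by (auto simp: bij_betw_def r_def)
  have hM: "i < r \<Longrightarrow> h i \<in> M" for i using subsetD[OF Y(1) hY] .
  have hinj: "i < r \<Longrightarrow> j < r \<Longrightarrow> h i = h j \<longleftrightarrow> i = j" for i j using h by (auto simp: bij_betw_def r_def inj_on_def)
  define k where "k i m = representation Y m (h i)" for i m
  have expand: "m = (\<Sum>i<r. s (k i m) (h i))" if "m \<in> M" for m
  proof -
    have "m = (\<Sum>b\<in>Y. s (representation Y m b) b)"
      using that Y finY by (intro sum_representation_eq[symmetric]) auto
    also have "\<dots> = (\<Sum>i<r. s (k i m) (h i))"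
      unfolding k_def using sum.reindex_bij_betw[OF h, of "\<lambda>b. s (representation Y m b) b"]
      by (simp add: r_def atLeast0LessThan)
    finally show ?thesis .
  qed
  have k_add: "k i (m + m') = k i m + k i m'" if "m \<in> M" "m' \<in> M" for i m m'
    using that Y by (simp add: k_def representation_add subset_iff)
  have k_scale: "k i (s c m) = c * k i m" if "m \<in> M" for i c m
    using that Y by (simp add: k_def representation_scale subset_iff)
  have k_sum: "k i (\<Sum>j\<in>A. f j) = (\<Sum>j\<in>A. k i (f j))" if "\<And>j. j \<in> A \<Longrightarrow> f j \<in> M" for i f and A :: "nat set"
    unfolding k_def by (subst representation_sum) (use that Y in auto)
  have k_h: "k i (h j) = (if i = j then 1 else 0)" if "i < r" "j < r" for i j
    unfolding k_def using representation_basis[OF Y(2) hY[OF that(2)]] hinj[OF that] by simp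
  define \<phi> where "\<phi> b = Matrix.mat r r (\<lambda>(i, j). k i (b * h j))" for b
  have act: "b * m = (\<Sum>i<r. s (\<Sum>j<r. \<phi> b $$ (i, j) * k j m) (h i))" if m: "m \<in> M" for b m
  proof -
    have "k i (b * m) = (\<Sum>j<r. \<phi> b $$ (i, j) * k j m)" if i: "i < r" for i
    proof -
      have "k i (b * m) = k i (b * (\<Sum>j<r. s (k j m) (h j)))" using expand[OF m] by simp
      also have "\<dots> = k i (\<Sum>j<r. s (k j m) (b * h j))" by (simp add: sum_distrib_left sm)
      also have "\<dots> = (\<Sum>j<r. k i (s (k j m) (b * h j)))"
        by (rule k_sum) (use hM left subspace_scale[OF sub] in auto)
      also have "\<dots> = (\<Sum>j<r. \<phi> b $$ (i, j) * k j m)"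
        using hM left i by (intro sum.cong refl) (simp add: k_scale \<phi>_def mult.commute)
      finally show ?thesis .
    qed
    then show ?thesis by (subst expand[OF left[OF m]]) (simp cong: sum.cong_simp)
  qed
  have \<phi>c: "\<phi> b \<in> carrier_mat r r" for b by (simp add: \<phi>_def)
  have "inj \<phi>"
  proof (rule injI)
    fix b b' assume "\<phi> b = \<phi> b'"
    then have "(b - b') * m = 0" if "m \<in> M" for m
      using act[OF that, of b] act[OF that, of b'] by (simp add: left_diff_distrib)
    then show "b = b'" using faithful[of "b - b'"] by simp
  qed
  moreover have "A \<in> range \<phi>" if A: "A \<in> carrier_mat r r" for A
  proof -
    define T where "T m = (\<Sum>i<r. s (\<Sum>j<r. A $$ (i, j) * k j m) (h i))" for m
    have "\<exists>b. \<forall>y\<in>M. T y = b * y"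
    proof (rule endo)
      show "T (x + y) = T x + T y" if "x \<in> M" "y \<in> M" for x y
        using that by (simp add: T_def k_add distrib_left sum.distrib scale_left_distrib)
      show "T (s c x) = s c (T x)" if "x \<in> M" for c x
        using that by (simp add: T_def k_scale scale_sum_right sum_distrib_left mult.left_commute)
      show "T x \<in> M" if "x \<in> M" for x
        unfolding T_def using hM by (intro subspace_sum[OF sub] subspace_scale[OF sub]) auto
    qed
    then obtain b where b: "\<forall>y\<in>M. T y = b * y" by auto
    have "\<phi> b = A"
    proof (rule eq_matI)
      fix i j assume "i < dim_row A" "j < dim_col A"
      then have ij: "i < r" "j < r" using A by auto
      have "\<phi> b $$ (i, j) = k i (T (h j))" using ij b hM by (simp add: \<phi>_def)
      also have "T (h j) = (\<Sum>i<r. s (A $$ (i, j)) (h i))"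
        unfolding T_def using ij by (intro sum.cong refl arg_cong2[of _ _ _ _ s]) (simp add: k_h if_distrib[of "\<lambda>z. _ * z"] cong: if_cong)
      also have "k i \<dots> = (\<Sum>i'<r. k i (s (A $$ (i', j)) (h i')))"
        by (rule k_sum) (use hM subspace_scale[OF sub] in auto)
      also have "\<dots> = (\<Sum>i'<r. A $$ (i', j) * (if i = i' then 1 else 0))"
        using ij hM by (intro sum.cong refl) (simp add: k_scale k_h)
      also have "\<dots> = A $$ (i, j)" using ij by (simp add: if_distrib[of "\<lambda>z. _ * z"] cong: if_cong)
      finally show "\<phi> b $$ (i, j) = A $$ (i, j)" .
    qed (use A in \<open>auto simp: \<phi>_def\<close>)
    then show ?thesis by auto
  qed
  ultimately have "bij_betw \<phi> UNIV (carrier_mat r r)" using \<phi>c by (auto simp: bij_betw_def)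
  moreover have "\<phi> 1 = 1\<^sub>m r" by (rule eq_matI) (auto simp: \<phi>_def k_h)
  moreover have "\<phi> (x + y) = \<phi> x + \<phi> y" for x y
    by (rule eq_matI) (auto simp: \<phi>_def distrib_right k_add hM left)
  moreover have "\<phi> (x * y) = \<phi> x * \<phi> y" for x y
  proof (rule eq_matI)
    fix i j assume "i < dim_row (\<phi> x * \<phi> y)" "j < dim_col (\<phi> x * \<phi> y)"
    then have ij: "i < r" "j < r" by (auto simp: \<phi>_def)
    have "\<phi> (x * y) $$ (i, j) = k i (x * (y * h j))" using ij by (simp add: \<phi>_def mult.assoc)
    also have "x * (y * h j) = (\<Sum>i<r. s (\<Sum>l<r. \<phi> x $$ (i, l) * k l (y * h j)) (h i))"
      using ij hM left by (intro act) auto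
    also have "k i \<dots> = (\<Sum>i'<r. k i (s (\<Sum>l<r. \<phi> x $$ (i', l) * k l (y * h j)) (h i')))"
      by (rule k_sum) (use hM subspace_scale[OF sub] in auto)
    also have "\<dots> = (\<Sum>i'<r. (\<Sum>l<r. \<phi> x $$ (i', l) * k l (y * h j)) * (if i = i' then 1 else 0))"
      using ij hM by (intro sum.cong refl) (simp add: k_scale k_h)
    also have "\<dots> = (\<Sum>l<r. \<phi> x $$ (i, l) * k l (y * h j))"
      using ij by (simp add: if_distrib[of "\<lambda>z. _ * z"] cong: if_cong)
    also have "\<dots> = (\<phi> x * \<phi> y) $$ (i, j)"
      using ij \<phi>c[of x] \<phi>c[of y] by (simp add: scalar_prod_def atLeast0LessThan \<phi>_def)
    finally show "\<phi> (x * y) $$ (i, j) = (\<phi> x * \<phi> y) $$ (i, j)" .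
  qed (use \<phi>c in \<open>auto simp: \<phi>_def\<close>)
  moreover have "\<phi> (s c x) = c \<cdot>\<^sub>m \<phi> x" for c x
    by (rule eq_matI) (auto simp: \<phi>_def sm k_scale hM left)
  ultimately show ?thesis by (intro exI[of _ r] exI[of _ \<phi>] conjI allI)
qed

text \<open>If \<open>B\<close> has more than \<open>r * r\<close> elements, comparing entries gives
  a linear relation in \<open>B\<close>; if it has fewer, comparing coordinates gives one among the
  matrix units.\<close>

lemma matrix_basis_card:
  fixes s :: "'k::field \<Rightarrow> 'b::ring_1 \<Rightarrow> 'b"
  assumes vs: "vector_space s" and B: "finite B" "is_basis s B"
    and \<phi>: "bij_betw \<phi> UNIV (carrier_mat r r)" "\<And>x y. \<phi> (x + y) = \<phi> x + \<phi> y" "\<And>c x. \<phi> (s c x) = c \<cdot>\<^sub>m \<phi> x"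
  shows "card B = r * r"
proof -
  interpret vector_space s by (rule vs)
  have \<phi>c: "\<phi> x \<in> carrier_mat r r" for x using \<phi>(1) by (auto simp: bij_betw_def)
  have "0 \<cdot>\<^sub>m \<phi> 0 = 0\<^sub>m r r" by (rule eq_matI) (use \<phi>c[of 0] in auto)
  then have \<phi>0: "\<phi> 0 = 0\<^sub>m r r" using \<phi>(3)[of 0 0] by simp
  have \<phi>_zero: "x = 0" if "\<phi> x = 0\<^sub>m r r" for x
  proof -
    have "inj \<phi>" using \<phi>(1) by (simp add: bij_betw_def)
    then show ?thesis using that \<phi>0 by (simp add: inj_eq[symmetric, of \<phi> x 0])
  qed
  have \<phi>_sum: "\<phi> (\<Sum>i\<in>A. s (c i) (f i)) $$ (a, b) = (\<Sum>i\<in>A. c i * \<phi> (f i) $$ (a, b))"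
    if "a < r" "b < r" for A :: "'i set" and c f a b
    using that \<phi>c carrier_matD[OF \<phi>c]
    by (induction A rule: infinite_finite_induct) (simp_all add: \<phi> \<phi>0)
  have "card B \<le> r * r"
  proof (rule ccontr)
    assume "\<not> ?thesis"
    then have "card ({..<r} \<times> {..<r}) < card B" by simp
    from homogeneous_system_solution[OF finite_cartesian_product[OF finite_lessThan finite_lessThan] B(1) this,
        of "\<lambda>b ij. \<phi> b $$ ij"] obtain c
      where c: "\<exists>b\<in>B. c b \<noteq> 0" "\<forall>ij\<in>{..<r} \<times> {..<r}. (\<Sum>b\<in>B. c b * \<phi> b $$ ij) = 0"
      by (elim exE conjE)
    have "\<phi> (\<Sum>b\<in>B. s (c b) b) = 0\<^sub>m r r"
      using \<phi>c[of "\<Sum>b\<in>B. s (c b) b"] c(2) by (intro eq_matI) (auto simp: \<phi>_sum)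
    then have "(\<Sum>b\<in>B. s (c b) b) = 0" by (rule \<phi>_zero)
    moreover have "independent B" using B(2) by (simp add: is_basis_def)
    ultimately have "\<forall>b\<in>B. c b = 0" using independentD[OF _ B(1) subset_refl] by blast
    then show False using c(1) by blast
  qed
  moreover have "r * r \<le> card B"
  proof (rule ccontr)
    assume "\<not> ?thesis"
    then have card: "card B < card ({..<r} \<times> {..<r})" by simp
    define u where "u ij = inv_into UNIV \<phi> (Matrix.mat r r (\<lambda>ab. if ab = ij then 1 else 0))" for ij
    have u: "\<phi> (u ij) = Matrix.mat r r (\<lambda>ab. if ab = ij then 1 else 0)" for ij
      unfolding u_def using \<phi>(1) by (intro f_inv_into_f) (auto simp: bij_betw_def)
    from homogeneous_system_solution[OF B(1) finite_cartesian_product[OF finite_lessThan finite_lessThan] card,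
        of "\<lambda>ij. representation B (u ij)"] obtain c where c: "\<exists>ij\<in>{..<r} \<times> {..<r}. c ij \<noteq> 0"
      "\<forall>b\<in>B. (\<Sum>ij\<in>{..<r} \<times> {..<r}. c ij * representation B (u ij) b) = 0"
      by (elim exE conjE)
    have "(\<Sum>ij\<in>{..<r} \<times> {..<r}. s (c ij) (u ij)) =
      (\<Sum>ij\<in>{..<r} \<times> {..<r}. s (c ij) (\<Sum>b\<in>B. s (representation B (u ij) b) b))"
      using basis_expansion[OF vs B] by simp
    also have "\<dots> = (\<Sum>b\<in>B. s (\<Sum>ij\<in>{..<r} \<times> {..<r}. c ij * representation B (u ij) b) b)"
      unfolding scale_sum_right scale_sum_left by (subst sum.swap) simp
    also have "\<dots> = 0" using c(2) by simp
    finally have zero: "(\<Sum>ij\<in>{..<r} \<times> {..<r}. s (c ij) (u ij)) = 0" .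
    have "c (a, b) = 0" if ab: "a < r" "b < r" for a b
    proof -
      have "0 = \<phi> (\<Sum>ij\<in>{..<r} \<times> {..<r}. s (c ij) (u ij)) $$ (a, b)" using zero \<phi>0 ab by simp
      also have "\<dots> = (\<Sum>ij\<in>{..<r} \<times> {..<r}. c ij * (if (a, b) = ij then 1 else 0))"
        unfolding \<phi>_sum[OF ab] using ab by (intro sum.cong refl) (simp add: u)
      also have "\<dots> = c (a, b)" using ab
        by (simp add: if_distrib[of "\<lambda>z. _ * z"] cong: if_cong)
      finally show ?thesis by simp
    qed
    then show False using c(1) by auto
  qed
  ultimately show ?thesis by simp
qed

section \<open>The group of an involution on a matrix algebra\<close>

inductive_set generated_ideal :: "('x \<Rightarrow> 'k::comm_ring_1) set \<Rightarrow> ('x \<Rightarrow> 'k) set \<Rightarrow> ('x \<Rightarrow> 'k) set"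
  for R G where
  gi_zero: "(\<lambda>_. 0) \<in> generated_ideal R G"
| gi_base: "r \<in> R \<Longrightarrow> p \<in> G \<Longrightarrow> (\<lambda>x. r x * p x) \<in> generated_ideal R G"
| gi_add: "p \<in> generated_ideal R G \<Longrightarrow> q \<in> generated_ideal R G \<Longrightarrow> (\<lambda>x. p x + q x) \<in> generated_ideal R G"

lemma function_ideal_generated:
  assumes R: "function_ring R" and G: "G \<subseteq> R"
  shows "function_ideal R (generated_ideal R G)"
proof -
  interpret function_ring R by (rule R)
  show ?thesis
  proof unfold_locales
    show "generated_ideal R G \<subseteq> R"
    proof
      fix p assume "p \<in> generated_ideal R G"
      then show "p \<in> R"
      proof induction
        case (gi_base r p)
        then show ?case using G by (intro mult) auto
      qed (simp_all add: const add)
    qed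
    show "(\<lambda>x. r x * p x) \<in> generated_ideal R G" if r: "r \<in> R" and "p \<in> generated_ideal R G" for r p
      using that(2)
    proof induction
      case gi_zero
      then show ?case using generated_ideal.gi_zero by simp
    next
      case (gi_base r' p)
      then show ?case using generated_ideal.gi_base[OF mult[OF r gi_base(1)] gi_base(2)] by (simp add: mult.assoc)
    next
      case (gi_add p q)
      then show ?case using generated_ideal.gi_add by (simp add: distrib_left)
    qed
  qed (simp_all add: generated_ideal.gi_zero generated_ideal.gi_add)
qed

text \<open>The product is a parameter because the carrier is later the type of 2 by 2 matrices over
  the extended algebra, with product \<open>**\<close>. The map \<open>\<Phi>\<close> supplies
  determinants and adjugates, and the basis \<open>B\<close> supplies coordinates for the
  Nullstellensatz.\<close>

locale matrix_algebra = vector_space s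
  for s :: "'k::alg_closed_field \<Rightarrow> 'w::ab_group_add \<Rightarrow> 'w" +
  fixes mul :: "'w \<Rightarrow> 'w \<Rightarrow> 'w" (infixl "\<odot>" 70) and e :: 'w
    and \<Phi> :: "'w \<Rightarrow> 'k Matrix.mat" and N :: nat and \<tau> :: "'w \<Rightarrow> 'w" and B :: "'w set"
  assumes mul_assoc: "(x \<odot> y) \<odot> z = x \<odot> (y \<odot> z)"
    and mul_left: "(x + y) \<odot> z = x \<odot> z + y \<odot> z" and mul_right: "x \<odot> (y + z) = x \<odot> y + x \<odot> z"
    and mul_one: "e \<odot> x = x" "x \<odot> e = x"
    and mul_scale: "s c x \<odot> y = s c (x \<odot> y)" "x \<odot> s c y = s c (x \<odot> y)"
    and \<Phi>_bij: "bij_betw \<Phi> UNIV (carrier_mat N N)"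
    and \<Phi>_add: "\<Phi> (x + y) = \<Phi> x + \<Phi> y" and \<Phi>_mul: "\<Phi> (x \<odot> y) = \<Phi> x * \<Phi> y"
    and \<Phi>_one: "\<Phi> e = 1\<^sub>m N" and \<Phi>_scale: "\<Phi> (s c x) = c \<cdot>\<^sub>m \<Phi> x"
    and \<tau>_add: "\<tau> (x + y) = \<tau> x + \<tau> y" and \<tau>_scale: "\<tau> (s c x) = s c (\<tau> x)"
    and \<tau>_mul: "\<tau> (x \<odot> y) = \<tau> y \<odot> \<tau> x" and \<tau>_\<tau>: "\<tau> (\<tau> x) = x"
    and fin_B: "finite B" and basis_B: "is_basis s B"
    and two: "(2 :: 'k) \<noteq> 0"
begin

abbreviation R where "R \<equiv> polynomials s"

lemma mul_zero: "0 \<odot> x = 0" "x \<odot> 0 = 0"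
  using mul_left[of 0 0 x] mul_right[of x 0 0] by simp_all

lemma mul_uminus: "(- x) \<odot> y = - (x \<odot> y)" "x \<odot> (- y) = - (x \<odot> y)"
  using mul_left[of "-x" x y] mul_right[of x "-y" y] by (simp_all add: mul_zero add_eq_0_iff2 add.commute)

lemma mul_minus: "(x - y) \<odot> z = x \<odot> z - y \<odot> z" "x \<odot> (y - z) = x \<odot> y - x \<odot> z"
  using mul_left[of x "-y" z] mul_right[of x y "-z"] by (simp_all add: mul_uminus)

lemma \<tau>_zero: "\<tau> 0 = 0" using \<tau>_add[of 0 0] by simp

lemma \<tau>_uminus: "\<tau> (- x) = - \<tau> x" using \<tau>_add[of "-x" x] by (simp add: \<tau>_zero add_eq_0_iff2 add.commute)

lemma \<tau>_minus: "\<tau> (x - y) = \<tau> x - \<tau> y" using \<tau>_add[of x "-y"] by (simp add: \<tau>_uminus)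

lemma \<tau>_one: "\<tau> e = e"
  using \<tau>_mul[of "\<tau> e" e] by (simp add: mul_one \<tau>_\<tau>)

lemma \<Phi>_carrier: "\<Phi> x \<in> carrier_mat N N"
  using \<Phi>_bij by (auto simp: bij_betw_def)

lemma \<Phi>_dim: "dim_row (\<Phi> x) = N" "dim_col (\<Phi> x) = N"
  using \<Phi>_carrier[of x] by auto

lemma \<Phi>_eq_iff: "\<Phi> x = \<Phi> y \<longleftrightarrow> x = y"
  using \<Phi>_bij by (auto simp: bij_betw_def inj_on_def)

definition \<Psi> :: "'k Matrix.mat \<Rightarrow> 'w" where "\<Psi> = inv_into UNIV \<Phi>"

lemma \<Phi>_\<Psi>: "A \<in> carrier_mat N N \<Longrightarrow> \<Phi> (\<Psi> A) = A"
  unfolding \<Psi>_def using \<Phi>_bij by (intro f_inv_into_f) (auto simp: bij_betw_def)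

lemma \<Phi>_zero: "\<Phi> 0 = 0\<^sub>m N N"
proof -
  have "0 \<cdot>\<^sub>m \<Phi> 0 = 0\<^sub>m N N" by (rule eq_matI) (use \<Phi>_carrier[of 0] in auto)
  then show ?thesis using \<Phi>_scale[of 0 0] by simp
qed

lemma \<Phi>_minus: "\<Phi> (x - y) = \<Phi> x - \<Phi> y"
proof -
  have "\<Phi> x = \<Phi> (x - y) + \<Phi> y" using \<Phi>_add[of "x - y" y] by simp
  then show ?thesis using \<Phi>_dim by (intro eq_matI) auto
qed

lemma inverse_sym:
  assumes "x \<odot> y = e" shows "y \<odot> x = e"
proof -
  have "\<Phi> x * \<Phi> y = 1\<^sub>m N" using assms by (simp add: \<Phi>_mul[symmetric] \<Phi>_one)
  then have "\<Phi> y * \<Phi> x = 1\<^sub>m N" by (rule mat_mult_left_right_inverse[OF \<Phi>_carrier \<Phi>_carrier])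
  then show ?thesis by (simp add: \<Phi>_mul[symmetric] \<Phi>_one[symmetric] \<Phi>_eq_iff)
qed

definition dt :: "'w \<Rightarrow> 'k" where "dt x = Determinant.det (\<Phi> x)"
text \<open>Unlike \<open>winv\<close>, this is polynomial in the entries; the statements about
  polynomial maps are made with it.\<close>

definition adj :: "'w \<Rightarrow> 'w" where "adj x = \<Psi> (adj_mat (\<Phi> x))"
definition winv :: "'w \<Rightarrow> 'w" where "winv x = s (inverse (dt x)) (adj x)"

lemma \<Phi>_adj: "\<Phi> (adj x) = adj_mat (\<Phi> x)"
  unfolding adj_def by (rule \<Phi>_\<Psi>[OF adj_mat(1)[OF \<Phi>_carrier]])

lemma mul_adj: "x \<odot> adj x = s (dt x) e" "adj x \<odot> x = s (dt x) e"
  using adj_mat(2,3)[OF \<Phi>_carrier[of x]]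
  by (simp_all add: \<Phi>_eq_iff[symmetric] \<Phi>_mul \<Phi>_adj \<Phi>_scale \<Phi>_one dt_def)

lemma mul_winv: assumes "dt x \<noteq> 0" shows "x \<odot> winv x = e" "winv x \<odot> x = e"
  using assms by (simp_all add: winv_def mul_scale mul_adj)

lemma dt_mul: "dt (x \<odot> y) = dt x * dt y"
  unfolding dt_def \<Phi>_mul by (rule det_mult[OF \<Phi>_carrier \<Phi>_carrier])

lemma dt_scale_one: "dt (s c e) = c ^ N"
  by (simp add: dt_def \<Phi>_scale \<Phi>_one)

lemma dt_inverse: "x \<odot> y = e \<Longrightarrow> dt x \<noteq> 0"
  using dt_mul[of x y] dt_scale_one[of 1] by auto

definition V :: "'w set" where "V = {x. x \<odot> \<tau> x = e}"

lemma V_sym: "x \<in> V \<Longrightarrow> \<tau> x \<odot> x = e"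
  by (simp add: V_def inverse_sym)

lemma V_mul: assumes "x \<in> V" "y \<in> V" shows "x \<odot> y \<in> V"
proof -
  have "(x \<odot> y) \<odot> \<tau> (x \<odot> y) = x \<odot> (y \<odot> \<tau> y) \<odot> \<tau> x" by (simp add: \<tau>_mul mul_assoc)
  then show ?thesis using assms by (simp add: V_def mul_one)
qed

lemma V_\<tau>: "x \<in> V \<Longrightarrow> \<tau> x \<in> V"
  using V_sym by (simp add: V_def \<tau>_\<tau>)

subsection \<open>The Cayley transform\<close>

text \<open>If \<open>P\<close> commutes with \<open>P' = \<tau> P\<close>, then
  \<open>\<tau>\<close> sends the quotient of \<open>P'\<close> by \<open>P\<close> to the quotient
  of \<open>P\<close> by \<open>P'\<close>, its inverse. It is used for \<open>P = e + x\<close>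
  with skew \<open>x\<close>, and for a version freed of denominators.\<close>

lemma cayley_in_V:
  assumes P: "\<tau> P = P'" "P \<odot> P' = P' \<odot> P" and nz: "dt P \<noteq> 0"
  shows "P' \<odot> winv P \<in> V"
proof -
  define Q where "Q = winv P"
  have Q: "P \<odot> Q = e" "Q \<odot> P = e" using mul_winv[OF nz] by (simp_all add: Q_def)
  have P': "\<tau> P' = P" using P \<tau>_\<tau>[of P] by simp
  have R: "\<tau> Q \<odot> P' = e" using \<tau>_mul[of P Q] Q(1) P(1) \<tau>_one by simp
  then have R': "P' \<odot> \<tau> Q = e" by (rule inverse_sym)
  have "P \<odot> \<tau> Q = (\<tau> Q \<odot> P') \<odot> (P \<odot> \<tau> Q)" by (simp add: R mul_one)
  also have "\<dots> = \<tau> Q \<odot> (P' \<odot> P) \<odot> \<tau> Q" by (simp add: mul_assoc)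
  also have "\<dots> = \<tau> Q \<odot> P \<odot> (P' \<odot> \<tau> Q)" by (simp add: P(2)[symmetric] mul_assoc)
  finally have comm: "P \<odot> \<tau> Q = \<tau> Q \<odot> P" by (simp add: R' mul_one)
  have "(P' \<odot> Q) \<odot> \<tau> (P' \<odot> Q) = P' \<odot> Q \<odot> (\<tau> Q \<odot> P)" by (simp add: \<tau>_mul P' mul_assoc)
  also have "\<dots> = P' \<odot> (Q \<odot> P) \<odot> \<tau> Q" by (simp add: comm[symmetric] mul_assoc)
  finally show ?thesis by (simp add: V_def Q mul_one R' Q_def[symmetric])
qed

definition Lie :: "'w set" where "Lie = {x. \<tau> x = - x}"

definition cayley :: "'w \<Rightarrow> 'w" where "cayley x = (e - x) \<odot> winv (e + x)"

lemma cayley_Lie: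
  assumes x: "x \<in> Lie" and "dt (e + x) \<noteq> 0" shows "cayley x \<in> V"
  unfolding cayley_def using assms
  by (intro cayley_in_V) (auto simp: Lie_def \<tau>_add \<tau>_one mul_left mul_right mul_minus mul_one)

lemma two_e: "e + e = s 2 e"
  using scale_left_distrib[of 1 1 e] by simp

text \<open>For \<open>w = (1 - x) / (1 + x)\<close> these are \<open>1 + w = 2 / (1 + x)\<close>
  and \<open>1 - w = 2 x / (1 + x)\<close>. Their quotient is \<open>x\<close> again, so the Cayley
  transform is its own inverse.\<close>

lemma cayley_plus:
  assumes nz: "dt (e + x) \<noteq> 0"
  shows "e + cayley x = s 2 (winv (e + x))" "e - cayley x = s 2 (x \<odot> winv (e + x))"
proof -
  define Q where "Q = winv (e + x)"
  have Q: "e = (e + x) \<odot> Q" using mul_winv[OF nz] by (simp add: Q_def)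
  have "s 2 Q = Q + Q" using scale_left_distrib[of 1 1 Q] by simp
  moreover have "s 2 (x \<odot> Q) = x \<odot> Q + x \<odot> Q" using scale_left_distrib[of 1 1 "x \<odot> Q"] by simp
  moreover have "(e + x) \<odot> Q + (e - x) \<odot> Q = Q + Q"
    "(e + x) \<odot> Q - (e - x) \<odot> Q = x \<odot> Q + x \<odot> Q"
    by (simp_all add: mul_left mul_minus mul_one algebra_simps)
  ultimately show "e + cayley x = s 2 (winv (e + x))" "e - cayley x = s 2 (x \<odot> winv (e + x))"
    unfolding cayley_def Q_def[symmetric] by (simp_all add: Q[symmetric])
qed

lemma cayley_nonzero: assumes nz: "dt (e + x) \<noteq> 0" shows "dt (e + cayley x) \<noteq> 0"
proof (rule dt_inverse)
  show "(e + cayley x) \<odot> s (inverse 2) (e + x) = e"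
    using two by (simp add: cayley_plus[OF nz] mul_scale mul_winv[OF nz])
qed

lemma cayley_cayley: assumes nz: "dt (e + x) \<noteq> 0" shows "cayley (cayley x) = x"
proof -
  have "(e + cayley x) \<odot> s (inverse 2) (e + x) = e"
    using two by (simp add: cayley_plus[OF nz] mul_scale mul_winv[OF nz])
  then have "winv (e + cayley x) = winv (e + cayley x) \<odot> (e + cayley x) \<odot> s (inverse 2) (e + x)"
    by (simp add: mul_assoc mul_one)
  then have "winv (e + cayley x) = s (inverse 2) (e + x)"
    using mul_winv(2)[OF cayley_nonzero[OF nz]] by (simp add: mul_one)
  then have "cayley (cayley x) = (e - cayley x) \<odot> s (inverse 2) (e + x)" by (simp add: cayley_def[of "cayley x"])
  also have "\<dots> = x \<odot> (winv (e + x) \<odot> (e + x))"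
    using two by (simp add: cayley_plus[OF nz] mul_scale mul_assoc)
  finally show ?thesis by (simp add: mul_winv[OF nz] mul_one)
qed

text \<open>With \<open>Q\<close> the inverse of \<open>e + x\<close> and \<open>\<tau> x\<close>
  the inverse of \<open>x\<close>, one gets \<open>\<tau> Q = x Q\<close>. Hence
  \<open>\<tau>\<close> maps \<open>(e - x) Q\<close> to
  \<open>x Q (e - \<tau> x) = x Q - Q\<close>, its negative.\<close>

lemma cayley_V:
  assumes x: "x \<in> V" and nz: "dt (e + x) \<noteq> 0" shows "cayley x \<in> Lie"
proof -
  define Q where "Q = winv (e + x)"
  have Q: "(e + x) \<odot> Q = e" "Q \<odot> (e + x) = e" using mul_winv[OF nz] by (simp_all add: Q_def)
  have Qx: "Q \<odot> x = e - Q" "x \<odot> Q = e - Q"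
    using Q by (simp_all add: mul_left mul_right mul_one algebra_simps)
  have xx: "x \<odot> \<tau> x = e" "\<tau> x \<odot> x = e" using x V_sym by (auto simp: V_def)
  have "\<tau> Q \<odot> (e + \<tau> x) = e" using \<tau>_mul[of "e + x" Q] Q(1) by (simp add: \<tau>_one \<tau>_add)
  moreover have "(e + \<tau> x) \<odot> (x \<odot> Q) = e"
  proof -
    have "(e + \<tau> x) \<odot> (x \<odot> Q) = (x + \<tau> x \<odot> x) \<odot> Q" by (simp add: mul_left mul_one mul_assoc[symmetric])
    then show ?thesis using Q(1) by (simp add: xx add.commute)
  qed
  ultimately have \<tau>Q: "\<tau> Q = x \<odot> Q"
    by (metis mul_assoc mul_one)
  have "\<tau> (cayley x) = x \<odot> Q \<odot> (e - \<tau> x)"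
    by (simp add: cayley_def Q_def[symmetric] \<tau>_mul \<tau>_minus \<tau>_one \<tau>Q)
  also have "x \<odot> Q = Q \<odot> x" by (simp add: Qx)
  also have "Q \<odot> x \<odot> (e - \<tau> x) = Q \<odot> x - Q" by (simp add: mul_minus mul_one mul_assoc xx)
  also have "\<dots> = - cayley x"
    by (simp add: cayley_def Q_def[symmetric] mul_minus mul_one Qx)
  finally show ?thesis by (simp add: Lie_def)
qed

subsection \<open>Polynomial maps\<close>

lemma functional_add: "l \<in> functionals s \<Longrightarrow> l (x + y) = l x + l y"
  and functional_scale: "l \<in> functionals s \<Longrightarrow> l (s c x) = c * l x"
  by (simp_all add: functionals_def linear_iff_module_hom module_hom.add module_hom.scale)

lemma functional_zero: "l \<in> functionals s \<Longrightarrow> l 0 = 0"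
  using functional_scale[of l 0 0] by simp

lemma functional_diff: "l \<in> functionals s \<Longrightarrow> l (x - y) = l x - l y"
  using functional_add[of l "x - y" y] by simp

lemma functional_sum: "l \<in> functionals s \<Longrightarrow> l (\<Sum>i\<in>I. f i) = (\<Sum>i\<in>I. l (f i))"
  by (induction I rule: infinite_finite_induct) (simp_all add: functional_zero functional_add)

lemma functionalI:
  assumes "\<And>x y. l (x + y) = l x + l y" "\<And>c x. l (s c x) = c * l x"
  shows "l \<in> functionals s"
  unfolding functionals_def linear_iff_module_hom
  by (rule CollectI, unfold_locales) (simp_all add: assms algebra_simps)

lemma functional_representation: "(\<lambda>x. representation B x b) \<in> functionals s"
  using basis_B by (intro functionalI) (simp_all add: is_basis_def representation_add representation_scale)

lemma functional_entry: "i < N \<Longrightarrow> j < N \<Longrightarrow> (\<lambda>x. \<Phi> x $$ (i, j)) \<in> functionals s"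
  using \<Phi>_dim by (intro functionalI) (simp_all add: \<Phi>_add \<Phi>_scale)

definition unit_mat :: "nat \<times> nat \<Rightarrow> 'w" where
  "unit_mat p = \<Psi> (Matrix.mat N N (\<lambda>q. if q = p then 1 else 0))"

lemma \<Phi>_unit_mat: "\<Phi> (unit_mat p) = Matrix.mat N N (\<lambda>q. if q = p then 1 else 0)"
  unfolding unit_mat_def by (rule \<Phi>_\<Psi>) simp

lemma \<Phi>_entry_sum:
  assumes "i < N" "j < N"
  shows "\<Phi> (\<Sum>p\<in>I. s (c p) (f p)) $$ (i, j) = (\<Sum>p\<in>I. c p * \<Phi> (f p) $$ (i, j))"
  using functional_sum[OF functional_entry[OF assms], of "\<lambda>p. s (c p) (f p)" I]
    functional_scale[OF functional_entry[OF assms]] by simp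

lemma unit_mat_expand: "x = (\<Sum>p\<in>{..<N} \<times> {..<N}. s (\<Phi> x $$ p) (unit_mat p))"
proof -
  have "\<Phi> x = \<Phi> (\<Sum>p\<in>{..<N} \<times> {..<N}. s (\<Phi> x $$ p) (unit_mat p))"
  proof (rule eq_matI)
    fix i j assume "i < dim_row (\<Phi> (\<Sum>p\<in>{..<N} \<times> {..<N}. s (\<Phi> x $$ p) (unit_mat p)))"
      "j < dim_col (\<Phi> (\<Sum>p\<in>{..<N} \<times> {..<N}. s (\<Phi> x $$ p) (unit_mat p)))"
    then have ij: "i < N" "j < N" by (simp_all add: \<Phi>_dim)
    have "\<Phi> (\<Sum>p\<in>{..<N} \<times> {..<N}. s (\<Phi> x $$ p) (unit_mat p)) $$ (i, j) =
      (\<Sum>p\<in>{..<N} \<times> {..<N}. \<Phi> x $$ p * (if (i, j) = p then 1 else 0))"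
      unfolding \<Phi>_entry_sum[OF ij] using ij by (simp add: \<Phi>_unit_mat)
    then show "\<Phi> x $$ (i, j) = \<Phi> (\<Sum>p\<in>{..<N} \<times> {..<N}. s (\<Phi> x $$ p) (unit_mat p)) $$ (i, j)"
      using ij by (simp add: if_distrib[of "\<lambda>z. _ * z"] cong: if_cong)
  qed (simp_all add: \<Phi>_dim)
  then show ?thesis by (simp add: \<Phi>_eq_iff)
qed

text \<open>The matrix entries span the functionals, so polynomiality and congruence have to be
  checked on entries only.\<close>

lemma functional_entries:
  assumes "l \<in> functionals s"
  shows "l x = (\<Sum>p\<in>{..<N} \<times> {..<N}. \<Phi> x $$ p * l (unit_mat p))"
  by (subst unit_mat_expand[of x]) (simp add: functional_sum[OF assms] functional_scale[OF assms])

lemma functional_mul: "l \<in> functionals s \<Longrightarrow> (\<lambda>x. l (a \<odot> x \<odot> b)) \<in> functionals s"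
  by (rule functionalI) (simp_all add: mul_left mul_right mul_scale functional_add functional_scale)

lemma functional_\<tau>: "l \<in> functionals s \<Longrightarrow> (\<lambda>x. l (\<tau> x)) \<in> functionals s"
  by (rule functionalI) (simp_all add: \<tau>_add \<tau>_scale functional_add functional_scale)

lemma matrix_over_id: "matrix_over R N \<Phi>"
  unfolding matrix_over_def
  by (intro conjI allI impI \<Phi>_carrier functional_in_polynomials functional_entry)

lemma matrix_over_\<tau>: "matrix_over R N (\<lambda>x. \<Phi> (\<tau> x))"
  unfolding matrix_over_def
  by (intro conjI allI impI \<Phi>_carrier functional_in_polynomials
      functional_\<tau>[of "\<lambda>x. \<Phi> x $$ _"] functional_entry)

lemma matrix_over_functional:
  assumes R': "function_ring R'" and F: "matrix_over R' N (\<lambda>x. \<Phi> (F x))" and l: "l \<in> functionals s"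
  shows "(\<lambda>x. l (F x)) \<in> R'"
proof -
  interpret function_ring R' by (rule R')
  have "(\<lambda>x. \<Sum>p\<in>{..<N} \<times> {..<N}. \<Phi> (F x) $$ p * l (unit_mat p)) \<in> R'"
    by (intro sum mult const) (use F in \<open>auto simp: matrix_over_def\<close>)
  then show ?thesis by (simp add: functional_entries[OF l, symmetric])
qed

lemma mcongr_functional:
  assumes J: "function_ideal R' J" and F: "function_ideal.mcongr R' J N (\<lambda>x. \<Phi> (F x)) (\<lambda>x. \<Phi> (G x))"
    and l: "l \<in> functionals s"
  shows "function_ideal.congr R' J (\<lambda>x. l (F x)) (\<lambda>x. l (G x))"
proof -
  interpret function_ideal R' J by (rule J)
  have "congr (\<lambda>x. \<Sum>p\<in>{..<N} \<times> {..<N}. \<Phi> (F x) $$ p * l (unit_mat p))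
    (\<lambda>x. \<Sum>p\<in>{..<N} \<times> {..<N}. \<Phi> (G x) $$ p * l (unit_mat p))"
    by (intro congr_sum congr_mult congr_refl const) (use F in \<open>auto simp: mcongr_def\<close>)
  then show ?thesis by (simp add: functional_entries[OF l, symmetric])
qed

lemma matrix_over_polynomial:
  assumes R': "function_ring R'" and F: "matrix_over R' N (\<lambda>x. \<Phi> (F x))" and f: "f \<in> R"
  shows "(\<lambda>x. f (F x)) \<in> R'"
proof -
  interpret function_ring R' by (rule R')
  show ?thesis using f unfolding polynomials_def
  proof induction
    case (functional l)
    then show ?case by (rule matrix_over_functional[OF R' F])
  qed (simp_all add: const add mult)
qed

lemma matrix_over_cayley:
  assumes R': "function_ring R'" and F: "matrix_over R' N (\<lambda>x. \<Phi> (F x))"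
  shows "matrix_over R' N (\<lambda>x. \<Phi> (a \<odot> ((e - F x) \<odot> adj (e + F x))))" "(\<lambda>x. dt (e + F x)) \<in> R'"
proof -
  interpret function_ring R' by (rule R')
  have 1: "matrix_over R' N (\<lambda>x. \<Phi> (e + F x))" "matrix_over R' N (\<lambda>x. \<Phi> (e - F x))"
    unfolding \<Phi>_add \<Phi>_minus by (intro matrix_over_add matrix_over_diff matrix_over_const \<Phi>_carrier F)+
  show "(\<lambda>x. dt (e + F x)) \<in> R'" unfolding dt_def by (rule matrix_over_det[OF 1(1)])
  show "matrix_over R' N (\<lambda>x. \<Phi> (a \<odot> ((e - F x) \<odot> adj (e + F x))))"
    unfolding \<Phi>_mul \<Phi>_adj by (intro matrix_over_mult matrix_over_const \<Phi>_carrier matrix_over_adj 1)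
qed

text \<open>The factor \<open>a\<close> serves the charts translated by a group element, and
  \<open>F\<close> serves both the identity and a parametrization of the skew elements.\<close>

lemma pull_cayley:
  assumes R': "function_ring R'" and F: "matrix_over R' N (\<lambda>x. \<Phi> (F x))" and f: "f \<in> R"
  shows "\<exists>k. \<exists>p\<in>R'. \<forall>x. dt (e + F x) \<noteq> 0 \<longrightarrow> p x = dt (e + F x) ^ k * f (a \<odot> cayley (F x))"
proof -
  interpret function_ring R' by (rule R')
  \<comment> \<open>For the ideal that is the whole ring every congruence holds, so \<open>Z\<close>
    may be taken to be zero in \<open>substitute_fraction\<close>, which then just clears
    denominators.\<close>
  have J: "function_ideal R' R'" by unfold_locales auto
  then interpret J: function_ideal R' R' .
  have "\<exists>k p. (\<forall>x. dt (e + F x) \<noteq> 0 \<longrightarrow> p x = dt (e + F x) ^ k * f (a \<odot> cayley (F x))) \<and>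
    J.congr p (\<lambda>x. dt (e + F x) ^ k * f 0) \<and> (\<lambda>x. f 0) \<in> R'"
  proof (rule J.substitute_fraction[where L = "functionals s" and C = UNIV
        and Y = "\<lambda>x. a \<odot> ((e - F x) \<odot> adj (e + F x))" and Z = "\<lambda>_. 0"])
    show "f \<in> generated_functions UNIV (functionals s)" using f by (simp add: polynomials_def)
    show "(\<lambda>x. dt (e + F x)) \<in> R'" by (rule matrix_over_cayley[OF R' F])
    show "dt (e + F x) * l (a \<odot> cayley (F x)) = l (a \<odot> ((e - F x) \<odot> adj (e + F x)))"
      if "l \<in> functionals s" "dt (e + F x) \<noteq> 0" for l x
      using that by (simp add: cayley_def winv_def mul_scale functional_scale)
    show "J.congr (\<lambda>x. l (a \<odot> ((e - F x) \<odot> adj (e + F x)))) (\<lambda>x. dt (e + F x) * l 0)"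
      if "l \<in> functionals s" for l
      unfolding J.congr_def
      by (intro conjI diff mult const matrix_over_functional[OF R' _ that] matrix_over_cayley[OF R' F])
  qed auto
  then obtain k p where "\<forall>x. dt (e + F x) \<noteq> 0 \<longrightarrow> p x = dt (e + F x) ^ k * f (a \<odot> cayley (F x))"
    "J.congr p (\<lambda>x. dt (e + F x) ^ k * f 0)" by (elim exE conjE)
  then show ?thesis by (intro exI[of _ k] bexI[of _ p]) (simp_all add: J.congr_def)
qed

subsection \<open>The dimension\<close>

lemma zariski_closed_V: "zariski_closed s V"
  unfolding zariski_closed_def
proof (intro exI conjI)
  have "matrix_over R N (\<lambda>x. \<Phi> (x \<odot> \<tau> x - e))"
    unfolding \<Phi>_minus \<Phi>_mul
    by (intro PW.matrix_over_diff PW.matrix_over_mult matrix_over_id matrix_over_\<tau> PW.matrix_over_const \<Phi>_carrier)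
  then show "{(\<lambda>x. \<Phi> (x \<odot> \<tau> x - e) $$ (i, j)) |i j. i < N \<and> j < N} \<subseteq> R"
    by (auto simp: matrix_over_def)
  have "x \<in> V \<longleftrightarrow> \<Phi> (x \<odot> \<tau> x - e) = \<Phi> 0" for x by (simp add: V_def \<Phi>_eq_iff)
  also have "\<dots> x \<longleftrightarrow> (\<forall>i j. i < N \<longrightarrow> j < N \<longrightarrow> \<Phi> (x \<odot> \<tau> x - e) $$ (i, j) = 0)" for x
  proof
    assume "\<Phi> (x \<odot> \<tau> x - e) = \<Phi> 0"
    then show "\<forall>i j. i < N \<longrightarrow> j < N \<longrightarrow> \<Phi> (x \<odot> \<tau> x - e) $$ (i, j) = 0" by (simp add: \<Phi>_zero)
  next
    assume "\<forall>i j. i < N \<longrightarrow> j < N \<longrightarrow> \<Phi> (x \<odot> \<tau> x - e) $$ (i, j) = 0"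
    then show "\<Phi> (x \<odot> \<tau> x - e) = \<Phi> 0"
      unfolding \<Phi>_zero by (intro eq_matI) (simp_all add: \<Phi>_dim)
  qed
  finally show "V = {x. \<forall>p\<in>{(\<lambda>x. \<Phi> (x \<odot> \<tau> x - e) $$ (i, j)) |i j. i < N \<and> j < N}. p x = 0}"
    by auto
qed

lemma subspace_Lie: "subspace Lie"
  by (rule subspaceI) (simp_all add: Lie_def \<tau>_zero \<tau>_add \<tau>_scale)

text \<open>\<open>D\<close> is the dimension of \<open>Lie\<close>. Upper bound: near
  \<open>x0\<close> the group is parametrized by \<open>x0 \<odot> cayley\<close>, which reaches
  every \<open>x\<close> with \<open>e + \<tau> x0 \<odot> x\<close> invertible. Lower bound: the
  Cayley transform carries a full flag of \<open>Lie\<close> to a chain in \<open>V\<close>.\<close>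

lemma zariski_dim_V:
  assumes b: "\<And>i. i < D \<Longrightarrow> b i \<in> Lie" and l: "\<And>i. i < D \<Longrightarrow> l i \<in> functionals s"
    and dual: "\<And>i j. i < D \<Longrightarrow> j < D \<Longrightarrow> l i (b j) = (if i = j then 1 else 0)"
    and expand: "\<And>x. x \<in> Lie \<Longrightarrow> x = (\<Sum>i<D. s (l i x) (b i))"
  shows "zariski_dim s V = enat D"
proof (rule antisym)
  define \<gamma> where "\<gamma> y = (\<Sum>i<D. s (y i) (b i))" for y
  have \<gamma>_over: "matrix_over (poly_fun D) N (\<lambda>y. \<Phi> (\<gamma> y))"
    unfolding matrix_over_def
  proof (intro conjI allI impI \<Phi>_carrier)
    fix i j assume ij: "i < N" "j < N"
    show "(\<lambda>y. \<Phi> (\<gamma> y) $$ (i, j)) \<in> poly_fun D"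
      unfolding \<gamma>_def \<Phi>_entry_sum[OF ij] by (intro PF.sum PF.mult PF.const poly_fun_var) auto
  qed
  show "zariski_dim s V \<le> enat D"
  proof (rule zariski_dim_le)
    fix x0 assume x0: "x0 \<in> V"
    define h where "h = (\<lambda>x. dt (e + \<tau> x0 \<odot> x))"
    have "h \<in> R"
      unfolding h_def by (rule matrix_over_cayley(2)[OF function_ring_polynomials])
        (simp add: \<Phi>_mul PW.matrix_over_mult matrix_over_id PW.matrix_over_const \<Phi>_carrier)
    \<comment> \<open>At the centre of the chart the denominator is
      \<open>dt (e + e) = 2 ^ N\<close>.\<close>
    moreover have "h x0 \<noteq> 0" using V_sym[OF x0] two by (simp add: h_def two_e dt_scale_one)
    moreover have "\<exists>y. dt (e + \<gamma> y) \<noteq> 0 \<and> x0 \<odot> cayley (\<gamma> y) = x" if x: "x \<in> V" "h x \<noteq> 0" for x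
    proof -
      define z where "z = \<tau> x0 \<odot> x"
      have z: "z \<in> V" "dt (e + z) \<noteq> 0" using V_mul[OF V_\<tau>[OF x0] x(1)] x(2) by (simp_all add: z_def h_def)
      have "\<gamma> (\<lambda>i. l i (cayley z)) = cayley z"
        unfolding \<gamma>_def using expand[OF cayley_V[OF z]] by simp
      moreover have "x0 \<odot> z = x" using x0 by (simp add: z_def mul_assoc[symmetric] V_def mul_one)
      ultimately show ?thesis using cayley_nonzero[OF z(2)] cayley_cayley[OF z(2)]
        by (intro exI[of _ "\<lambda>i. l i (cayley z)"]) simp
    qed
    moreover have "\<forall>f\<in>R. \<exists>k. \<exists>p\<in>poly_fun D. \<forall>y. dt (e + \<gamma> y) \<noteq> 0 \<longrightarrow>
        p y = dt (e + \<gamma> y) ^ k * f (x0 \<odot> cayley (\<gamma> y))"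
      using pull_cayley[OF function_ring_poly_fun \<gamma>_over] by (rule ballI)
    moreover have "(\<lambda>y. dt (e + \<gamma> y)) \<in> poly_fun D" by (rule matrix_over_cayley(2)[OF function_ring_poly_fun \<gamma>_over])
    ultimately show "\<exists>\<phi> \<delta> h. h \<in> R \<and> h x0 \<noteq> 0 \<and> \<delta> \<in> poly_fun D \<and>
        (\<forall>x\<in>V. h x \<noteq> 0 \<longrightarrow> (\<exists>y. \<delta> y \<noteq> 0 \<and> \<phi> y = x)) \<and>
        (\<forall>f\<in>R. \<exists>k. \<exists>p\<in>poly_fun D. \<forall>y. \<delta> y \<noteq> 0 \<longrightarrow> p y = \<delta> y ^ k * f (\<phi> y))"
      by (intro exI[of _ "\<lambda>y. x0 \<odot> cayley (\<gamma> y)"] exI[of _ "\<lambda>y. dt (e + \<gamma> y)"] exI[of _ h] conjI ballI impI) simp_all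
  qed
  \<comment> \<open>The flag of the subspaces spanned by the first \<open>i\<close> of the vectors
    \<open>b\<close>.\<close>
  define L where "L i = {x \<in> Lie. \<forall>j. i \<le> j \<longrightarrow> j < D \<longrightarrow> l j x = 0}" for i
  show "enat D \<le> zariski_dim s V"
  proof (rule zariski_dim_ge[OF vector_space_axioms zariski_closed_V, where \<phi> = cayley and \<delta> = "\<lambda>x. dt (e + x)"
        and L = L and l = l])
    show "(\<lambda>x. dt (e + x)) \<in> R" by (rule matrix_over_cayley(2)[OF function_ring_polynomials matrix_over_id])
    show "dt (e + 0) \<noteq> 0" using dt_scale_one[of 1] by simp
    show "\<exists>k. \<exists>p\<in>R. \<forall>x. dt (e + x) \<noteq> 0 \<longrightarrow> p x = dt (e + x) ^ k * f (cayley x)" if "f \<in> R" for f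
      using pull_cayley[OF function_ring_polynomials matrix_over_id that, of e] by (simp add: mul_one)
    show "subspace (L i)" if "i \<le> D" for i
      using subspace_Lie l
      by (intro subspaceI) (auto simp: L_def subspace_0 subspace_add subspace_scale functional_zero
          functional_add functional_scale)
    show "L i \<subseteq> L (Suc i)" for i by (auto simp: L_def)
    show "l i x = 0" if "i < D" "x \<in> L i" for i x using that by (simp add: L_def)
    show "\<exists>v\<in>L (Suc i). l i v \<noteq> 0" if i: "i < D" for i
      using i b dual by (intro bexI[of _ "b i"]) (auto simp: L_def)
    show "cayley x \<in> V \<and> dt (e + cayley x) \<noteq> 0 \<and> cayley (cayley x) = x"
      if "x \<in> L D" "dt (e + x) \<noteq> 0" for x
      using that cayley_Lie cayley_nonzero cayley_cayley by (simp add: L_def)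
  qed (use l in auto)
qed

subsection \<open>The vanishing ideal\<close>

text \<open>All functionals of \<open>x \<odot> \<tau> x - e\<close> are taken, not only
  coordinates: the set of generators is then stable under translation, and it can be rewritten later
  in coordinates that are defined over \<open>F\<close>.\<close>

definition equations :: "('w \<Rightarrow> 'k) set" where
  "equations = generated_ideal R {(\<lambda>x. l (x \<odot> \<tau> x - e)) |l. l \<in> functionals s}"

lemma matrix_over_equation: "matrix_over R N (\<lambda>x. \<Phi> (x \<odot> \<tau> x - e))"
  unfolding \<Phi>_minus \<Phi>_mul
  by (intro PW.matrix_over_diff PW.matrix_over_mult matrix_over_id matrix_over_\<tau> PW.matrix_over_const \<Phi>_carrier)

lemma function_ideal_equations: "function_ideal R equations"
  unfolding equations_def
proof (rule function_ideal_generated[OF function_ring_polynomials])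
  show "{(\<lambda>x. l (x \<odot> \<tau> x - e)) |l. l \<in> functionals s} \<subseteq> R"
    using matrix_over_functional[OF function_ring_polynomials matrix_over_equation] by auto
qed

sublocale E: function_ideal R equations
  by (rule function_ideal_equations)

lemma equations_base:
  assumes "l \<in> functionals s" shows "(\<lambda>x. l (x \<odot> \<tau> x - e)) \<in> equations"
proof -
  have "(\<lambda>x. l (x \<odot> \<tau> x - e)) \<in> {(\<lambda>x. l (x \<odot> \<tau> x - e)) |l. l \<in> functionals s}"
    by (intro CollectI exI[of _ l] conjI refl assms)
  from gi_base[OF PW.const[of 1] this] show ?thesis by (simp add: equations_def)
qed

text \<open>For \<open>g\<close> in \<open>V\<close>, replacing \<open>x\<close> by
  \<open>g \<odot> x\<close> turns \<open>x \<odot> \<tau> x - e\<close> into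
  \<open>g \<odot> (x \<odot> \<tau> x - e) \<odot> \<tau> g\<close>, and a functional of this is
  again a functional of \<open>x \<odot> \<tau> x - e\<close>.\<close>

lemma equations_translate:
  assumes "p \<in> equations" shows "(\<lambda>x. p (g \<odot> x)) \<in> equations \<or> g \<notin> V"
proof (cases "g \<in> V")
  case True
  have "(\<lambda>x. p (g \<odot> x)) \<in> equations" using assms unfolding equations_def
  proof (induction rule: generated_ideal.induct)
    case (gi_base r p)
    then obtain l where l: "p = (\<lambda>x. l (x \<odot> \<tau> x - e))" "l \<in> functionals s" by auto
    have r: "(\<lambda>x. r (g \<odot> x)) \<in> R"
      by (rule matrix_over_polynomial[OF function_ring_polynomials _ gi_base(1)])
        (simp add: \<Phi>_mul PW.matrix_over_mult matrix_over_id PW.matrix_over_const \<Phi>_carrier)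
    have "(g \<odot> x) \<odot> \<tau> (g \<odot> x) - e = g \<odot> (x \<odot> \<tau> x - e) \<odot> \<tau> g" for x
      using True by (simp add: \<tau>_mul mul_minus mul_assoc V_def mul_one)
    moreover have "(\<lambda>x. l (g \<odot> (x \<odot> \<tau> x - e) \<odot> \<tau> g)) \<in> {(\<lambda>x. l (x \<odot> \<tau> x - e)) |l. l \<in> functionals s}"
      by (intro CollectI exI[of _ "\<lambda>z. l (g \<odot> z \<odot> \<tau> g)"] conjI refl functional_mul l(2))
    ultimately show ?case using generated_ideal.gi_base[OF r] by (simp add: l(1))
  qed (simp_all add: generated_ideal.gi_zero generated_ideal.gi_add)
  then show ?thesis ..
qed simp

lemma equation_congr_zero: "E.mcongr N (\<lambda>x. \<Phi> (x \<odot> \<tau> x - e)) (\<lambda>_. 0\<^sub>m N N)"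
  unfolding E.mcongr_def E.congr_def
  using matrix_over_equation equations_base[OF functional_entry]
  by (auto simp: \<Phi>_carrier matrix_over_def)

text \<open>The Cayley transform of an arbitrary matrix \<open>x\<close>, made skew and freed of denominators, gives a
  point \<open>Y / \<Delta>\<close> of the group which modulo the equations of the group is \<open>x\<close> itself.\<close>

lemma vanishing_times_denominator:
  assumes f: "f \<in> R" and van: "\<And>x. x \<in> V \<Longrightarrow> f x = 0"
  shows "\<exists>h\<in>R. (\<lambda>x. h x * f x) \<in> equations \<and> (\<forall>x. dt (e + x) \<noteq> 0 \<longrightarrow> h x \<noteq> 0)"
proof -
  define \<delta> where "\<delta> x = dt (e + x)" for x
  define A where "A x = adj (e + x)" for x
  \<comment> \<open>\<open>S'\<close> is \<open>\<delta>\<close> times the Cayley transform of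
    \<open>x\<close>. With \<open>k\<close> its skew part, \<open>S\<close> is
    \<open>2 \<delta>^2 k\<close>, and \<open>P\<close>, \<open>P'\<close> are
    \<open>2 \<delta>^2\<close> times \<open>e + k\<close> and \<open>e - k\<close>; so the quotient
    of \<open>P'\<close> by \<open>P\<close> is the Cayley transform of \<open>k\<close>.\<close>
  define S' where "S' x = (e - x) \<odot> A x" for x
  define S where "S x = s (\<delta> x) (S' x - \<tau> (S' x))" for x
  define c where "c x = 2 * \<delta> x * \<delta> x" for x
  define P where "P x = s (c x) e + S x" for x
  define P' where "P' x = s (c x) e - S x" for x
  define \<Delta> where "\<Delta> x = dt (P x)" for x
  define Y where "Y x = P' x \<odot> adj (P x)" for x
  have A1: "(e + x) \<odot> A x = s (\<delta> x) e" "A x \<odot> (e + x) = s (\<delta> x) e" for x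
    by (simp_all add: A_def \<delta>_def mul_adj)
  have \<tau>P: "\<tau> (P x) = P' x" for x
    by (simp add: P_def P'_def S_def \<tau>_add \<tau>_minus \<tau>_scale \<tau>_one \<tau>_\<tau> scale_right_diff_distrib)
  have QV: "P' x \<odot> winv (P x) \<in> V" if "\<Delta> x \<noteq> 0" for x
    by (rule cayley_in_V[OF \<tau>P])
      (use that in \<open>simp_all add: \<Delta>_def P_def P'_def mul_left mul_right mul_minus mul_scale mul_one
        scale_right_distrib scale_right_diff_distrib\<close>)
  have solve: "b = - a - d" if "a + b = - d" for a b d :: 'w
    using that by (metis add_diff_cancel_left' diff_conv_add_uminus add.commute)
  \<comment> \<open>The symmetric part of the Cayley transform vanishes modulo the equations:
    \<open>\<delta> (S' + \<tau> S')\<close> is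
    \<open>(e - x) (e + \<tau> x) + (e + x) (e - \<tau> x)\<close> between \<open>A\<close> and
    \<open>\<tau> A\<close>, and this sum is \<open>-2 (x \<tau> x - e)\<close>.\<close>
  have S_eq: "S x = s (2 * \<delta> x) (S' x) + s 2 (A x \<odot> (x \<odot> \<tau> x - e) \<odot> \<tau> (A x))" for x
  proof -
    have comm: "S' x = A x \<odot> (e - x)"
    proof -
      have "(e + x) \<odot> A x = A x \<odot> (e + x)" by (simp only: A1)
      then have "x \<odot> A x = A x \<odot> x" by (simp add: mul_left mul_right mul_one)
      then show ?thesis by (simp add: S'_def mul_minus mul_one)
    qed
    have \<tau>S': "\<tau> (S' x) = (e - \<tau> x) \<odot> \<tau> (A x)"
      by (simp add: comm \<tau>_mul \<tau>_minus \<tau>_one)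
    have \<tau>A: "(e + \<tau> x) \<odot> \<tau> (A x) = s (\<delta> x) e"
      using arg_cong[OF A1(2), of \<tau>] by (simp add: \<tau>_mul \<tau>_add \<tau>_one \<tau>_scale)
    have "s (\<delta> x) (S' x) = A x \<odot> (e - x) \<odot> ((e + \<tau> x) \<odot> \<tau> (A x))"
      unfolding \<tau>A by (simp add: comm mul_scale mul_one)
    moreover have "s (\<delta> x) (\<tau> (S' x)) = A x \<odot> (e + x) \<odot> ((e - \<tau> x) \<odot> \<tau> (A x))"
      unfolding A1(2) by (simp add: \<tau>S' mul_scale mul_one)
    ultimately have "s (\<delta> x) (S' x) + s (\<delta> x) (\<tau> (S' x)) =
      A x \<odot> ((e - x) \<odot> (e + \<tau> x) + (e + x) \<odot> (e - \<tau> x)) \<odot> \<tau> (A x)"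
      by (simp add: mul_assoc mul_left mul_right)
    also have "(e - x) \<odot> (e + \<tau> x) + (e + x) \<odot> (e - \<tau> x) = - s 2 (x \<odot> \<tau> x - e)"
      using scale_left_distrib[of 1 1 "x \<odot> \<tau> x - e"]
      by (simp add: mul_left mul_right mul_minus mul_one algebra_simps)
    also have "A x \<odot> (- s 2 (x \<odot> \<tau> x - e)) \<odot> \<tau> (A x) = - s 2 (A x \<odot> (x \<odot> \<tau> x - e) \<odot> \<tau> (A x))"
      by (simp only: mul_uminus mul_scale)
    finally have "s (\<delta> x) (\<tau> (S' x)) = - s (\<delta> x) (S' x) - s 2 (A x \<odot> (x \<odot> \<tau> x - e) \<odot> \<tau> (A x))"
      by (rule solve)
    moreover have "s (2 * \<delta> x) (S' x) = s (\<delta> x) (S' x) + s (\<delta> x) (S' x)"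
      using scale_left_distrib[of "\<delta> x" "\<delta> x" "S' x"] by simp
    ultimately show ?thesis by (simp add: S_def scale_right_diff_distrib)
  qed
  \<comment> \<open>Modulo the equations, \<open>P\<close> is \<open>4 \<delta> A\<close> and
    \<open>P'\<close> is \<open>x\<close> times that, so their quotient is \<open>x\<close>. The
    term \<open>c e\<close> is rewritten by \<open>\<delta> e = (e + x) A\<close>.\<close>
  have P_eq: "P x = s (4 * \<delta> x) (A x) + s 2 (A x \<odot> (x \<odot> \<tau> x - e) \<odot> \<tau> (A x))"
    and P'_eq: "P' x = s (4 * \<delta> x) (x \<odot> A x) - s 2 (A x \<odot> (x \<odot> \<tau> x - e) \<odot> \<tau> (A x))" for x
  proof -
    have four: "s (4 * \<delta> x) y = s (2 * \<delta> x) y + s (2 * \<delta> x) y" for y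
      using scale_left_distrib[of "2 * \<delta> x" "2 * \<delta> x" y] by simp
    have ce: "s (c x) e = s (2 * \<delta> x) (A x + x \<odot> A x)"
      using A1(1)[of x] by (simp add: c_def mul_left mul_one scale_scale[symmetric] del: scale_scale)
    show "P x = s (4 * \<delta> x) (A x) + s 2 (A x \<odot> (x \<odot> \<tau> x - e) \<odot> \<tau> (A x))"
      "P' x = s (4 * \<delta> x) (x \<odot> A x) - s 2 (A x \<odot> (x \<odot> \<tau> x - e) \<odot> \<tau> (A x))"
      unfolding P_def P'_def S_eq ce four S'_def
      by (simp_all add: mul_minus mul_one scale_right_distrib scale_right_diff_distrib)
  qed
  have \<delta>R: "\<delta> \<in> R" unfolding \<delta>_def
    by (rule matrix_over_cayley(2)[OF function_ring_polynomials matrix_over_id])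
  have ex: "matrix_over R N (\<lambda>x. \<Phi> (e + x))" unfolding \<Phi>_add
    by (intro PW.matrix_over_add matrix_over_id PW.matrix_over_const \<Phi>_carrier)
  have A_over: "matrix_over R N (\<lambda>x. \<Phi> (A x))"
    unfolding A_def \<Phi>_adj by (rule PW.matrix_over_adj[OF ex])
  have \<tau>A_over: "matrix_over R N (\<lambda>x. \<Phi> (\<tau> (A x)))"
    unfolding matrix_over_def
    by (intro conjI allI impI \<Phi>_carrier matrix_over_functional[OF function_ring_polynomials A_over]
        functional_\<tau>[of "\<lambda>x. \<Phi> x $$ _"] functional_entry)
  have zero: "E.mcongr N (\<lambda>x. \<Phi> (s 2 (A x \<odot> (x \<odot> \<tau> x - e) \<odot> \<tau> (A x)))) (\<lambda>x. \<Phi> 0)"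
  proof -
    have "E.mcongr N (\<lambda>x. 2 \<cdot>\<^sub>m (\<Phi> (A x) * \<Phi> (x \<odot> \<tau> x - e) * \<Phi> (\<tau> (A x))))
        (\<lambda>x. 2 \<cdot>\<^sub>m (\<Phi> (A x) * 0\<^sub>m N N * \<Phi> (\<tau> (A x))))"
      by (intro E.mcongr_smult E.mcongr_mult E.mcongr_refl A_over \<tau>A_over equation_congr_zero E.congr_refl PW.const)
    moreover have "2 \<cdot>\<^sub>m (\<Phi> (A x) * 0\<^sub>m N N * \<Phi> (\<tau> (A x))) = \<Phi> 0" for x
      using \<Phi>_carrier[of "A x"] \<Phi>_carrier[of "\<tau> (A x)"] by (simp add: \<Phi>_zero)
    ultimately show ?thesis by (simp add: \<Phi>_mul \<Phi>_scale)
  qed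
  have four\<delta>: "(\<lambda>x. 4 * \<delta> x) \<in> R" by (intro PW.mult PW.const \<delta>R)
  have P_congr: "E.mcongr N (\<lambda>x. \<Phi> (P x)) (\<lambda>x. \<Phi> (s (4 * \<delta> x) (A x)))"
  proof -
    have "E.mcongr N (\<lambda>x. (4 * \<delta> x) \<cdot>\<^sub>m \<Phi> (A x) + \<Phi> (s 2 (A x \<odot> (x \<odot> \<tau> x - e) \<odot> \<tau> (A x))))
      (\<lambda>x. (4 * \<delta> x) \<cdot>\<^sub>m \<Phi> (A x) + \<Phi> 0)"
      by (intro E.mcongr_add E.mcongr_smult E.mcongr_refl zero A_over E.congr_refl four\<delta>)
    then show ?thesis by (simp add: P_eq \<Phi>_scale[symmetric] \<Phi>_add[symmetric])
  qed
  have P'_congr: "E.mcongr N (\<lambda>x. \<Phi> (P' x)) (\<lambda>x. \<Phi> (s (4 * \<delta> x) (x \<odot> A x)))"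
  proof -
    have "E.mcongr N (\<lambda>x. (4 * \<delta> x) \<cdot>\<^sub>m (\<Phi> x * \<Phi> (A x)) - \<Phi> (s 2 (A x \<odot> (x \<odot> \<tau> x - e) \<odot> \<tau> (A x))))
      (\<lambda>x. (4 * \<delta> x) \<cdot>\<^sub>m (\<Phi> x * \<Phi> (A x)) - \<Phi> 0)"
      by (intro E.mcongr_diff E.mcongr_smult E.mcongr_refl zero PW.matrix_over_mult matrix_over_id
          A_over E.congr_refl four\<delta>)
    then show ?thesis by (simp add: P'_eq \<Phi>_scale[symmetric] \<Phi>_mul[symmetric] \<Phi>_minus[symmetric])
  qed
  \<comment> \<open>The value of \<open>\<Delta>\<close> modulo the equations. It is nonzero
    wherever \<open>\<delta>\<close> is, since there \<open>(e + x) / (4 \<delta>^2)\<close> is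
    inverse to \<open>4 \<delta> A\<close>.\<close>
  define d where "d x = dt (s (4 * \<delta> x) (A x))" for x
  have \<Delta>d: "E.congr \<Delta> d" unfolding \<Delta>_def d_def dt_def by (rule E.mcongr_det[OF P_congr])
  have Y_congr: "E.mcongr N (\<lambda>x. \<Phi> (Y x)) (\<lambda>x. \<Phi> (s (\<Delta> x) x))"
  proof -
    have "E.mcongr N (\<lambda>x. \<Phi> (Y x)) (\<lambda>x. \<Phi> (s (4 * \<delta> x) (x \<odot> A x)) * adj_mat (\<Phi> (s (4 * \<delta> x) (A x))))"
      unfolding Y_def \<Phi>_mul \<Phi>_adj by (rule E.mcongr_mult[OF P'_congr[unfolded \<Phi>_mul] E.mcongr_adj[OF P_congr]])
    moreover have "\<Phi> (s (4 * \<delta> x) (x \<odot> A x)) * adj_mat (\<Phi> (s (4 * \<delta> x) (A x))) = d x \<cdot>\<^sub>m \<Phi> x" for x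
    proof -
      have "\<Phi> (s (4 * \<delta> x) (x \<odot> A x)) * adj_mat (\<Phi> (s (4 * \<delta> x) (A x))) =
        \<Phi> (x \<odot> (s (4 * \<delta> x) (A x) \<odot> adj (s (4 * \<delta> x) (A x))))"
        by (simp only: \<Phi>_adj[symmetric] \<Phi>_mul[symmetric] mul_scale mul_assoc)
      also have "\<dots> = d x \<cdot>\<^sub>m \<Phi> x" unfolding mul_adj by (simp add: mul_scale mul_one \<Phi>_scale d_def)
      finally show ?thesis .
    qed
    moreover have "E.mcongr N (\<lambda>x. d x \<cdot>\<^sub>m \<Phi> x) (\<lambda>x. \<Delta> x \<cdot>\<^sub>m \<Phi> x)"
      by (intro E.mcongr_smult E.mcongr_refl matrix_over_id E.congr_sym[OF \<Delta>d])
    ultimately show ?thesis by (simp add: \<Phi>_scale) (rule E.mcongr_trans)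
  qed
  have "\<exists>k p. (\<forall>x. \<Delta> x \<noteq> 0 \<longrightarrow> p x = \<Delta> x ^ k * f (P' x \<odot> winv (P x))) \<and>
    E.congr p (\<lambda>x. \<Delta> x ^ k * f x) \<and> (\<lambda>x. f x) \<in> R"
  proof (rule E.substitute_fraction[where L = "functionals s" and C = UNIV and Y = Y])
    show "f \<in> generated_functions UNIV (functionals s)" using f by (simp add: polynomials_def)
    show "\<Delta> \<in> R" using \<Delta>d by (simp add: E.congr_def)
    show "\<Delta> x * l (P' x \<odot> winv (P x)) = l (Y x)" if "l \<in> functionals s" "\<Delta> x \<noteq> 0" for l x
      using that by (simp add: Y_def winv_def mul_scale functional_scale \<Delta>_def)
    show "E.congr (\<lambda>x. l (Y x)) (\<lambda>x. \<Delta> x * l x)" if "l \<in> functionals s" for l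
      using mcongr_functional[OF function_ideal_equations Y_congr that]
      by (simp add: functional_scale[OF that])
    show "(\<lambda>x. l x) \<in> R" if "l \<in> functionals s" for l using that by (simp add: functional_in_polynomials)
  qed
  then obtain k p where p: "\<forall>x. \<Delta> x \<noteq> 0 \<longrightarrow> p x = \<Delta> x ^ k * f (P' x \<odot> winv (P x))"
    "E.congr p (\<lambda>x. \<Delta> x ^ k * f x)" by (elim exE conjE)
  \<comment> \<open>Nothing is known about \<open>p\<close> where \<open>\<Delta>\<close> vanishes;
    the additional factor \<open>\<Delta>\<close> makes the product zero everywhere.\<close>
  have zero': "\<Delta> x * p x = 0" for x
  proof (cases "\<Delta> x = 0")
    case False
    then have "p x = 0" using p(1) van[OF QV[OF False]] by simp
    then show ?thesis by simp
  qed simp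
  have dR: "d \<in> R" using \<Delta>d by (simp_all add: E.congr_def)
  have "E.congr (\<lambda>x. \<Delta> x * p x) (\<lambda>x. d x * (d x ^ k * f x))"
  proof (rule E.congr_mult[OF \<Delta>d])
    show "E.congr p (\<lambda>x. d x ^ k * f x)"
      by (rule E.congr_trans[OF p(2)]) (intro E.congr_mult E.congr_power \<Delta>d E.congr_refl f)
  qed
  then have "E.congr (\<lambda>x. 0) (\<lambda>x. d x * (d x ^ k * f x))" by (simp only: zero')
  then have "(\<lambda>x. d x * (d x ^ k * f x)) \<in> equations" by (rule E.congr_ideal[OF _ E.ideal_zero])
  moreover have "d x \<noteq> 0" if "\<delta> x \<noteq> 0" for x
  proof -
    have "(4 :: 'k) = 2 * 2" by simp
    then have four: "(4 :: 'k) \<noteq> 0" using two by (metis mult_eq_0_iff)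
    have "inverse (4 * \<delta> x * \<delta> x) * (4 * \<delta> x * \<delta> x) = 1"
      by (rule left_inverse) (use that four in simp)
    then have "s (4 * \<delta> x) (A x) \<odot> s (inverse (4 * \<delta> x * \<delta> x)) (e + x) = e"
      by (simp only: mul_scale A1 scale_scale mult.assoc scale_one)
    then show ?thesis unfolding d_def by (rule dt_inverse)
  qed
  ultimately show ?thesis
    by (intro bexI[of _ "\<lambda>x. d x * d x ^ k"] conjI allI impI PW.mult PW.power dR)
      (simp_all add: mult.assoc \<delta>_def)
qed

lemma nullstellensatz_W:
  assumes I: "function_ideal R I" and one: "(\<lambda>_. 1) \<notin> I"
  shows "\<exists>x. \<forall>f\<in>I. f x = 0"
proof -
  interpret I: function_ideal R I by (rule I)
  obtain h where h: "bij_betw h {0..<card B} B" using ex_bij_betw_nat_finite[OF fin_B] ..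
  define m where "m = card B"
  define \<kappa> where "\<kappa> x i = representation B x (h i)" for x i
  define \<gamma> where "\<gamma> y = (\<Sum>i<m. s (y i) (h i))" for y
  have \<gamma>\<kappa>: "\<gamma> (\<kappa> x) = x" for x
    unfolding \<gamma>_def \<kappa>_def m_def
    using basis_expansion[OF vector_space_axioms fin_B basis_B, of x]
      sum.reindex_bij_betw[OF h, of "\<lambda>b. s (representation B x b) b"] by (simp add: atLeast0LessThan)
  have f\<gamma>: "(\<lambda>y. f (\<gamma> y)) \<in> poly_fun m" if "f \<in> R" for f
    using that unfolding polynomials_def
  proof induction
    case (functional l)
    then show ?case unfolding \<gamma>_def functional_sum[OF functional] functional_scale[OF functional]
      by (intro PF.sum PF.mult PF.const poly_fun_var) auto
  qed (simp_all add: PF.const PF.add PF.mult)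
  have p\<kappa>: "(\<lambda>x. p (\<kappa> x)) \<in> R" if "p \<in> poly_fun m" for p
    by (rule poly_fun_compose[OF function_ring_polynomials that])
      (simp add: \<kappa>_def functional_in_polynomials functional_representation)
  define I' where "I' = {p \<in> poly_fun m. (\<lambda>x. p (\<kappa> x)) \<in> I}"
  have "function_ideal (poly_fun m) I'"
  proof unfold_locales
    show "(\<lambda>x. p x + q x) \<in> I'" if "p \<in> I'" "q \<in> I'" for p q
      using that PF.add[of p m q] I.ideal_add[of "\<lambda>x. p (\<kappa> x)" "\<lambda>x. q (\<kappa> x)"] by (simp add: I'_def)
    show "(\<lambda>x. r x * p x) \<in> I'" if "r \<in> poly_fun m" "p \<in> I'" for r p
      using that PF.mult[of r m p] I.ideal_mult[OF p\<kappa>[OF that(1)], of "\<lambda>x. p (\<kappa> x)"] by (simp add: I'_def)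
  qed (simp_all add: I'_def PF.const I.ideal_zero)
  moreover have "(\<lambda>_. 1) \<notin> I'" using one by (simp add: I'_def)
  ultimately obtain y where y: "\<forall>p\<in>I'. p y = 0" using nullstellensatz by metis
  have "f (\<gamma> y) = 0" if f: "f \<in> I" for f
  proof -
    have "(\<lambda>y. f (\<gamma> y)) \<in> I'"
      unfolding I'_def using f f\<gamma>[OF subsetD[OF I.ideal_subset f]] by (simp add: \<gamma>\<kappa>)
    from bspec[OF y this] show ?thesis .
  qed
  then show ?thesis by (intro exI[of _ "\<gamma> y"] ballI)
qed

text \<open>The ideal \<open>I\<close> of all \<open>h\<close> with \<open>h * f\<close> in
  \<open>equations\<close> contains the equations, so if it were proper it would have a zero
  \<open>x\<close> in \<open>V\<close>. Translation by \<open>x\<close> moves this point to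
  \<open>e\<close>: the multiplier that \<open>vanishing_times_denominator\<close> gives for the
  translated \<open>f\<close> is nonzero at \<open>e\<close>, and translated back it is a member of
  \<open>I\<close> that is nonzero at \<open>x\<close>.\<close>

theorem vanishing_ideal_V:
  assumes f: "f \<in> R" and van: "\<And>x. x \<in> V \<Longrightarrow> f x = 0"
  shows "f \<in> equations"
proof (rule ccontr)
  assume not: "f \<notin> equations"
  define I where "I = {h \<in> R. (\<lambda>x. h x * f x) \<in> equations}"
  have I: "function_ideal R I"
  proof unfold_locales
    show "(\<lambda>_. 0) \<in> I" by (simp add: I_def PW.const E.ideal_zero)
    show "(\<lambda>x. p x + q x) \<in> I" if "p \<in> I" "q \<in> I" for p q
      using that PW.add[of p s q] E.ideal_add[of "\<lambda>x. p x * f x" "\<lambda>x. q x * f x"] by (simp add: I_def distrib_right)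
    show "(\<lambda>x. r x * p x) \<in> I" if "r \<in> R" "p \<in> I" for r p
      using that PW.mult[of r s p] E.ideal_mult[of r "\<lambda>x. p x * f x"] by (simp add: I_def mult.assoc)
  qed (simp add: I_def subset_iff)
  have "(\<lambda>_. 1) \<notin> I" using not by (simp add: I_def)
  from nullstellensatz_W[OF I this] obtain x where x: "\<forall>h\<in>I. h x = 0" ..
  have "l (x \<odot> \<tau> x - e) = 0" if l: "l \<in> functionals s" for l
  proof -
    have "(\<lambda>x. f x * l (x \<odot> \<tau> x - e)) \<in> equations" by (rule E.ideal_mult[OF f equations_base[OF l]])
    then have "(\<lambda>x. l (x \<odot> \<tau> x - e)) \<in> I"
      unfolding I_def using subsetD[OF E.ideal_subset equations_base[OF l]] by (simp add: mult.commute)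
    from bspec[OF x this] show ?thesis .
  qed
  from this[OF functional_entry] have "\<Phi> (x \<odot> \<tau> x - e) = \<Phi> 0"
    unfolding \<Phi>_zero using \<Phi>_dim by (intro eq_matI) auto
  then have xV: "x \<in> V" by (simp add: \<Phi>_eq_iff V_def)
  define g where "g = \<tau> x"
  have gV: "g \<in> V" and gx: "g \<odot> x = e" using V_\<tau>[OF xV] V_sym[OF xV] by (simp_all add: g_def)
  define f' where "f' = (\<lambda>y. f (x \<odot> y))"
  have "f' \<in> R" unfolding f'_def
    by (rule matrix_over_polynomial[OF function_ring_polynomials _ f])
      (simp add: \<Phi>_mul PW.matrix_over_mult matrix_over_id PW.matrix_over_const \<Phi>_carrier)
  from vanishing_times_denominator[OF this] obtain h where
    h: "h \<in> R" "(\<lambda>y. h y * f' y) \<in> equations" "\<forall>y. dt (e + y) \<noteq> 0 \<longrightarrow> h y \<noteq> 0"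
    using van[OF V_mul[OF xV]] by (auto simp: f'_def)
  have "(\<lambda>y. h (g \<odot> y) * f' (g \<odot> y)) \<in> equations" using equations_translate[OF h(2), of g] gV by simp
  moreover have "f' (g \<odot> y) = f y" for y
    using xV by (simp add: f'_def g_def mul_assoc[symmetric] V_def mul_one)
  moreover have "(\<lambda>y. h (g \<odot> y)) \<in> R"
    by (rule matrix_over_polynomial[OF function_ring_polynomials _ h(1)])
      (simp add: \<Phi>_mul PW.matrix_over_mult matrix_over_id PW.matrix_over_const \<Phi>_carrier)
  ultimately have "(\<lambda>y. h (g \<odot> y)) \<in> I" by (simp add: I_def)
  from bspec[OF x this] have "h e = 0" by (simp add: gx)
  moreover have "dt (e + e) \<noteq> 0" using two by (simp add: two_e dt_scale_one)
  ultimately show False using h(3) by blast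
qed

end

section \<open>The bilinear form of an involution\<close>

text \<open>The number of positions strictly below the diagonal of a matrix of size
  \<open>2 * n\<close>.\<close>

lemma sum_triangle: "(\<Sum>j<2 * n. j) = 2 * n\<^sup>2 - (n::nat)"
proof -
  have "(\<Sum>j<2 * n. j) + n = 2 * n\<^sup>2"
    by (induction n) (simp_all add: power2_eq_square algebra_simps)
  then show ?thesis by simp
qed

text \<open>The same count with the diagonal included.\<close>

lemma sum_triangle_Suc: "(\<Sum>j<2 * n. Suc j) = 2 * n\<^sup>2 + (n::nat)"
  by (induction n) (simp_all add: power2_eq_square algebra_simps)

context matrix_algebra
begin

text \<open>The Skolem--Noether argument: if row \<open>p\<close> of \<open>\<tau> (unit_mat (0, 0))\<close> is not zero, then the rows of
  \<open>g\<close> can be taken to be the rows \<open>p\<close> of the matrices \<open>\<tau> (unit_mat (a, 0))\<close>.\<close>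

lemma exists_form_matrix:
  assumes N: "N > 0"
  shows "\<exists>g. dt g \<noteq> 0 \<and> (\<forall>x. \<Phi> g * \<Phi> (\<tau> x) = transpose_mat (\<Phi> x) * \<Phi> g)"
proof -
  have "unit_mat (0, 0) \<noteq> 0"
  proof
    assume "unit_mat (0, 0) = 0"
    then have "\<Phi> (unit_mat (0, 0)) $$ (0, 0) = \<Phi> 0 $$ (0, 0)" by simp
    then show False using N by (simp add: \<Phi>_unit_mat \<Phi>_zero)
  qed
  then have "\<tau> (unit_mat (0, 0)) \<noteq> 0" using \<tau>_\<tau>[of "unit_mat (0, 0)"] \<tau>_zero by auto
  then have neq: "\<Phi> (\<tau> (unit_mat (0, 0))) \<noteq> 0\<^sub>m N N" by (simp add: \<Phi>_zero[symmetric] \<Phi>_eq_iff)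
  have "\<exists>p<N. \<exists>q<N. \<Phi> (\<tau> (unit_mat (0, 0))) $$ (p, q) \<noteq> 0"
  proof (rule ccontr)
    assume "\<not> ?thesis"
    then have "\<Phi> (\<tau> (unit_mat (0, 0))) = 0\<^sub>m N N" by (intro eq_matI) (auto simp: \<Phi>_dim)
    then show False using neq by simp
  qed
  then obtain p q where pq: "p < N" "q < N" "\<Phi> (\<tau> (unit_mat (0, 0))) $$ (p, q) \<noteq> 0" by auto
  define g where "g = \<Psi> (Matrix.mat N N (\<lambda>(a, b). \<Phi> (\<tau> (unit_mat (a, 0))) $$ (p, b)))"
  have g: "\<Phi> g = Matrix.mat N N (\<lambda>(a, b). \<Phi> (\<tau> (unit_mat (a, 0))) $$ (p, b))"
    unfolding g_def by (rule \<Phi>_\<Psi>) simp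
  \<comment> \<open>Write \<open>E_a\<close> for \<open>unit_mat (a, 0)\<close>. Row
    \<open>a\<close> of \<open>g\<close> times \<open>\<tau> x\<close> is row \<open>p\<close> of
    \<open>\<tau> (x E_a)\<close>, and \<open>x E_a\<close> is the sum of the \<open>E_i\<close>
    with the entries of column \<open>a\<close> of \<open>x\<close> as coefficients.\<close>
  have entry: "(\<Phi> g * \<Phi> (\<tau> x)) $$ (a, b) = (transpose_mat (\<Phi> x) * \<Phi> g) $$ (a, b)"
    if ab: "a < N" "b < N" for a b x
  proof -
    have "(\<Phi> g * \<Phi> (\<tau> x)) $$ (a, b) = \<Phi> (\<tau> (unit_mat (a, 0)) \<odot> \<tau> x) $$ (p, b)"
      using ab pq by (simp add: \<Phi>_mul g scalar_prod_def \<Phi>_dim)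
    also have "\<tau> (unit_mat (a, 0)) \<odot> \<tau> x = \<tau> (x \<odot> unit_mat (a, 0))" by (simp add: \<tau>_mul)
    also have "x \<odot> unit_mat (a, 0) = (\<Sum>i<N. s (\<Phi> x $$ (i, a)) (unit_mat (i, 0)))"
    proof -
      have "\<Phi> (x \<odot> unit_mat (a, 0)) = \<Phi> (\<Sum>i<N. s (\<Phi> x $$ (i, a)) (unit_mat (i, 0)))"
      proof (rule eq_matI)
        fix i j assume "i < dim_row (\<Phi> (\<Sum>i<N. s (\<Phi> x $$ (i, a)) (unit_mat (i, 0))))"
          "j < dim_col (\<Phi> (\<Sum>i<N. s (\<Phi> x $$ (i, a)) (unit_mat (i, 0))))"
        then have ij: "i < N" "j < N" by (simp_all add: \<Phi>_dim)
        have "\<Phi> (x \<odot> unit_mat (a, 0)) $$ (i, j) = (\<Sum>c\<in>{0..<N}. \<Phi> x $$ (i, c) * (if (c, j) = (a, 0) then 1 else 0))"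
          using ij by (simp add: \<Phi>_mul \<Phi>_unit_mat scalar_prod_def \<Phi>_dim)
        also have "\<dots> = (\<Sum>c\<in>{0..<N}. if c = a then (if j = 0 then \<Phi> x $$ (i, a) else 0) else 0)"
          by (intro sum.cong) auto
        also have "\<dots> = (if j = 0 then \<Phi> x $$ (i, a) else 0)" using ab by simp
        also have "\<dots> = (\<Sum>c<N. if c = i then (if j = 0 then \<Phi> x $$ (i, a) else 0) else 0)" using ij by simp
        also have "\<dots> = (\<Sum>c<N. \<Phi> x $$ (c, a) * (if (i, j) = (c, 0) then 1 else 0))"
          by (intro sum.cong) auto
        finally show "\<Phi> (x \<odot> unit_mat (a, 0)) $$ (i, j) = \<Phi> (\<Sum>i<N. s (\<Phi> x $$ (i, a)) (unit_mat (i, 0))) $$ (i, j)"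
          unfolding \<Phi>_entry_sum[OF ij] using ij by (simp add: \<Phi>_unit_mat)
      qed (simp_all add: \<Phi>_dim)
      then show ?thesis by (simp only: \<Phi>_eq_iff)
    qed
    also have "\<tau> (\<Sum>i<N. s (\<Phi> x $$ (i, a)) (unit_mat (i, 0))) = (\<Sum>i<N. s (\<Phi> x $$ (i, a)) (\<tau> (unit_mat (i, 0))))"
    proof -
      have "\<tau> (\<Sum>i<m. f i) = (\<Sum>i<m. \<tau> (f i))" for m :: nat and f
        by (induction m) (simp_all add: \<tau>_zero \<tau>_add)
      then show ?thesis by (simp add: \<tau>_scale)
    qed
    also have "\<Phi> \<dots> $$ (p, b) = (\<Sum>i<N. \<Phi> x $$ (i, a) * \<Phi> (\<tau> (unit_mat (i, 0))) $$ (p, b))"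
      using pq ab by (simp only: \<Phi>_entry_sum)
    also have "\<dots> = (transpose_mat (\<Phi> x) * \<Phi> g) $$ (a, b)"
      using ab by (simp add: scalar_prod_def g \<Phi>_dim atLeast0LessThan)
    finally show ?thesis .
  qed
  have rel: "\<Phi> g * \<Phi> (\<tau> x) = transpose_mat (\<Phi> x) * \<Phi> g" for x
    by (rule eq_matI) (use entry in \<open>simp_all add: \<Phi>_dim\<close>)
  \<comment> \<open>By \<open>rel\<close> the kernel of \<open>g\<close> is stable under every
    \<open>\<tau> x\<close>, thus under every matrix. A nonzero \<open>v\<close> in it would be
    carried by a matrix unit to a multiple of the unit vector \<open>q\<close>, but entry
    \<open>(0, q)\<close> of \<open>g\<close> is nonzero by the choice of \<open>p\<close> and
    \<open>q\<close>.\<close>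
  have "dt g \<noteq> 0"
  proof
    assume "dt g = 0"
    then obtain v where v: "v \<in> carrier_vec N" "v \<noteq> 0\<^sub>v N" "\<Phi> g *\<^sub>v v = 0\<^sub>v N"
      using det_0_iff_vec_prod_zero_field[OF \<Phi>_carrier[of g]] by (auto simp: dt_def)
    have "\<exists>c<N. Matrix.vec_index v c \<noteq> 0"
    proof (rule ccontr)
      assume "\<not> ?thesis"
      then have "v = 0\<^sub>v N" using v(1) by (intro eq_vecI) auto
      then show False using v(2) by simp
    qed
    then obtain c where c: "c < N" "Matrix.vec_index v c \<noteq> 0" by auto
    define x where "x = \<tau> (unit_mat (q, c))"
    have \<tau>x: "\<tau> x = unit_mat (q, c)" by (simp add: x_def \<tau>_\<tau>)
    have "\<Phi> g *\<^sub>v (\<Phi> (\<tau> x) *\<^sub>v v) = transpose_mat (\<Phi> x) *\<^sub>v (\<Phi> g *\<^sub>v v)"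
      using rel[of x] assoc_mult_mat_vec[OF \<Phi>_carrier[of g] \<Phi>_carrier[of "\<tau> x"] v(1)]
        assoc_mult_mat_vec[of "transpose_mat (\<Phi> x)" N N "\<Phi> g" N v] \<Phi>_carrier v(1) by simp
    also have "\<dots> = 0\<^sub>v N" unfolding v(3) using \<Phi>_carrier[of x] by (intro eq_vecI) auto
    finally have zero: "\<Phi> g *\<^sub>v (\<Phi> (unit_mat (q, c)) *\<^sub>v v) = 0\<^sub>v N" by (simp add: \<tau>x)
    have Ev: "\<Phi> (unit_mat (q, c)) *\<^sub>v v = Matrix.vec_index v c \<cdot>\<^sub>v unit_vec N q"
    proof (rule eq_vecI)
      fix i assume "i < dim_vec (Matrix.vec_index v c \<cdot>\<^sub>v unit_vec N q)"
      then have i: "i < N" by simp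
      have "Matrix.vec_index (\<Phi> (unit_mat (q, c)) *\<^sub>v v) i =
        (\<Sum>k\<in>{0..<N}. (if (i, k) = (q, c) then 1 else 0) * Matrix.vec_index v k)"
        using i v(1) by (simp add: \<Phi>_unit_mat scalar_prod_def)
      also have "\<dots> = (\<Sum>k\<in>{0..<N}. if k = c then (if i = q then Matrix.vec_index v c else 0) else 0)"
        by (intro sum.cong) auto
      also have "\<dots> = (if i = q then Matrix.vec_index v c else 0)" using c by simp
      finally show "Matrix.vec_index (\<Phi> (unit_mat (q, c)) *\<^sub>v v) i =
        Matrix.vec_index (Matrix.vec_index v c \<cdot>\<^sub>v unit_vec N q) i" using i pq by (simp add: unit_vec_def)
    qed (simp add: \<Phi>_dim)
    have "Matrix.vec_index (\<Phi> g *\<^sub>v (Matrix.vec_index v c \<cdot>\<^sub>v unit_vec N q)) 0 =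
      Matrix.vec_index v c * \<Phi> g $$ (0, q)"
      using N pq \<Phi>_carrier[of g] by (simp add: mult_mat_vec[OF \<Phi>_carrier] \<Phi>_dim)
    then have "Matrix.vec_index v c * \<Phi> g $$ (0, q) = 0" using zero N unfolding Ev by simp
    then show False using c pq N by (simp add: g)
  qed
  then show ?thesis using rel by blast
qed

text \<open>Transposing the relation and comparing it with the one for \<open>\<tau> x\<close> shows
  that \<open>m\<close>, the inverse of \<open>g\<close> times its transpose, commutes with all
  matrices, so it is a scalar \<open>\<epsilon>\<close>. Transposing twice gives
  \<open>\<epsilon> * \<epsilon> = 1\<close>.\<close>

lemma form_matrix_sign:
  assumes nz: "dt g \<noteq> 0" and rel: "\<And>x. \<Phi> g * \<Phi> (\<tau> x) = transpose_mat (\<Phi> x) * \<Phi> g" and N: "N > 0"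
  shows "\<exists>\<epsilon>. transpose_mat (\<Phi> g) = \<epsilon> \<cdot>\<^sub>m \<Phi> g \<and> (\<epsilon> = 1 \<or> \<epsilon> = -1)"
proof -
  define m where "m = winv g \<odot> \<Psi> (transpose_mat (\<Phi> g))"
  have g': "\<Phi> (\<Psi> (transpose_mat (\<Phi> g))) = transpose_mat (\<Phi> g)"
    by (rule \<Phi>_\<Psi>) (use \<Phi>_carrier[of g] in simp)
  have gm: "\<Phi> g * \<Phi> m = transpose_mat (\<Phi> g)"
    unfolding m_def \<Phi>_mul[symmetric] mul_assoc[symmetric] by (simp add: mul_winv[OF nz] mul_one g')
  have comm: "m \<odot> x = x \<odot> m" for x
  proof -
    have "transpose_mat (\<Phi> (\<tau> x)) * \<Phi> g = \<Phi> g * \<Phi> x" using rel[of "\<tau> x"] by (simp add: \<tau>_\<tau>)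
    moreover have "transpose_mat (\<Phi> (\<tau> x)) * transpose_mat (\<Phi> g) = transpose_mat (\<Phi> g) * \<Phi> x"
      using arg_cong[OF rel[of x], of transpose_mat] \<Phi>_carrier
      by (simp add: transpose_mult[of _ N N _ N])
    ultimately have "\<Phi> g * \<Phi> x * \<Phi> m = \<Phi> g * \<Phi> m * \<Phi> x"
      unfolding gm[symmetric] using \<Phi>_carrier
      by (simp add: assoc_mult_mat[of _ N N _ N _ N, symmetric])
    then have "g \<odot> (x \<odot> m) = g \<odot> (m \<odot> x)"
      by (simp add: \<Phi>_mul[symmetric] \<Phi>_eq_iff mul_assoc)
    then have "winv g \<odot> g \<odot> (x \<odot> m) = winv g \<odot> g \<odot> (m \<odot> x)" by (simp only: mul_assoc)
    then show ?thesis by (simp add: mul_winv[OF nz] mul_one)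
  qed
  define \<epsilon> where "\<epsilon> = \<Phi> m $$ (0, 0)"
  \<comment> \<open>Both products of \<open>m\<close> with the matrix unit at \<open>(b, 0)\<close>
    are compared in the entry \<open>(a, 0)\<close>.\<close>
  have m_entry: "\<Phi> m $$ (a, b) = (if a = b then \<epsilon> else 0)" if ab: "a < N" "b < N" for a b
  proof -
    have "(\<Phi> m * \<Phi> (unit_mat (b, 0))) $$ (a, 0) = (\<Phi> (unit_mat (b, 0)) * \<Phi> m) $$ (a, 0)"
      using comm[of "unit_mat (b, 0)"] by (simp add: \<Phi>_mul[symmetric])
    moreover have "(\<Phi> m * \<Phi> (unit_mat (b, 0))) $$ (a, 0) = \<Phi> m $$ (a, b)"
      using ab N by (simp add: \<Phi>_unit_mat scalar_prod_def \<Phi>_dim if_distrib[of "\<lambda>z. _ * z"] cong: if_cong)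
    moreover have "(\<Phi> (unit_mat (b, 0)) * \<Phi> m) $$ (a, 0) = (if a = b then \<epsilon> else 0)"
      using ab N by (cases "a = b")
        (simp_all add: \<Phi>_unit_mat scalar_prod_def \<Phi>_dim \<epsilon>_def if_distrib[of "\<lambda>z. z * _"] cong: if_cong)
    ultimately show ?thesis by simp
  qed
  have "\<Phi> m = \<epsilon> \<cdot>\<^sub>m 1\<^sub>m N" by (rule eq_matI) (auto simp: m_entry \<Phi>_dim)
  then have eq: "transpose_mat (\<Phi> g) = \<epsilon> \<cdot>\<^sub>m \<Phi> g"
    using gm mult_smult_distrib[OF \<Phi>_carrier[of g] one_carrier_mat[of N], of \<epsilon>]
      right_mult_one_mat[OF \<Phi>_carrier[of g]] by simp
  have "\<epsilon> * \<epsilon> = 1"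
  proof (rule ccontr)
    assume neq: "\<epsilon> * \<epsilon> \<noteq> 1"
    have "\<Phi> g $$ (a, b) = 0" if ab: "a < N" "b < N" for a b
    proof -
      have 1: "\<Phi> g $$ (a, b) = \<epsilon> * \<Phi> g $$ (b, a)" if "a < N" "b < N" for a b
        using arg_cong[OF eq, of "\<lambda>A. A $$ (b, a)"] that by (simp add: \<Phi>_dim)
      have "\<Phi> g $$ (a, b) = \<epsilon> * (\<epsilon> * \<Phi> g $$ (a, b))" using 1[OF ab] 1[OF ab(2,1)] by simp
      then have "(1 - \<epsilon> * \<epsilon>) * \<Phi> g $$ (a, b) = 0" by (simp add: left_diff_distrib mult.assoc)
      then show ?thesis using neq by simp
    qed
    then have "\<Phi> g = \<Phi> 0" unfolding \<Phi>_zero by (intro eq_matI) (simp_all add: \<Phi>_dim)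
    then have "g = 0" by (simp only: \<Phi>_eq_iff)
    then have "e = 0" using mul_winv(1)[OF nz] by (simp add: mul_zero)
    then have "\<Phi> e $$ (0, 0) = \<Phi> 0 $$ (0, 0)" by simp
    then show False using N by (simp add: \<Phi>_one \<Phi>_zero)
  qed
  then have "\<epsilon> = 1 \<or> \<epsilon> = -1" by (simp add: square_eq_1_iff)
  then show ?thesis using eq by blast
qed

text \<open>Multiplication by \<open>g\<close> identifies \<open>Lie\<close> with the matrices whose
  transpose is \<open>- \<epsilon>\<close> times themselves: skew ones for
  \<open>\<epsilon> = 1\<close>, symmetric ones for \<open>\<epsilon> = -1\<close>. The set
  \<open>I\<close> lists the positions of their free entries.\<close>

lemma zariski_dim_sign:
  assumes nz: "dt g \<noteq> 0" and rel: "\<And>x. \<Phi> g * \<Phi> (\<tau> x) = transpose_mat (\<Phi> x) * \<Phi> g"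
    and sign: "transpose_mat (\<Phi> g) = \<epsilon> \<cdot>\<^sub>m \<Phi> g" "\<epsilon> = 1 \<or> \<epsilon> = -1"
    and I: "I = (if \<epsilon> = 1 then SIGMA a:{..<N}. {..<a} else SIGMA a:{..<N}. {..a})"
  shows "zariski_dim s V = enat (card I)"
proof -
  have two': "- 1 \<noteq> (1 :: 'k)" using two by (metis add.right_inverse one_add_one)
  have le: "a < N \<and> b < N \<and> b \<le> a" if "(a, b) \<in> I" for a b using that unfolding I by (auto split: if_splits)
  have diag: "\<epsilon> = -1" if "(a, a) \<in> I" for a using that sign(2) unfolding I by (auto split: if_splits)
  have fin: "finite I" unfolding I by simp
  \<comment> \<open>Entry \<open>1\<close> at \<open>p\<close> and \<open>- \<epsilon>\<close> at
    the mirrored position. On the diagonal the first case prevails; such \<open>p\<close> are in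
    \<open>I\<close> only for \<open>\<epsilon> = -1\<close>, where the two values agree.\<close>
  define w where "w p = \<Psi> (Matrix.mat N N (\<lambda>(a, b). if (a, b) = p then 1 else if (b, a) = p then - \<epsilon> else 0))" for p
  have \<Phi>w: "\<Phi> (w p) = Matrix.mat N N (\<lambda>(a, b). if (a, b) = p then 1 else if (b, a) = p then - \<epsilon> else 0)" for p
    unfolding w_def by (rule \<Phi>_\<Psi>) simp
  define L where "L p x = \<Phi> (g \<odot> x) $$ p" for p x
  define \<beta> where "\<beta> p = winv g \<odot> w p" for p
  have g\<beta>: "g \<odot> \<beta> p = w p" for p by (simp add: \<beta>_def mul_assoc[symmetric] mul_winv[OF nz] mul_one)
  have Lie_iff: "x \<in> Lie \<longleftrightarrow> transpose_mat (\<Phi> (g \<odot> x)) = (- \<epsilon>) \<cdot>\<^sub>m \<Phi> (g \<odot> x)" for x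
  proof -
    have "transpose_mat (\<Phi> (g \<odot> x)) = transpose_mat (\<Phi> x) * (\<epsilon> \<cdot>\<^sub>m \<Phi> g)"
      unfolding \<Phi>_mul using \<Phi>_carrier sign(1) by (simp add: transpose_mult[of _ N N _ N])
    also have "\<dots> = \<epsilon> \<cdot>\<^sub>m (\<Phi> g * \<Phi> (\<tau> x))"
      unfolding rel by (rule mult_smult_distrib[of _ N N _ N]) (use \<Phi>_carrier[of x] \<Phi>_carrier[of g] in auto)
    finally have "transpose_mat (\<Phi> (g \<odot> x)) = \<Phi> (s \<epsilon> (g \<odot> \<tau> x))" by (simp add: \<Phi>_mul \<Phi>_scale)
    moreover have "(- \<epsilon>) \<cdot>\<^sub>m \<Phi> (g \<odot> x) = \<Phi> (s \<epsilon> (g \<odot> (- x)))" by (simp add: \<Phi>_scale[symmetric] mul_uminus)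
    ultimately have "transpose_mat (\<Phi> (g \<odot> x)) = (- \<epsilon>) \<cdot>\<^sub>m \<Phi> (g \<odot> x) \<longleftrightarrow> s \<epsilon> (g \<odot> \<tau> x) = s \<epsilon> (g \<odot> (- x))"
      by (simp only: \<Phi>_eq_iff)
    also have "\<dots> \<longleftrightarrow> g \<odot> \<tau> x = g \<odot> (- x)" using sign(2) by auto
    also have "\<dots> \<longleftrightarrow> \<tau> x = - x"
    proof
      assume "g \<odot> \<tau> x = g \<odot> (- x)"
      then have "winv g \<odot> g \<odot> \<tau> x = winv g \<odot> g \<odot> (- x)" by (simp only: mul_assoc)
      then show "\<tau> x = - x" by (simp add: mul_winv[OF nz] mul_one)
    qed simp
    finally show ?thesis by (simp add: Lie_def)
  qed
  have \<epsilon>\<epsilon>: "\<epsilon> * \<epsilon> = 1" using sign(2) by auto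
  have \<beta>_Lie: "\<beta> p \<in> Lie" if p: "p \<in> I" for p
    unfolding Lie_iff g\<beta>
  proof (rule eq_matI)
    fix a b assume "a < dim_row ((- \<epsilon>) \<cdot>\<^sub>m \<Phi> (w p))" "b < dim_col ((- \<epsilon>) \<cdot>\<^sub>m \<Phi> (w p))"
    then have ab: "a < N" "b < N" by (simp_all add: \<Phi>_dim)
    show "transpose_mat (\<Phi> (w p)) $$ (a, b) = ((- \<epsilon>) \<cdot>\<^sub>m \<Phi> (w p)) $$ (a, b)"
    proof (cases "a = b")
      case True
      then show ?thesis using ab diag[of a] p by (auto simp: \<Phi>w)
    next
      case False
      then show ?thesis using ab \<epsilon>\<epsilon> by (auto simp: \<Phi>w)
    qed
  qed (simp_all add: \<Phi>_dim)
  have L_functional: "L p \<in> functionals s" if p: "p \<in> I" for p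
  proof -
    obtain a b where "p = (a, b)" "a < N" "b < N" using le p by (cases p) auto
    then show ?thesis
      unfolding L_def by (intro functionalI) (simp_all add: mul_right mul_scale \<Phi>_add \<Phi>_scale \<Phi>_dim)
  qed
  have dual: "L p (\<beta> q) = (if p = q then 1 else 0)" if pq: "p \<in> I" "q \<in> I" for p q
  proof -
    obtain a b where p: "p = (a, b)" "a < N" "b < N" "b \<le> a" using le pq(1) by (cases p) auto
    obtain c d where q: "q = (c, d)" "d \<le> c" using le pq(2) by (cases q) auto
    show ?thesis unfolding L_def g\<beta> using p q by (auto simp: \<Phi>w)
  qed
  have expand: "x = (\<Sum>p\<in>I. s (L p x) (\<beta> p))" if x: "x \<in> Lie" for x
  proof -
    have tr: "\<Phi> (g \<odot> x) $$ (b, a) = - \<epsilon> * \<Phi> (g \<odot> x) $$ (a, b)" if "a < N" "b < N" for a b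
      using arg_cong[OF x[unfolded Lie_iff], of "\<lambda>A. A $$ (a, b)"] that by (simp add: \<Phi>_dim)
    have "\<Phi> (g \<odot> x) = \<Phi> (\<Sum>p\<in>I. s (L p x) (w p))"
    proof (rule eq_matI)
      fix a b assume "a < dim_row (\<Phi> (\<Sum>p\<in>I. s (L p x) (w p)))" "b < dim_col (\<Phi> (\<Sum>p\<in>I. s (L p x) (w p)))"
      then have ab: "a < N" "b < N" by (simp_all add: \<Phi>_dim)
      have eq: "\<Phi> (\<Sum>p\<in>I. s (L p x) (w p)) $$ (a, b) =
        (\<Sum>p\<in>I. L p x * (if (a, b) = p then 1 else if (b, a) = p then - \<epsilon> else 0))"
        unfolding \<Phi>_entry_sum[OF ab] using ab by (simp add: \<Phi>w)
      consider "(a, b) \<in> I" | "(a, b) \<notin> I" "(b, a) \<in> I" | "a = b" "(a, b) \<notin> I" "\<epsilon> = 1"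
        using ab sign(2) two' unfolding I by (cases a b rule: linorder_cases) (auto split: if_splits)
      then have "(\<Sum>p\<in>I. L p x * (if (a, b) = p then 1 else if (b, a) = p then - \<epsilon> else 0)) = \<Phi> (g \<odot> x) $$ (a, b)"
      proof cases
        case 1
        then have "(b, a) \<in> I \<Longrightarrow> a = b" using le[of a b] le[of b a] by auto
        then have "(\<Sum>p\<in>I. L p x * (if (a, b) = p then 1 else if (b, a) = p then - \<epsilon> else 0)) =
          (\<Sum>p\<in>I. if p = (a, b) then L (a, b) x else 0)" by (intro sum.cong) auto
        then show ?thesis using 1 fin by (simp add: L_def)
      next
        case 2
        have "(\<Sum>p\<in>I. L p x * (if (a, b) = p then 1 else if (b, a) = p then - \<epsilon> else 0)) =
          (\<Sum>p\<in>I. if p = (b, a) then - \<epsilon> * L (b, a) x else 0)"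
        proof (intro sum.cong refl)
          fix p assume "p \<in> I"
          then have "(a, b) \<noteq> p" using 2(1) by blast
          then show "L p x * (if (a, b) = p then 1 else if (b, a) = p then - \<epsilon> else 0) =
            (if p = (b, a) then - \<epsilon> * L (b, a) x else 0)"
            by (cases "p = (b, a)") (simp_all only: if_False if_True refl mult_zero_right mult.commute[of "- \<epsilon>"] eq_commute[of _ p])
        qed
        also have "\<dots> = - \<epsilon> * L (b, a) x" using 2(2) fin by simp
        also have "\<dots> = \<Phi> (g \<odot> x) $$ (a, b)" unfolding L_def by (rule tr[OF ab(2,1), symmetric])
        finally show ?thesis .
      next
        case 3
        have "(\<Sum>p\<in>I. L p x * (if (a, b) = p then 1 else if (b, a) = p then - \<epsilon> else 0)) = 0"
        proof (rule sum.neutral, rule ballI)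
          fix p assume "p \<in> I"
          then have "(a, b) \<noteq> p" "(b, a) \<noteq> p" using 3(1,2) by blast+
          then show "L p x * (if (a, b) = p then 1 else if (b, a) = p then - \<epsilon> else 0) = 0"
            by (simp only: if_False mult_zero_right)
        qed
        moreover have "\<Phi> (g \<odot> x) $$ (a, b) = 0"
        proof -
          have "\<Phi> (g \<odot> x) $$ (a, b) = - \<Phi> (g \<odot> x) $$ (a, b)"
            using tr[OF ab] unfolding 3(1,3) mult_minus1 .
          then have "\<Phi> (g \<odot> x) $$ (a, b) + \<Phi> (g \<odot> x) $$ (a, b) = 0"
            by (rule eq_neg_iff_add_eq_0[THEN iffD1])
          then have "2 * \<Phi> (g \<odot> x) $$ (a, b) = 0" by (simp only: mult_2)
          then show ?thesis using two by simp
        qed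
        ultimately show ?thesis by simp
      qed
      then show "\<Phi> (g \<odot> x) $$ (a, b) = \<Phi> (\<Sum>p\<in>I. s (L p x) (w p)) $$ (a, b)" by (simp only: eq)
    qed (simp_all add: \<Phi>_dim)
    then have "g \<odot> x = (\<Sum>p\<in>I. s (L p x) (w p))" by (simp only: \<Phi>_eq_iff)
    then have "winv g \<odot> (g \<odot> x) = winv g \<odot> (\<Sum>p\<in>I. s (L p x) (w p))" by simp
    also have "\<dots> = (\<Sum>p\<in>I. s (L p x) (\<beta> p))"
      using fin by (induction I rule: finite_induct) (simp_all add: mul_zero mul_right mul_scale \<beta>_def)
    finally show ?thesis by (simp add: mul_assoc[symmetric] mul_winv[OF nz] mul_one)
  qed
  obtain h where h: "bij_betw h {0..<card I} I" using ex_bij_betw_nat_finite[OF fin] ..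
  have hI: "i < card I \<Longrightarrow> h i \<in> I" for i using h by (auto simp: bij_betw_def)
  show ?thesis
  proof (rule zariski_dim_V[where b = "\<lambda>i. \<beta> (h i)" and l = "\<lambda>i. L (h i)"])
    show "L (h i) (\<beta> (h j)) = (if i = j then 1 else 0)" if "i < card I" "j < card I" for i j
      using dual[OF hI[OF that(1)] hI[OF that(2)]] h that by (auto simp: bij_betw_def inj_on_def)
    show "x = (\<Sum>i<card I. s (L (h i) x) (\<beta> (h i)))" if "x \<in> Lie" for x
    proof (rule trans[OF expand[OF that]])
      show "(\<Sum>p\<in>I. s (L p x) (\<beta> p)) = (\<Sum>i<card I. s (L (h i) x) (\<beta> (h i)))"
        using sum.reindex_bij_betw[OF h, of "\<lambda>p. s (L p x) (\<beta> p)"] by (simp add: atLeast0LessThan)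
    qed
  qed (use \<beta>_Lie L_functional hI in auto)
qed

text \<open>Multiplying \<open>\<tau> x \<odot> x = e\<close> by \<open>g\<close> and moving
  \<open>g\<close> past \<open>\<tau> x\<close> turns the equation of \<open>V\<close> into
  \<open>x^T g x = g\<close>, the matrix form of an isometry.\<close>

lemma isometry_group_V:
  assumes nz: "dt g \<noteq> 0" and rel: "\<And>x. \<Phi> g * \<Phi> (\<tau> x) = transpose_mat (\<Phi> x) * \<Phi> g"
  shows "\<Phi> ` V = isometry_group N (\<lambda>u v. scalar_prod u (\<Phi> g *\<^sub>v v))"
proof -
  have V_iff: "x \<in> V \<longleftrightarrow> transpose_mat (\<Phi> x) * \<Phi> g * \<Phi> x = \<Phi> g" for x
  proof -
    have "x \<in> V \<longleftrightarrow> \<tau> x \<odot> x = e" using inverse_sym[of x "\<tau> x"] inverse_sym[of "\<tau> x" x] by (auto simp: V_def)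
    also have "\<dots> \<longleftrightarrow> g \<odot> (\<tau> x \<odot> x) = g"
    proof
      assume "g \<odot> (\<tau> x \<odot> x) = g"
      then have "winv g \<odot> g \<odot> (\<tau> x \<odot> x) = winv g \<odot> g" by (simp only: mul_assoc)
      then show "\<tau> x \<odot> x = e" by (simp add: mul_winv[OF nz] mul_one)
    qed (simp add: mul_one)
    also have "\<dots> \<longleftrightarrow> \<Phi> g * \<Phi> (\<tau> x) * \<Phi> x = \<Phi> g"
      by (simp add: \<Phi>_mul[symmetric] \<Phi>_eq_iff mul_assoc)
    finally show ?thesis by (simp add: rel)
  qed
  have form: "scalar_prod (\<Phi> x *\<^sub>v u) (\<Phi> g *\<^sub>v (\<Phi> x *\<^sub>v v)) = scalar_prod u ((transpose_mat (\<Phi> x) * \<Phi> g * \<Phi> x) *\<^sub>v v)"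
    if uv: "u \<in> carrier_vec N" "v \<in> carrier_vec N" for x u v
  proof -
    have "scalar_prod (\<Phi> x *\<^sub>v u) (\<Phi> g *\<^sub>v (\<Phi> x *\<^sub>v v)) =
      scalar_prod (transpose_mat (transpose_mat (\<Phi> x)) *\<^sub>v u) (\<Phi> g *\<^sub>v (\<Phi> x *\<^sub>v v))" by simp
    also have "\<dots> = scalar_prod u (transpose_mat (\<Phi> x) *\<^sub>v (\<Phi> g *\<^sub>v (\<Phi> x *\<^sub>v v)))"
      by (rule transpose_vec_mult_scalar[of _ N N])
        (use uv \<Phi>_carrier[of x] in \<open>auto intro!: mult_mat_vec_carrier[OF \<Phi>_carrier]\<close>)
    also have "transpose_mat (\<Phi> x) *\<^sub>v (\<Phi> g *\<^sub>v (\<Phi> x *\<^sub>v v)) = (transpose_mat (\<Phi> x) * \<Phi> g * \<Phi> x) *\<^sub>v v"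
      using uv(2) \<Phi>_carrier[of x] \<Phi>_carrier[of g]
        assoc_mult_mat_vec[of "transpose_mat (\<Phi> x)" N N "\<Phi> g" N "\<Phi> x *\<^sub>v v"]
        assoc_mult_mat_vec[of "transpose_mat (\<Phi> x) * \<Phi> g" N N "\<Phi> x" N v]
      by (simp add: mult_carrier_mat[of _ N N _ N] mult_mat_vec_carrier[of _ N N])
    finally show ?thesis .
  qed
  have mat_eq: "A = A'" if A: "A \<in> carrier_mat N N" "A' \<in> carrier_mat N N"
    and eq: "\<And>u v. u \<in> carrier_vec N \<Longrightarrow> v \<in> carrier_vec N \<Longrightarrow> scalar_prod u (A *\<^sub>v v) = scalar_prod u (A' *\<^sub>v v)"
    for A A' :: "'k Matrix.mat"
  proof (rule eq_matI)
    fix i j assume "i < dim_row A'" "j < dim_col A'"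
    then have ij: "i < N" "j < N" using A by auto
    have "scalar_prod (unit_vec N i) (M *\<^sub>v unit_vec N j) = M $$ (i, j)" if "M \<in> carrier_mat N N" for M :: "'k Matrix.mat"
      using that ij by (simp add: scalar_prod_left_unit[of _ N])
    then show "A $$ (i, j) = A' $$ (i, j)" using eq[of "unit_vec N i" "unit_vec N j"] A by simp
  qed (use A in auto)
  have iso_iff: "\<Phi> x \<in> isometry_group N (\<lambda>u v. scalar_prod u (\<Phi> g *\<^sub>v v)) \<longleftrightarrow> x \<in> V" for x
  proof
    assume "\<Phi> x \<in> isometry_group N (\<lambda>u v. scalar_prod u (\<Phi> g *\<^sub>v v))"
    then have "transpose_mat (\<Phi> x) * \<Phi> g * \<Phi> x = \<Phi> g"
      using form[of _ _ x] \<Phi>_carrier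
      by (intro mat_eq) (auto simp: isometry_group_def mult_carrier_mat[of _ N N _ N])
    then show "x \<in> V" by (simp add: V_iff)
  next
    assume x: "x \<in> V"
    then have "x \<odot> \<tau> x = e" "\<tau> x \<odot> x = e" using V_sym by (auto simp: V_def)
    then have "invertible_mat (\<Phi> x)"
      unfolding invertible_mat_def inverts_mat_def
      by (intro conjI exI[of _ "\<Phi> (\<tau> x)"]) (simp_all add: \<Phi>_mul[symmetric] \<Phi>_one \<Phi>_dim)
    then show "\<Phi> x \<in> isometry_group N (\<lambda>u v. scalar_prod u (\<Phi> g *\<^sub>v v))"
      using x form[of _ _ x] \<Phi>_carrier[of x] by (simp add: isometry_group_def V_iff)
  qed
  show ?thesis
  proof
    show "\<Phi> ` V \<subseteq> isometry_group N (\<lambda>u v. scalar_prod u (\<Phi> g *\<^sub>v v))" using iso_iff by auto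
    show "isometry_group N (\<lambda>u v. scalar_prod u (\<Phi> g *\<^sub>v v)) \<subseteq> \<Phi> ` V"
    proof
      fix A assume A: "A \<in> isometry_group N (\<lambda>u v. scalar_prod u (\<Phi> g *\<^sub>v v))"
      then have "\<Phi> (\<Psi> A) = A" by (intro \<Phi>_\<Psi>) (simp add: isometry_group_def)
      then show "A \<in> \<Phi> ` V" using iso_iff[of "\<Psi> A"] A by (metis image_eqI)
    qed
  qed
qed

text \<open>The form \<open>u^T g v\<close> satisfies \<open>b v w = \<epsilon> * b w v\<close>. For
  \<open>\<epsilon> = -1\<close> this gives \<open>2 * b v v = 0\<close>, so that the form is
  alternating.\<close>

theorem form_of_involution:
  assumes N: "N = 2 * n" "n > 0"
  shows "\<exists>b. bilinear_form N b \<and> nondegenerate_form N b \<and> \<Phi> ` V = isometry_group N b \<and>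
    (alternating_form N b \<and> zariski_dim s V = enat (2 * n\<^sup>2 + n) \<or>
     symmetric_form N b \<and> zariski_dim s V = enat (2 * n\<^sup>2 - n))"
proof -
  have "N > 0" using N by simp
  from exists_form_matrix[OF this] obtain g where g: "dt g \<noteq> 0"
    "\<And>x. \<Phi> g * \<Phi> (\<tau> x) = transpose_mat (\<Phi> x) * \<Phi> g" by auto
  from form_matrix_sign[OF g \<open>N > 0\<close>] obtain \<epsilon> where
    \<epsilon>: "transpose_mat (\<Phi> g) = \<epsilon> \<cdot>\<^sub>m \<Phi> g" "\<epsilon> = 1 \<or> \<epsilon> = -1" by auto
  define b where "b = (\<lambda>u v. scalar_prod u (\<Phi> g *\<^sub>v v))"
  note dim = zariski_dim_sign[OF g \<epsilon> refl]
  have gv: "\<Phi> g *\<^sub>v v \<in> carrier_vec N" if "v \<in> carrier_vec N" for v using \<Phi>_carrier[of g] that by auto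
  have "bilinear_form N b" unfolding bilinear_form_def b_def
  proof (intro ballI allI conjI)
    fix u v w :: "'k Matrix.vec" and c assume uvw: "u \<in> carrier_vec N" "v \<in> carrier_vec N" "w \<in> carrier_vec N"
    show "scalar_prod (u + v) (\<Phi> g *\<^sub>v w) = scalar_prod u (\<Phi> g *\<^sub>v w) + scalar_prod v (\<Phi> g *\<^sub>v w)"
      by (rule add_scalar_prod_distrib[of _ N]) (use uvw gv in auto)
    show "scalar_prod w (\<Phi> g *\<^sub>v (u + v)) = scalar_prod w (\<Phi> g *\<^sub>v u) + scalar_prod w (\<Phi> g *\<^sub>v v)"
      using uvw gv by (simp add: mult_add_distrib_mat_vec[OF \<Phi>_carrier] scalar_prod_add_distrib[of _ N])
    show "scalar_prod (c \<cdot>\<^sub>v u) (\<Phi> g *\<^sub>v v) = c * scalar_prod u (\<Phi> g *\<^sub>v v)"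
      by (rule smult_scalar_prod_distrib[of _ N]) (use uvw gv in auto)
    show "scalar_prod u (\<Phi> g *\<^sub>v (c \<cdot>\<^sub>v v)) = c * scalar_prod u (\<Phi> g *\<^sub>v v)"
      unfolding mult_mat_vec[OF \<Phi>_carrier uvw(2)] by (rule scalar_prod_smult_distrib[of _ N]) (use uvw gv in auto)
  qed
  moreover have "nondegenerate_form N b" unfolding nondegenerate_form_def b_def
  proof (intro ballI impI)
    fix v assume v: "v \<in> carrier_vec N" "\<forall>w\<in>carrier_vec N. scalar_prod v (\<Phi> g *\<^sub>v w) = 0"
    show "v = 0\<^sub>v N"
    proof (rule eq_vecI)
      fix i assume "i < dim_vec (0\<^sub>v N :: 'k Matrix.vec)"
      then have i: "i < N" by simp
      define w where "w = \<Phi> (winv g) *\<^sub>v unit_vec N i"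
      have "w \<in> carrier_vec N" using \<Phi>_carrier[of "winv g"] by (simp add: w_def)
      moreover have "\<Phi> g *\<^sub>v w = (\<Phi> g * \<Phi> (winv g)) *\<^sub>v unit_vec N i"
        unfolding w_def using \<Phi>_carrier by (simp add: assoc_mult_mat_vec[of _ N N _ N])
      then have "\<Phi> g *\<^sub>v w = unit_vec N i"
        by (simp add: \<Phi>_mul[symmetric] mul_winv[OF g(1)] \<Phi>_one)
      ultimately show "Matrix.vec_index v i = Matrix.vec_index (0\<^sub>v N) i" using v i by force
    qed (use v in auto)
  qed
  moreover have "\<Phi> ` V = isometry_group N b" unfolding b_def by (rule isometry_group_V[OF g])
  moreover have b_swap: "b v w = \<epsilon> * b w v" if vw: "v \<in> carrier_vec N" "w \<in> carrier_vec N" for v w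
  proof -
    have "b v w = scalar_prod (transpose_mat (\<Phi> g) *\<^sub>v v) w"
      unfolding b_def by (rule transpose_vec_mult_scalar[OF \<Phi>_carrier vw(2,1), symmetric])
    also have "transpose_mat (\<Phi> g) *\<^sub>v v = \<epsilon> \<cdot>\<^sub>v (\<Phi> g *\<^sub>v v)"
      unfolding \<epsilon>(1) using \<Phi>_carrier[of g] vw by (intro eq_vecI) (auto simp: scalar_prod_def sum_distrib_left mult.assoc)
    also have "scalar_prod (\<epsilon> \<cdot>\<^sub>v (\<Phi> g *\<^sub>v v)) w = \<epsilon> * scalar_prod (\<Phi> g *\<^sub>v v) w"
      by (rule smult_scalar_prod_distrib[of _ N]) (use vw gv in auto)
    also have "scalar_prod (\<Phi> g *\<^sub>v v) w = b w v"
      unfolding b_def by (rule comm_scalar_prod[of _ N]) (use vw gv in auto)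
    finally show ?thesis .
  qed
  moreover have "alternating_form N b \<and> zariski_dim s V = enat (2 * n\<^sup>2 + n) \<or>
     symmetric_form N b \<and> zariski_dim s V = enat (2 * n\<^sup>2 - n)"
  proof (cases "\<epsilon> = 1")
    case True
    then show ?thesis using dim b_swap N by (simp add: symmetric_form_def sum_triangle)
  next
    case False
    then have \<epsilon>m: "\<epsilon> = -1" using \<epsilon>(2) by simp
    have "b v v = 0" if "v \<in> carrier_vec N" for v
    proof -
      have "b v v = - b v v" using b_swap[OF that that] unfolding \<epsilon>m mult_minus1 .
      then have "b v v + b v v = 0" by (rule eq_neg_iff_add_eq_0[THEN iffD1])
      then have "2 * b v v = 0" by (simp only: mult_2)
      then show ?thesis using two by simp
    qed
    then show ?thesis using dim False N sum_triangle_Suc[of n] by (simp add: alternating_form_def)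
  qed
  ultimately show ?thesis by blast
qed

end

section \<open>The group of a central simple algebra with involution\<close>

text \<open>Applying \<open>l i\<close> to a linear relation isolates its coefficient at
  \<open>f i\<close>.\<close>

lemma is_basis_dual_family:
  assumes vs: "vector_space s" and I: "finite I"
    and l: "\<And>i x y. l i (x + y) = l i x + l i y" "\<And>i c x. l i (s c x) = c * l i x"
    and dual: "\<And>i j. i \<in> I \<Longrightarrow> j \<in> I \<Longrightarrow> l i (f j) = (if i = j then 1 else 0)"
    and expand: "\<And>x. x = (\<Sum>i\<in>I. s (l i x) (f i))"
  shows "is_basis s (f ` I)" "inj_on f I"
proof -
  interpret vector_space s by (rule vs)
  have l0: "l i 0 = 0" for i using l(2)[of i 0 0] by simp
  have l_sum: "l i (\<Sum>j\<in>A. g j) = (\<Sum>j\<in>A. l i (g j))" for i g A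
    by (induction A rule: infinite_finite_induct) (simp_all add: l0 l)
  show inj: "inj_on f I"
  proof (rule inj_onI)
    fix i j assume ij: "i \<in> I" "j \<in> I" "f i = f j"
    then have "l i (f j) = 1" using dual[of i i] by simp
    then show "i = j" using dual[of i j] ij by (auto split: if_splits)
  qed
  have "independent (f ` I)"
  proof
    assume "dependent (f ` I)"
    then obtain u where u: "\<exists>v\<in>f ` I. u v \<noteq> 0" "(\<Sum>v\<in>f ` I. s (u v) v) = 0"
      using I by (auto simp: dependent_finite)
    then obtain i where i: "i \<in> I" "u (f i) \<noteq> 0" by auto
    have "0 = l i (\<Sum>j\<in>I. s (u (f j)) (f j))" using u(2) by (simp add: sum.reindex[OF inj] l0)
    also have "\<dots> = (\<Sum>j\<in>I. if j = i then u (f i) else 0)"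
      unfolding l_sum using i by (intro sum.cong) (auto simp: l dual)
    also have "\<dots> = u (f i)" using i I by simp
    finally show False using i by simp
  qed
  moreover have "x \<in> span (f ` I)" for x
    by (subst expand[of x]) (intro span_sum span_scale span_base imageI)
  ultimately show "is_basis s (f ` I)" unfolding is_basis_def by auto
qed

lemma four_block_mat_eqD:
  assumes "A \<in> carrier_mat n n" "B \<in> carrier_mat n n" "C \<in> carrier_mat n n" "D \<in> carrier_mat n n"
    "A' \<in> carrier_mat n n" "B' \<in> carrier_mat n n" "C' \<in> carrier_mat n n" "D' \<in> carrier_mat n n"
    and eq: "four_block_mat A B C D = four_block_mat A' B' C' D'"
  shows "A = A' \<and> B = B' \<and> C = C' \<and> D = D'"
proof -
  have e: "four_block_mat A B C D $$ (i, j) = four_block_mat A' B' C' D' $$ (i, j)" for i j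
    by (simp only: eq)
  have dims: "dim_row A = n" "dim_col A = n" "dim_row B = n" "dim_col B = n" "dim_row C = n" "dim_col C = n"
    "dim_row D = n" "dim_col D = n" "dim_row A' = n" "dim_col A' = n" "dim_row B' = n" "dim_col B' = n"
    "dim_row C' = n" "dim_col C' = n" "dim_row D' = n" "dim_col D' = n" using assms by auto
  have "A $$ (i, j) = A' $$ (i, j)" "B $$ (i, j) = B' $$ (i, j)" "C $$ (i, j) = C' $$ (i, j)"
    "D $$ (i, j) = D' $$ (i, j)" if "i < n" "j < n" for i j
    using e[of i j] e[of i "n + j"] e[of "n + i" j] e[of "n + i" "n + j"] that by (simp_all add: dims)
  then show ?thesis by (auto intro!: eq_matI simp: dims)
qed

lemma generated_functions_sum:
  assumes "0 \<in> C" "\<And>i. i \<in> I \<Longrightarrow> p i \<in> generated_functions C L"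
  shows "(\<lambda>x. \<Sum>i\<in>I. p i x) \<in> generated_functions C L"
  using assms(2)
  by (induction I rule: infinite_finite_induct) (simp_all add: generated_functions.const assms(1) generated_functions.add)

lemma matrix_mult_2:
  "((M :: 'r::ring_1 ^ 2 ^ 2) ** M') $ i $ j = M $ i $ 1 * M' $ 1 $ j + M $ i $ 2 * M' $ 2 $ j"
  by (simp add: matrix_matrix_mult_def sum_2)

lemma sigma_hat_nth:
  "sigma_hat \<sigma> M $ 1 $ 1 = \<sigma> (M $ 2 $ 2)" "sigma_hat \<sigma> M $ 1 $ 2 = - \<sigma> (M $ 1 $ 2)"
  "sigma_hat \<sigma> M $ 2 $ 1 = - \<sigma> (M $ 2 $ 1)" "sigma_hat \<sigma> M $ 2 $ 2 = \<sigma> (M $ 1 $ 1)"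
  by (simp_all add: sigma_hat_def)

lemma matrix_2_eqI:
  fixes M M' :: "'r ^ 2 ^ 2"
  assumes "M $ 1 $ 1 = M' $ 1 $ 1" "M $ 1 $ 2 = M' $ 1 $ 2" "M $ 2 $ 1 = M' $ 2 $ 1" "M $ 2 $ 2 = M' $ 2 $ 2"
  shows "M = M'"
  using assms by (simp add: Finite_Cartesian_Product.vec_eq_iff forall_2)

lemma mat_1_nth:
  "(Finite_Cartesian_Product.mat 1 :: 'r::ring_1 ^ 2 ^ 2) $ 1 $ 1 = 1"
  "(Finite_Cartesian_Product.mat 1 :: 'r::ring_1 ^ 2 ^ 2) $ 1 $ 2 = 0"
  "(Finite_Cartesian_Product.mat 1 :: 'r::ring_1 ^ 2 ^ 2) $ 2 $ 1 = 0"
  "(Finite_Cartesian_Product.mat 1 :: 'r::ring_1 ^ 2 ^ 2) $ 2 $ 2 = 1"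
  by (simp_all add: Finite_Cartesian_Product.mat_def)

lemma matrix_2_add_mult: "((M :: 'r::ring_1 ^ 2 ^ 2) + M') ** (L :: 'r ^ 2 ^ 2) = M ** L + M' ** L"
  by (rule matrix_2_eqI) (simp_all add: matrix_mult_2 algebra_simps)

lemma two_neq_zero_CHAR: assumes "CHAR('f::field) \<noteq> 2" shows "(2 :: 'f) \<noteq> 0"
proof
  assume "(2 :: 'f) = 0"
  then have "of_nat 2 = (0 :: 'f)" by simp
  then have dvd: "CHAR('f) dvd 2" by (simp only: of_nat_eq_0_iff_char_dvd)
  then have "CHAR('f) \<le> 2" by (rule dvd_imp_le) simp
  moreover have "CHAR('f) \<noteq> 0"
  proof
    assume "CHAR('f) = 0"
    then have "0 dvd (2 :: nat)" using dvd by (simp only:)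
    then show False by simp
  qed
  moreover have "CHAR('f) \<noteq> Suc 0" by simp
  ultimately show False using assms by simp
qed

section \<open>The algebra and its involution after extension of scalars\<close>

text \<open>The image of \<open>\<iota>\<close> spans the extension, so the last two assumptions
  determine \<open>\<sigma>'\<close>: it is \<open>\<sigma>\<close> extended linearly to the scalars
  of the algebraic closure.\<close>

locale involution_extension =
  fixes s :: "'f::field \<Rightarrow> 'a::ring_1 \<Rightarrow> 'a"
    and \<sigma> :: "'a \<Rightarrow> 'a"
    and n :: nat
    and s' :: "'f alg_closure \<Rightarrow> 'b::ring_1 \<Rightarrow> 'b"
    and \<iota> :: "'a \<Rightarrow> 'b"
    and \<sigma>' :: "'b \<Rightarrow> 'b"
  assumes char: "CHAR('f) \<noteq> 2"
    and csa: "central_simple_algebra s"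
    and dim: "vector_space.dim s (UNIV :: 'a set) = n\<^sup>2"
    and inv: "ring_involution \<sigma>" and lin: "Vector_Spaces.linear s s \<sigma>"
    and ext: "scalar_extension s s' \<iota>"
    and lin': "Vector_Spaces.linear s' s' \<sigma>'" and \<sigma>'_\<iota>: "\<And>a. \<sigma>' (\<iota> a) = \<iota> (\<sigma> a)"
begin

lemma alg: "is_algebra s" and alg': "is_algebra s'"
  using ext by (simp_all add: scalar_extension_def)

sublocale A: vector_space s using alg by (simp add: is_algebra_def)
sublocale B: vector_space s' using alg' by (simp add: is_algebra_def)

lemma mul_s': "s' c x * y = s' c (x * y)" "x * s' c y = s' c (x * y)"
  using alg' by (simp_all add: is_algebra_def)

lemma \<iota>: "\<iota> 1 = 1" "\<iota> (x + y) = \<iota> x + \<iota> y" "\<iota> (x * y) = \<iota> x * \<iota> y" "\<iota> (s c x) = s' (to_ac c) (\<iota> x)"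
  using ext by (simp_all add: scalar_extension_def)

lemma \<iota>_zero: "\<iota> 0 = 0" using \<iota>(2)[of 0 0] by simp

lemma \<iota>_uminus: "\<iota> (- x) = - \<iota> x" using \<iota>(2)[of "-x" x] by (simp add: \<iota>_zero add_eq_0_iff2 add.commute)
lemma \<iota>_minus: "\<iota> (x - y) = \<iota> x - \<iota> y" using \<iota>(2)[of "x - y" y] by simp

lemma \<iota>_sum: "\<iota> (\<Sum>i\<in>I. f i) = (\<Sum>i\<in>I. \<iota> (f i))"
  by (induction I rule: infinite_finite_induct) (simp_all add: \<iota>_zero \<iota>)

definition Bas :: "'a set" where "Bas = (SOME B. finite B \<and> is_basis s B)"

lemma Bas: "finite Bas" "is_basis s Bas"
proof -
  have "\<exists>B. finite B \<and> is_basis s B" using csa by (simp add: central_simple_algebra_def)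
  from someI_ex[OF this] show "finite Bas" "is_basis s Bas" unfolding Bas_def by simp_all
qed

lemma Bas': "inj_on \<iota> Bas" "is_basis s' (\<iota> ` Bas)"
  using ext Bas(2) by (simp_all add: scalar_extension_def)

lemma span_UNIV: "A.span Bas = UNIV" "A.independent Bas" "B.span (\<iota> ` Bas) = UNIV" "B.independent (\<iota> ` Bas)"
  using Bas Bas' by (simp_all add: is_basis_def)

text \<open>Coordinates in the extension are indexed by the basis of \<open>A\<close> itself, so
  those of \<open>\<iota> a\<close> are the images under \<open>to_ac\<close> of those of
  \<open>a\<close>.\<close>

definition cf :: "'b \<Rightarrow> 'a \<Rightarrow> 'f alg_closure" where
  "cf x b = B.representation (\<iota> ` Bas) x (\<iota> b)"

lemma cf_add: "cf (x + y) b = cf x b + cf y b"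
  and cf_scale: "cf (s' c x) b = c * cf x b"
  using span_UNIV by (simp_all add: cf_def B.representation_add B.representation_scale)

lemma cf_zero: "cf 0 b = 0" using cf_scale[of 0 0 b] by simp

lemma cf_sum: "cf (\<Sum>i\<in>I. f i) b = (\<Sum>i\<in>I. cf (f i) b)"
  by (induction I rule: infinite_finite_induct) (simp_all add: cf_zero cf_add)

lemma cf_basis: "a \<in> Bas \<Longrightarrow> b \<in> Bas \<Longrightarrow> cf (\<iota> a) b = (if a = b then 1 else 0)"
  using B.representation_basis[OF span_UNIV(4), of "\<iota> a"] Bas'(1)
  by (auto simp: cf_def inj_on_def)

lemma cf_expand: "(\<Sum>b\<in>Bas. s' (cf x b) (\<iota> b)) = x"
  using basis_expansion[OF B.vector_space_axioms _ Bas'(2), of x] Bas(1)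
  by (simp add: sum.reindex[OF Bas'(1)] cf_def)

lemma expand: "(\<Sum>b\<in>Bas. s (A.representation Bas a b) b) = a"
  using basis_expansion[OF A.vector_space_axioms Bas, of a] by simp

lemma cf_\<iota>: assumes "b \<in> Bas" shows "cf (\<iota> a) b = to_ac (A.representation Bas a b)"
proof -
  have "cf (\<iota> a) b = cf (\<iota> (\<Sum>b\<in>Bas. s (A.representation Bas a b) b)) b" by (simp only: expand)
  also have "\<dots> = (\<Sum>b'\<in>Bas. if b' = b then to_ac (A.representation Bas a b) else 0)"
    unfolding \<iota>_sum \<iota> cf_sum cf_scale using assms by (intro sum.cong) (simp_all add: cf_basis)
  finally show ?thesis using assms Bas(1) by simp
qed

lemma inj_\<iota>: "inj \<iota>"
proof (rule injI)
  fix a a' assume "\<iota> a = \<iota> a'"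
  then have "A.representation Bas a b = A.representation Bas a' b" if "b \<in> Bas" for b
    using cf_\<iota>[OF that, of a] cf_\<iota>[OF that, of a'] by simp
  then have "(\<Sum>b\<in>Bas. s (A.representation Bas a b) b) = (\<Sum>b\<in>Bas. s (A.representation Bas a' b) b)"
    by (intro sum.cong) simp_all
  then show "a = a'" by (simp only: expand)
qed

text \<open>The extension is spanned by the image of \<open>\<iota>\<close>, so identities that are
  linear in \<open>x\<close> pass from \<open>A\<close> to the extension; the laws of
  \<open>\<sigma>\<close> reach \<open>\<sigma>'\<close> in this way.\<close>

lemma extension_induct:
  assumes "\<And>a. P (\<iota> a)" "\<And>x y. P x \<Longrightarrow> P y \<Longrightarrow> P (x + y)" "\<And>c x. P x \<Longrightarrow> P (s' c x)"
  shows "P x"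
proof -
  have "P (\<Sum>b\<in>S. s' (cf x b) (\<iota> b))" for S
    by (induction S rule: infinite_finite_induct) (use assms assms(1)[of 0] in \<open>simp_all add: \<iota>_zero\<close>)
  then show ?thesis by (metis cf_expand)
qed

lemma \<sigma>: "\<sigma> (\<sigma> x) = x" "\<sigma> (x + y) = \<sigma> x + \<sigma> y" "\<sigma> (x * y) = \<sigma> y * \<sigma> x"
  using inv by (simp_all add: ring_involution_def)

lemma \<sigma>'_add: "\<sigma>' (x + y) = \<sigma>' x + \<sigma>' y" and \<sigma>'_scale: "\<sigma>' (s' c x) = s' c (\<sigma>' x)"
  using lin' by (simp_all add: linear_iff_module_hom module_hom.add module_hom.scale)

lemma \<sigma>'_uminus: "\<sigma>' (- x) = - \<sigma>' x"
  using \<sigma>'_add[of "-x" x] \<sigma>'_add[of 0 0] by (simp add: add_eq_0_iff2 add.commute)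

lemma \<sigma>'_\<sigma>': "\<sigma>' (\<sigma>' x) = x"
  by (rule extension_induct[of "\<lambda>x. \<sigma>' (\<sigma>' x) = x"]) (simp_all add: \<sigma>'_\<iota> \<sigma> \<sigma>'_add \<sigma>'_scale)

lemma \<sigma>'_mult: "\<sigma>' (x * y) = \<sigma>' y * \<sigma>' x"
proof (rule extension_induct[of "\<lambda>x. \<sigma>' (x * y) = \<sigma>' y * \<sigma>' x"])
  fix a
  show "\<sigma>' (\<iota> a * y) = \<sigma>' y * \<sigma>' (\<iota> a)"
    by (rule extension_induct[of "\<lambda>y. \<sigma>' (\<iota> a * y) = \<sigma>' y * \<sigma>' (\<iota> a)"])
      (simp_all add: \<iota>(3)[symmetric] \<sigma>'_\<iota> \<sigma> \<sigma>'_add \<sigma>'_scale mul_s' distrib_left distrib_right)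
qed (simp_all add: \<sigma>'_add \<sigma>'_scale mul_s' distrib_left distrib_right)

lemma n_pos: "n > 0"
proof (rule ccontr)
  assume "\<not> n > 0"
  have "card Bas = n\<^sup>2"
    using A.dim_eq_card[of Bas UNIV] span_UNIV dim by simp
  then have "Bas = {}" using Bas(1) \<open>\<not> n > 0\<close> by simp
  then have "(UNIV :: 'a set) = {0}" using span_UNIV(1) by simp
  then have "(1 :: 'a) = 0" by blast
  then show False by simp
qed

text \<open>Wedderburn's theorem gives matrices of some size \<open>r\<close>, and comparing
  dimensions gives \<open>r * r = n * n\<close>.\<close>

lemma exists_splitting:
  "\<exists>\<phi>. bij_betw \<phi> (UNIV :: 'b set) (carrier_mat n n) \<and> \<phi> 1 = 1\<^sub>m n \<and>
    (\<forall>x y. \<phi> (x + y) = \<phi> x + \<phi> y) \<and> (\<forall>x y. \<phi> (x * y) = \<phi> x * \<phi> y) \<and> (\<forall>c x. \<phi> (s' c x) = c \<cdot>\<^sub>m \<phi> x)"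
proof -
  have fin: "finite (\<iota> ` Bas)" using Bas(1) by simp
  from wedderburn[OF alg' fin Bas'(2) simple_ring_scalar_extension[OF csa ext]] obtain r \<phi> where
    \<phi>: "bij_betw \<phi> (UNIV :: 'b set) (carrier_mat r r)" "\<phi> 1 = 1\<^sub>m r"
      "\<forall>x y. \<phi> (x + y) = \<phi> x + \<phi> y" "\<forall>x y. \<phi> (x * y) = \<phi> x * \<phi> y" "\<forall>c x. \<phi> (s' c x) = c \<cdot>\<^sub>m \<phi> x"
    by (elim exE conjE)
  have "card (\<iota> ` Bas) = r * r"
    by (rule matrix_basis_card[OF B.vector_space_axioms fin Bas'(2) \<phi>(1)]) (simp_all add: \<phi>)
  moreover have "card (\<iota> ` Bas) = n\<^sup>2"
    using A.dim_eq_card[of Bas UNIV] span_UNIV dim by (simp add: card_image[OF Bas'(1)])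
  ultimately have "r = n" by (simp add: power2_eq_square[symmetric])
  then show ?thesis using \<phi> by (intro exI[of _ \<phi>] conjI) simp_all
qed

section \<open>Coordinates and rational structure on the 2 by 2 matrices\<close>

abbreviation sc :: "'f alg_closure \<Rightarrow> 'b ^ 2 ^ 2 \<Rightarrow> 'b ^ 2 ^ 2" where "sc \<equiv> \<lambda>c. map_matrix (s' c)"

abbreviation \<tau> :: "'b ^ 2 ^ 2 \<Rightarrow> 'b ^ 2 ^ 2" where "\<tau> \<equiv> sigma_hat \<sigma>'"

abbreviation W0 :: "('b ^ 2 ^ 2) set" where "W0 \<equiv> range (map_matrix \<iota>)"

text \<open>With \<open>crd\<close> this is a dual pair: the multiples of the four matrix units by
  the image of the basis of \<open>A\<close> form a basis of the 2 by 2 matrices inside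
  \<open>W0\<close>.\<close>

definition el :: "2 \<times> 2 \<times> 'a \<Rightarrow> 'b ^ 2 ^ 2" where
  "el = (\<lambda>(i, j, b). \<chi> k l. if k = i \<and> l = j then \<iota> b else 0)"

definition crd :: "2 \<times> 2 \<times> 'a \<Rightarrow> 'b ^ 2 ^ 2 \<Rightarrow> 'f alg_closure" where
  "crd = (\<lambda>(i, j, b) M. cf (M $ i $ j) b)"

definition Ix :: "(2 \<times> 2 \<times> 'a) set" where "Ix = UNIV \<times> UNIV \<times> Bas"

lemma finite_Ix: "finite Ix" using Bas(1) by (simp add: Ix_def)

lemma vs_sc: "vector_space sc"
  by unfold_locales
    (simp_all add: Finite_Cartesian_Product.vec_eq_iff B.scale_right_distrib B.scale_left_distrib)

lemma crd_add: "crd p (M + M') = crd p M + crd p M'"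
  and crd_scale: "crd p (sc c M) = c * crd p M"
  by (cases p; simp add: crd_def cf_add cf_scale)+

lemma crd_el: "p \<in> Ix \<Longrightarrow> q \<in> Ix \<Longrightarrow> crd p (el q) = (if p = q then 1 else 0)"
  by (cases p; cases q) (auto simp: crd_def el_def Ix_def cf_basis cf_zero)

lemma sum_el: "(\<Sum>p\<in>Ix. sc (h p) (el p)) $ k $ l = (\<Sum>b\<in>Bas. s' (h (k, l, b)) (\<iota> b))"
proof -
  have "(\<Sum>p\<in>Ix. sc (h p) (el p)) $ k $ l = (\<Sum>p\<in>Ix. s' (h p) (el p $ k $ l))" by (simp add: sum_component)
  also have "\<dots> = (\<Sum>p\<in>(\<lambda>b. (k, l, b)) ` Bas. s' (h p) (el p $ k $ l))"
    using finite_Ix by (intro sum.mono_neutral_right) (auto simp: Ix_def el_def split: if_splits)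
  also have "\<dots> = (\<Sum>b\<in>Bas. s' (h (k, l, b)) (\<iota> b))"
    by (subst sum.reindex) (auto simp: inj_on_def el_def)
  finally show ?thesis .
qed

lemma crd_expand: "(\<Sum>p\<in>Ix. sc (crd p M) (el p)) = M"
proof -
  have "(\<Sum>p\<in>Ix. sc (crd p M) (el p)) $ k $ l = M $ k $ l" for k l
    by (subst sum_el) (simp add: crd_def cf_expand)
  then show ?thesis by (simp add: Finite_Cartesian_Product.vec_eq_iff)
qed

lemma basis_el: "is_basis sc (el ` Ix)" "inj_on el Ix"
  by (rule is_basis_dual_family[OF vs_sc finite_Ix crd_add crd_scale crd_el crd_expand[symmetric]]; assumption)+

lemma \<tau>_W0: assumes "M \<in> W0" shows "\<tau> M \<in> W0"
proof -
  obtain M' where M: "M = map_matrix \<iota> M'" using assms by auto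
  have "\<tau> M = map_matrix \<iota> (sigma_hat \<sigma> M')"
    by (rule matrix_2_eqI) (simp_all add: M sigma_hat_nth \<sigma>'_\<iota> \<iota>_uminus)
  then show ?thesis by simp
qed

lemma mult_W0: assumes "M \<in> W0" "M' \<in> W0" shows "M ** M' \<in> W0"
proof -
  obtain L L' where "M = map_matrix \<iota> L" "M' = map_matrix \<iota> L'" using assms by auto
  then have "M ** M' = map_matrix \<iota> (L ** L')"
    by (intro matrix_2_eqI) (simp_all add: matrix_mult_2 \<iota>)
  then show ?thesis by simp
qed

lemma map_matrix_one:
  "map_matrix \<iota> (Finite_Cartesian_Product.mat 1) = (Finite_Cartesian_Product.mat 1 :: 'b ^ 2 ^ 2)"
  by (rule matrix_2_eqI) (simp_all add: mat_1_nth \<iota> \<iota>_zero)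

lemma one_W0: "Finite_Cartesian_Product.mat 1 \<in> W0"
  using map_matrix_one by (metis rangeI)

lemma el_W0: "el p \<in> W0"
proof -
  obtain i j b where p: "p = (i, j, b)" by (cases p)
  have "el p = map_matrix \<iota> (\<chi> k l. if k = i \<and> l = j then b else 0)"
    by (simp add: p el_def Finite_Cartesian_Product.vec_eq_iff \<iota>_zero)
  then show ?thesis by simp
qed

lemma F_structure_W0: "F_structure sc W0"
  unfolding F_structure_def
proof (intro conjI exI[of _ "el ` Ix"])
  show "vector_space sc" by (rule vs_sc)
  then interpret W: vector_space sc .
  interpret WF: vector_space "\<lambda>c. sc (to_ac c)"
    by unfold_locales (simp_all add: Finite_Cartesian_Product.vec_eq_iff B.scale_right_distrib B.scale_left_distrib)
  show "W0 = WF.span (el ` Ix)"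
  proof
    show "W0 \<subseteq> WF.span (el ` Ix)"
    proof
      fix M assume "M \<in> W0"
      then obtain L where M: "M = map_matrix \<iota> L" by auto
      have "M = (\<Sum>p\<in>Ix. sc (crd p M) (el p))" by (simp only: crd_expand)
      also have "\<dots> = (\<Sum>p\<in>Ix. sc (to_ac (case p of (i, j, b) \<Rightarrow> A.representation Bas (L $ i $ j) b)) (el p))"
        by (intro sum.cong refl) (auto simp: Ix_def crd_def M cf_\<iota>)
      also have "\<dots> \<in> WF.span (el ` Ix)"
        by (intro WF.span_sum WF.span_scale WF.span_base imageI)
      finally show "M \<in> WF.span (el ` Ix)" .
    qed
    have "WF.subspace W0"
    proof (rule WF.subspaceI)
      have "0 = map_matrix \<iota> 0" by (simp add: Finite_Cartesian_Product.vec_eq_iff \<iota>_zero)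
      then show "0 \<in> W0" by (metis rangeI)
      fix x y c assume "x \<in> W0"
      then obtain L where L: "x = map_matrix \<iota> L" by auto
      have "sc (to_ac c) x = map_matrix \<iota> (map_matrix (s c) L)" by (simp add: Finite_Cartesian_Product.vec_eq_iff L \<iota>)
      then show "sc (to_ac c) x \<in> W0" by simp
      assume "y \<in> W0"
      then obtain L' where L': "y = map_matrix \<iota> L'" by auto
      have "x + y = map_matrix \<iota> (L + L')" by (simp add: Finite_Cartesian_Product.vec_eq_iff L L' \<iota>)
      then show "x + y \<in> W0" by simp
    qed
    then show "WF.span (el ` Ix) \<subseteq> W0" by (intro WF.span_minimal) (auto intro: el_W0)
  qed
qed (use finite_Ix basis_el in auto)

lemma
  assumes "l \<in> functionals sc"
  shows functional_sc_add: "l (x + y) = l x + l y"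
    and functional_sc_scale: "l (sc c x) = c * l x"
proof -
  have h: "module_hom sc (*) l" using assms by (simp add: functionals_def linear_iff_module_hom)
  show "l (x + y) = l x + l y" "l (sc c x) = c * l x"
    using module_hom.add[OF h, of x y] module_hom.scale[OF h, of c x] by simp_all
qed

lemma functional_sc_sum:
  assumes l: "l \<in> functionals sc"
  shows "l (\<Sum>i\<in>I. f i) = (\<Sum>i\<in>I. l (f i))"
proof -
  have "sc 0 0 = 0" by (simp add: Finite_Cartesian_Product.vec_eq_iff)
  then have "l 0 = 0" using functional_sc_scale[OF l, of 0 0] by simp
  then show ?thesis
    by (induction I rule: infinite_finite_induct) (simp_all add: functional_sc_add[OF l])
qed

lemma functional_sc_crd: "l \<in> functionals sc \<Longrightarrow> l M = (\<Sum>p\<in>Ix. crd p M * l (el p))"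
  using functional_sc_sum[of l "\<lambda>p. sc (crd p M) (el p)" Ix]
  by (simp only: crd_expand) (simp add: functional_sc_scale)

lemma functional_vsI:
  assumes "vector_space t" "\<And>x y. l (x + y) = l x + l y" "\<And>c x. l (t c x) = c * l x"
  shows "l \<in> functionals t"
proof -
  interpret vector_space t by fact
  show ?thesis unfolding functionals_def linear_iff_module_hom
    by (rule CollectI, unfold_locales) (simp_all add: assms algebra_simps)
qed

lemma crd_F: assumes "p \<in> Ix" shows "crd p \<in> F_functionals sc W0"
proof -
  have "crd p \<in> functionals sc" by (rule functional_vsI[OF vs_sc crd_add crd_scale])
  moreover have "crd p M \<in> range to_ac" if "M \<in> W0" for M
    using that assms by (cases p) (auto simp: crd_def Ix_def cf_\<iota>)
  ultimately show ?thesis unfolding F_functionals_def by auto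
qed

text \<open>By bilinearity \<open>l (M ** M')\<close> is a sum of products of coordinates with the
  constants \<open>l (el p ** el q)\<close>, which lie in \<open>F\<close> because \<open>W0\<close>
  is closed under products. The general \<open>F\<close> and \<open>G\<close> cover both
  \<open>x ** \<tau> x\<close> and the multiplication of pairs.\<close>

lemma F_functional_mult:
  assumes l: "l \<in> F_functionals sc W0"
    and F: "\<And>l. l \<in> F_functionals sc W0 \<Longrightarrow> (\<lambda>z. l (F z)) \<in> generated_functions (range to_ac) L"
    and G: "\<And>l. l \<in> F_functionals sc W0 \<Longrightarrow> (\<lambda>z. l (G z)) \<in> generated_functions (range to_ac) L"
  shows "(\<lambda>z. l (F z ** G z)) \<in> generated_functions (range to_ac) L"
proof -
  have lf: "l \<in> functionals sc" and lW: "\<And>M. M \<in> W0 \<Longrightarrow> l M \<in> range to_ac"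
    using l by (auto simp: F_functionals_def)
  have sc_mult: "sc c M ** M' = sc c (M ** M')" "M ** sc c M' = sc c (M ** M')" for c M M'
    by (rule matrix_2_eqI; simp add: matrix_mult_2 mul_s' B.scale_right_distrib)+
  have zero: "0 \<in> range to_ac" using to_ac_0 by (metis rangeI)
  have "l (M ** M') = (\<Sum>p\<in>Ix. crd p M * (\<Sum>q\<in>Ix. crd q M' * l (el p ** el q)))" for M M'
  proof -
    have 1: "(\<lambda>M. l (M ** M')) \<in> functionals sc"
      by (rule functional_vsI[OF vs_sc])
        (simp_all add: matrix_2_add_mult sc_mult functional_sc_add[OF lf] functional_sc_scale[OF lf])
    have 2: "(\<lambda>M'. l (el p ** M')) \<in> functionals sc" for p
      by (rule functional_vsI[OF vs_sc])
        (simp_all add: matrix_add_ldistrib sc_mult functional_sc_add[OF lf] functional_sc_scale[OF lf])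
    show ?thesis unfolding functional_sc_crd[OF 1, of M] functional_sc_crd[OF 2, of _ M'] ..
  qed
  then have "(\<lambda>z. l (F z ** G z)) = (\<lambda>z. \<Sum>p\<in>Ix. crd p (F z) * (\<Sum>q\<in>Ix. crd q (G z) * l (el p ** el q)))"
    by (intro HOL.ext)
  moreover have "(\<lambda>z. \<Sum>p\<in>Ix. crd p (F z) * (\<Sum>q\<in>Ix. crd q (G z) * l (el p ** el q))) \<in> generated_functions (range to_ac) L"
  proof (rule generated_functions_sum[OF zero], rule generated_functions.mult)
    fix p assume "p \<in> Ix"
    then show "(\<lambda>z. crd p (F z)) \<in> generated_functions (range to_ac) L" by (rule F[OF crd_F])
    show "(\<lambda>z. \<Sum>q\<in>Ix. crd q (G z) * l (el p ** el q)) \<in> generated_functions (range to_ac) L"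
    proof (rule generated_functions_sum[OF zero], rule generated_functions.mult)
      fix q assume "q \<in> Ix"
      then show "(\<lambda>z. crd q (G z)) \<in> generated_functions (range to_ac) L" by (rule G[OF crd_F])
      show "(\<lambda>_. l (el p ** el q)) \<in> generated_functions (range to_ac) L"
        by (rule generated_functions.const[OF lW[OF mult_W0[OF el_W0 el_W0]]])
    qed
  qed
  ultimately show ?thesis by (simp only:)
qed

lemma \<tau>_add: "\<tau> (M + M') = \<tau> M + \<tau> M'"
  and \<tau>_scale: "\<tau> (sc c M) = sc c (\<tau> M)"
  and \<tau>_mult: "\<tau> (M ** M') = \<tau> M' ** \<tau> M"
  and \<tau>_\<tau>: "\<tau> (\<tau> M) = M"
  by (rule matrix_2_eqI; simp add: sigma_hat_nth matrix_mult_2 \<sigma>'_add \<sigma>'_scale \<sigma>'_mult \<sigma>'_\<sigma>' \<sigma>'_uminus)+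

lemma F_functional_\<tau>: assumes "l \<in> F_functionals sc W0" shows "(\<lambda>M. l (\<tau> M)) \<in> F_functionals sc W0"
proof -
  have lf: "l \<in> functionals sc" and lW: "\<And>M. M \<in> W0 \<Longrightarrow> l M \<in> range to_ac"
    using assms by (auto simp: F_functionals_def)
  have "(\<lambda>M. l (\<tau> M)) \<in> functionals sc"
    by (rule functional_vsI[OF vs_sc]) (simp_all add: \<tau>_add \<tau>_scale functional_sc_add[OF lf] functional_sc_scale[OF lf])
  then show ?thesis using lW \<tau>_W0 unfolding F_functionals_def by blast
qed

text \<open>\<open>W0\<close> is the algebra of 2 by 2 matrices over \<open>A\<close> inside its
  scalar extension, so the middle clause identifies \<open>SL2 \<sigma>\<close> with the
  \<open>F\<close>-rational points of the algebraic group.\<close>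

lemma main:
  "linear_algebraic_group sc W0 (SL2_group \<sigma>') \<and>
    map_matrix \<iota> ` SL2 \<sigma> = SL2 \<sigma>' \<inter> W0 \<and>
    (is_symplectic_group s' (2 * n) (SL2 \<sigma>') \<and> zariski_dim sc (SL2 \<sigma>') = enat (2 * n\<^sup>2 + n) \<or>
     is_orthogonal_group s' (2 * n) (SL2 \<sigma>') \<and> zariski_dim sc (SL2 \<sigma>') = enat (2 * n\<^sup>2 - n))"
proof -
  from exists_splitting obtain \<phi> where \<phi>: "bij_betw \<phi> (UNIV :: 'b set) (carrier_mat n n)" "\<phi> 1 = 1\<^sub>m n"
    "\<forall>x y. \<phi> (x + y) = \<phi> x + \<phi> y" "\<forall>x y. \<phi> (x * y) = \<phi> x * \<phi> y" "\<forall>c x. \<phi> (s' c x) = c \<cdot>\<^sub>m \<phi> x"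
    by (elim exE conjE)
  have \<phi>c: "\<phi> x \<in> carrier_mat n n" for x using \<phi>(1) by (auto simp: bij_betw_def)
  have \<phi>_inj: "\<phi> x = \<phi> y \<longleftrightarrow> x = y" for x y using \<phi>(1) by (auto simp: bij_betw_def inj_on_def)
  have \<phi>0: "\<phi> 0 = 0\<^sub>m n n"
  proof -
    have "0 \<cdot>\<^sub>m \<phi> 0 = 0\<^sub>m n n" by (rule eq_matI) (use \<phi>c[of 0] in auto)
    then show ?thesis using spec[OF spec[OF \<phi>(5), of 0], of 0] by simp
  qed
  \<comment> \<open>A 2 by 2 matrix of matrices of size \<open>n\<close> is read as one block matrix
    of size \<open>2 * n\<close>.\<close>
  define \<Phi> where "\<Phi> M = four_block_mat (\<phi> (M $ 1 $ 1)) (\<phi> (M $ 1 $ 2)) (\<phi> (M $ 2 $ 1)) (\<phi> (M $ 2 $ 2))" for M :: "'b ^ 2 ^ 2"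
  have surj\<Phi>: "Z \<in> range \<Phi>" if Z: "Z \<in> carrier_mat (2 * n) (2 * n)" for Z
  proof -
    obtain Z1 Z2 Z3 Z4 where sp: "split_block Z n n = (Z1, Z2, Z3, Z4)" by (cases "split_block Z n n") auto
    have dims: "dim_row Z = n + n" "dim_col Z = n + n" using Z by auto
    note blocks = split_block[OF sp dims]
    have surj: "\<exists>x. \<phi> x = Y" if "Y \<in> carrier_mat n n" for Y
    proof -
      have "Y \<in> range \<phi>" using \<phi>(1) that by (simp add: bij_betw_def)
      then show ?thesis by auto
    qed
    from surj[OF blocks(1)] obtain x1 where x1: "\<phi> x1 = Z1" ..
    from surj[OF blocks(2)] obtain x2 where x2: "\<phi> x2 = Z2" ..
    from surj[OF blocks(3)] obtain x3 where x3: "\<phi> x3 = Z3" ..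
    from surj[OF blocks(4)] obtain x4 where x4: "\<phi> x4 = Z4" ..
    note x1 x2 x3 x4
    then have "\<Phi> (vector [vector [x1, x2], vector [x3, x4]]) = Z"
      using blocks(5) by (simp add: \<Phi>_def)
    then show ?thesis by (metis rangeI)
  qed
  have \<Phi>_bij: "bij_betw \<Phi> UNIV (carrier_mat (2 * n) (2 * n))"
    unfolding bij_betw_def
  proof
    show "inj \<Phi>"
    proof (rule injI)
      fix M M' :: "'b ^ 2 ^ 2"
      assume eq: "\<Phi> M = \<Phi> M'"
      have "M $ 1 $ 1 = M' $ 1 $ 1 \<and> M $ 1 $ 2 = M' $ 1 $ 2 \<and> M $ 2 $ 1 = M' $ 2 $ 1 \<and> M $ 2 $ 2 = M' $ 2 $ 2"
        using four_block_mat_eqD[OF \<phi>c \<phi>c \<phi>c \<phi>c \<phi>c \<phi>c \<phi>c \<phi>c eq[unfolded \<Phi>_def]]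
        by (simp only: \<phi>_inj)
      then show "M = M'" by (intro matrix_2_eqI) simp_all
    qed
    have "\<Phi> M \<in> carrier_mat (2 * n) (2 * n)" for M
      unfolding \<Phi>_def mult_2 by (rule four_block_carrier_mat[OF \<phi>c \<phi>c])
    then show "range \<Phi> = carrier_mat (2 * n) (2 * n)" using surj\<Phi> by (intro equalityI subsetI) auto
  qed
  have \<Phi>_one: "\<Phi> (Finite_Cartesian_Product.mat 1) = 1\<^sub>m (2 * n)"
    by (simp add: \<Phi>_def mat_1_nth \<phi>(2) \<phi>0 mult_2)
  have \<Phi>_add: "\<Phi> (M + M') = \<Phi> M + \<Phi> M'" for M M'
    unfolding \<Phi>_def add_four_block_mat[OF \<phi>c \<phi>c \<phi>c \<phi>c \<phi>c \<phi>c \<phi>c \<phi>c] by (simp add: \<phi>(3))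
  have \<Phi>_mult: "\<Phi> (M ** M') = \<Phi> M * \<Phi> M'" for M M'
    unfolding \<Phi>_def mult_four_block_mat[OF \<phi>c \<phi>c \<phi>c \<phi>c \<phi>c \<phi>c \<phi>c \<phi>c]
    by (simp add: matrix_mult_2 \<phi>(3,4))
  have \<Phi>_scale: "\<Phi> (sc c M) = c \<cdot>\<^sub>m \<Phi> M" for c M
    unfolding \<Phi>_def smult_four_block_mat[OF \<phi>c \<phi>c \<phi>c \<phi>c] by (simp add: \<phi>(5))
  have two: "(2 :: 'f alg_closure) \<noteq> 0"
    using two_neq_zero_CHAR[OF char] to_ac_eq_0_iff[of "2 :: 'f"] by simp
  interpret W: vector_space sc by (rule vs_sc)
  have W: "matrix_algebra sc (**) (Finite_Cartesian_Product.mat 1) \<Phi> (2 * n) \<tau> (el ` Ix)"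
  proof unfold_locales
    show "sc c x ** y = sc c (x ** y)" "x ** sc c y = sc c (x ** y)" for c x y
      by (rule matrix_2_eqI; simp add: matrix_mult_2 mul_s' B.scale_right_distrib)+
  qed (simp_all add: matrix_mul_assoc matrix_add_ldistrib matrix_2_add_mult \<Phi>_bij \<Phi>_one \<Phi>_add \<Phi>_mult
      \<Phi>_scale \<tau>_add \<tau>_scale \<tau>_mult \<tau>_\<tau> finite_Ix basis_el two)
  then interpret M: matrix_algebra sc "(**)" "Finite_Cartesian_Product.mat 1" \<Phi> "2 * n" \<tau> "el ` Ix" .
  have V: "M.V = SL2 \<sigma>'" by (simp add: M.V_def SL2_def)
  have iso: "matrix_algebra_iso s' (2 * n) \<Phi>"
    using \<Phi>_bij \<Phi>_one \<Phi>_add \<Phi>_mult \<Phi>_scale by (simp add: matrix_algebra_iso_def)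
  from M.form_of_involution[OF refl n_pos] obtain b where b: "bilinear_form (2 * n) b" "nondegenerate_form (2 * n) b"
    "\<Phi> ` SL2 \<sigma>' = isometry_group (2 * n) b"
    "alternating_form (2 * n) b \<and> zariski_dim sc (SL2 \<sigma>') = enat (2 * n\<^sup>2 + n) \<or>
     symmetric_form (2 * n) b \<and> zariski_dim sc (SL2 \<sigma>') = enat (2 * n\<^sup>2 - n)"
    unfolding V by (elim exE conjE)
  have 3: "is_symplectic_group s' (2 * n) (SL2 \<sigma>') \<and> zariski_dim sc (SL2 \<sigma>') = enat (2 * n\<^sup>2 + n) \<or>
     is_orthogonal_group s' (2 * n) (SL2 \<sigma>') \<and> zariski_dim sc (SL2 \<sigma>') = enat (2 * n\<^sup>2 - n)"
    using b(4)
  proof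
    assume *: "alternating_form (2 * n) b \<and> zariski_dim sc (SL2 \<sigma>') = enat (2 * n\<^sup>2 + n)"
    have "is_symplectic_group s' (2 * n) (SL2 \<sigma>')" unfolding is_symplectic_group_def
      by (intro exI[of _ \<Phi>] exI[of _ b] conjI iso b(1-3)) (use * in simp)
    then show ?thesis using * by simp
  next
    assume *: "symmetric_form (2 * n) b \<and> zariski_dim sc (SL2 \<sigma>') = enat (2 * n\<^sup>2 - n)"
    have "is_orthogonal_group s' (2 * n) (SL2 \<sigma>')" unfolding is_orthogonal_group_def
      by (intro exI[of _ \<Phi>] exI[of _ b] conjI iso b(1-3)) (use * in simp)
    then show ?thesis using * by simp
  qed
  have "map_matrix \<iota> M \<in> SL2 \<sigma>' \<longleftrightarrow> M \<in> SL2 \<sigma>" for M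
  proof -
    have inj: "map_matrix \<iota> M = map_matrix \<iota> M' \<longleftrightarrow> M = M'" for M M' :: "'a ^ 2 ^ 2"
      using inj_\<iota> by (auto simp: Finite_Cartesian_Product.vec_eq_iff inj_def)
    have "map_matrix \<iota> M ** \<tau> (map_matrix \<iota> M) = map_matrix \<iota> (M ** sigma_hat \<sigma> M)"
      by (rule matrix_2_eqI) (simp_all add: matrix_mult_2 sigma_hat_nth \<sigma>'_\<iota> \<iota> \<iota>_uminus \<iota>_minus)
    then have "map_matrix \<iota> M \<in> SL2 \<sigma>' \<longleftrightarrow>
        map_matrix \<iota> (M ** sigma_hat \<sigma> M) = map_matrix \<iota> (Finite_Cartesian_Product.mat 1)"
      by (simp add: SL2_def map_matrix_one)
    then show ?thesis unfolding inj by (simp add: SL2_def)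
  qed
  note mem = this
  have 2: "map_matrix \<iota> ` SL2 \<sigma> = SL2 \<sigma>' \<inter> W0"
  proof (intro equalityI subsetI IntI)
    fix x assume "x \<in> map_matrix \<iota> ` SL2 \<sigma>"
    then obtain M where "x = map_matrix \<iota> M" "M \<in> SL2 \<sigma>" by (elim imageE)
    then show "x \<in> SL2 \<sigma>'" "x \<in> W0" by (simp_all only: mem rangeI)
  next
    fix x assume *: "x \<in> SL2 \<sigma>' \<inter> W0"
    then obtain M where M: "x = map_matrix \<iota> M" by (elim IntE imageE)
    with * have "M \<in> SL2 \<sigma>" by (simp only: mem Int_iff)
    then show "x \<in> map_matrix \<iota> ` SL2 \<sigma>" unfolding M by (rule imageI)
  qed
  have group: "group (SL2_group \<sigma>')"
  proof (rule groupI)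
    show "x \<otimes>\<^bsub>SL2_group \<sigma>'\<^esub> y \<in> carrier (SL2_group \<sigma>')"
      if "x \<in> carrier (SL2_group \<sigma>')" "y \<in> carrier (SL2_group \<sigma>')" for x y
      using that M.V_mul by (simp add: SL2_group_def V)
    show "\<one>\<^bsub>SL2_group \<sigma>'\<^esub> \<in> carrier (SL2_group \<sigma>')"
      using M.\<tau>_one by (simp add: SL2_group_def SL2_def)
    show "\<exists>y\<in>carrier (SL2_group \<sigma>'). y \<otimes>\<^bsub>SL2_group \<sigma>'\<^esub> x = \<one>\<^bsub>SL2_group \<sigma>'\<^esub>"
      if "x \<in> carrier (SL2_group \<sigma>')" for x
      using that M.V_\<tau>[of x] M.V_sym[of x] by (intro bexI[of _ "\<tau> x"]) (simp_all add: SL2_group_def V)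
  qed (simp_all add: SL2_group_def matrix_mul_assoc)
  \<comment> \<open>Inversion is the restriction to the group of the linear map
    \<open>\<tau>\<close>, which preserves \<open>W0\<close>; hence it is a morphism over
    \<open>F\<close>.\<close>
  have inv_eq: "inv\<^bsub>SL2_group \<sigma>'\<^esub> x = \<tau> x" if "x \<in> SL2 \<sigma>'" for x
    by (rule group.inv_equality[OF group])
      (use that M.V_\<tau>[of x] M.V_sym[of x] in \<open>simp_all add: SL2_group_def V\<close>)
  have equation_F: "(\<lambda>x. crd p (x ** \<tau> x - Finite_Cartesian_Product.mat 1)) \<in> F_polynomials sc W0" if p: "p \<in> Ix" for p
  proof -
    have cp: "crd p \<in> F_functionals sc W0" by (rule crd_F[OF p])
    have "(\<lambda>x. crd p (x ** \<tau> x)) \<in> F_polynomials sc W0"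
      unfolding F_polynomials_def
      by (rule F_functional_mult[OF cp]) (auto intro: generated_functions.functional F_functional_\<tau>)
    moreover have "crd p (Finite_Cartesian_Product.mat 1) \<in> range to_ac"
      using cp one_W0 unfolding F_functionals_def by blast
    then have "(\<lambda>_. - crd p (Finite_Cartesian_Product.mat 1)) \<in> F_polynomials sc W0"
      unfolding F_polynomials_def
      by (intro generated_functions.const) (auto simp: to_ac_minus[symmetric] simp del: to_ac_minus)
    ultimately have "(\<lambda>x. crd p (x ** \<tau> x) + - crd p (Finite_Cartesian_Product.mat 1)) \<in> F_polynomials sc W0"
      unfolding F_polynomials_def by (rule generated_functions.add)
    moreover have "crd p \<in> functionals sc" using cp by (simp add: F_functionals_def)
    ultimately show ?thesis by (simp add: M.functional_diff)
  qed
  have defined: "defined_over_F sc W0 (SL2 \<sigma>')"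
    unfolding defined_over_F_def
  proof (intro ballI impI)
    fix f assume f: "f \<in> polynomials sc" "\<forall>x\<in>SL2 \<sigma>'. f x = 0"
    then have "f \<in> M.equations" by (intro M.vanishing_ideal_V) (simp_all add: V)
    \<comment> \<open>The generators are reduced to the coordinates \<open>crd p\<close>, which are
      defined over \<open>F\<close>: a general functional \<open>l\<close> is a combination of them
      with constants \<open>l (el p)\<close>, and these are absorbed into the polynomial
      coefficients.\<close>
    then have "\<exists>h. (\<forall>p. h p \<in> polynomials sc) \<and>
      f = (\<lambda>x. \<Sum>p\<in>Ix. h p x * crd p (x ** \<tau> x - Finite_Cartesian_Product.mat 1))"
      unfolding M.equations_def
    proof (induction rule: generated_ideal.induct)
      case gi_zero
      show ?case by (rule exI[of _ "\<lambda>_ _. 0"]) (simp add: PW.const)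
    next
      case (gi_base r q)
      from gi_base(2) obtain l where l: "q = (\<lambda>x. l (x ** \<tau> x - Finite_Cartesian_Product.mat 1))" "l \<in> functionals sc"
        by (elim CollectE exE conjE)
      have "(\<lambda>x. r x * q x) = (\<lambda>x. \<Sum>p\<in>Ix. (r x * l (el p)) * crd p (x ** \<tau> x - Finite_Cartesian_Product.mat 1))"
        unfolding l(1) by (subst functional_sc_crd[OF l(2)]) (simp add: sum_distrib_left mult_ac)
      moreover have "\<forall>p. (\<lambda>x. r x * l (el p)) \<in> polynomials sc" by (intro allI PW.mult PW.const gi_base(1))
      ultimately show ?case by (intro exI[of _ "\<lambda>p x. r x * l (el p)"] conjI)
    next
      case (gi_add q q')
      from gi_add(3) obtain h where h: "\<forall>p. h p \<in> polynomials sc"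
        "q = (\<lambda>x. \<Sum>p\<in>Ix. h p x * crd p (x ** \<tau> x - Finite_Cartesian_Product.mat 1))" by (elim exE conjE)
      from gi_add(4) obtain h' where h': "\<forall>p. h' p \<in> polynomials sc"
        "q' = (\<lambda>x. \<Sum>p\<in>Ix. h' p x * crd p (x ** \<tau> x - Finite_Cartesian_Product.mat 1))" by (elim exE conjE)
      show ?case
        by (intro exI[of _ "\<lambda>p x. h p x + h' p x"] conjI allI PW.add)
          (simp_all add: h h' distrib_right sum.distrib)
    qed
    then obtain h where h: "\<forall>p. h p \<in> polynomials sc"
      "f = (\<lambda>x. \<Sum>p\<in>Ix. h p x * crd p (x ** \<tau> x - Finite_Cartesian_Product.mat 1))" by (elim exE conjE)
    obtain k where k: "bij_betw k {0..<card Ix} Ix" using ex_bij_betw_nat_finite[OF finite_Ix] ..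
    have kI: "i < card Ix \<Longrightarrow> k i \<in> Ix" for i using k by (auto simp: bij_betw_def)
    have crd0: "crd p 0 = 0" for p using crd_add[of p 0 0] by (metis add_0_right add_cancel_right_right)
    define g where "g i x = crd (k i) (x ** \<tau> x - Finite_Cartesian_Product.mat 1)" for i x
    have "g i \<in> F_polynomials sc W0" if "i < card Ix" for i
      unfolding g_def by (rule equation_F[OF kI[OF that]])
    moreover have "g i x = 0" if "x \<in> SL2 \<sigma>'" for i x
    proof -
      have "x ** \<tau> x = Finite_Cartesian_Product.mat 1" using that by (simp add: SL2_def)
      then show ?thesis by (simp only: g_def diff_self crd0)
    qed
    ultimately have g: "\<forall>i<card Ix. h (k i) \<in> polynomials sc \<and> g i \<in> F_polynomials sc W0 \<and> (\<forall>x\<in>SL2 \<sigma>'. g i x = 0)"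
      by (intro allI impI conjI ballI h(1)[rule_format])
    have "f = (\<lambda>x. \<Sum>i<card Ix. h (k i) x * g i x)"
      unfolding h(2) g_def
    proof
      fix x
      show "(\<Sum>p\<in>Ix. h p x * crd p (x ** \<tau> x - Finite_Cartesian_Product.mat 1)) =
        (\<Sum>i<card Ix. h (k i) x * crd (k i) (x ** \<tau> x - Finite_Cartesian_Product.mat 1))"
        using sum.reindex_bij_betw[OF k, of "\<lambda>p. h p x * crd p (x ** \<tau> x - Finite_Cartesian_Product.mat 1)"]
        by (simp add: atLeast0LessThan)
    qed
    with g have "(\<forall>i<card Ix. h (k i) \<in> polynomials sc \<and> g i \<in> F_polynomials sc W0 \<and> (\<forall>x\<in>SL2 \<sigma>'. g i x = 0)) \<and>
      f = (\<lambda>x. \<Sum>i<card Ix. h (k i) x * g i x)" ..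
    then show "\<exists>(m::nat) h g. (\<forall>i<m. h i \<in> polynomials sc \<and> g i \<in> F_polynomials sc W0 \<and> (\<forall>x\<in>SL2 \<sigma>'. g i x = 0)) \<and>
      f = (\<lambda>x. \<Sum>i<m. h i x * g i x)"
      by - (rule exI[of _ "card Ix"], rule exI[of _ "\<lambda>i. h (k i)"], rule exI[of _ g])
  qed
  have mult_F: "\<exists>p\<in>F_polynomials (\<lambda>c (x, y). (sc c x, sc c y)) (W0 \<times> W0).
      \<forall>x\<in>SL2 \<sigma>'. \<forall>y\<in>SL2 \<sigma>'. l (x ** y) = p (x, y)" if l: "l \<in> F_functionals sc W0" for l
  proof (rule bexI[of _ "\<lambda>z. l (fst z ** snd z)"])
    have vs2: "vector_space (\<lambda>c (x, y). (sc c x, sc c y))"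
      by unfold_locales
        (auto simp: W.scale_right_distrib W.scale_left_distrib split: prod.splits)
    have fs: "(\<lambda>z. l (fst z)) \<in> F_functionals (\<lambda>c (x, y). (sc c x, sc c y)) (W0 \<times> W0)"
      "(\<lambda>z. l (snd z)) \<in> F_functionals (\<lambda>c (x, y). (sc c x, sc c y)) (W0 \<times> W0)"
      if l: "l \<in> F_functionals sc W0" for l
    proof -
      have lf: "l \<in> functionals sc" and lW: "\<And>M. M \<in> W0 \<Longrightarrow> l M \<in> range to_ac"
        using l by (auto simp: F_functionals_def)
      have "(\<lambda>z. l (fst z)) \<in> functionals (\<lambda>c (x, y). (sc c x, sc c y))"
        "(\<lambda>z. l (snd z)) \<in> functionals (\<lambda>c (x, y). (sc c x, sc c y))"
        by (rule functional_vsI[OF vs2]; auto simp: functional_sc_add[OF lf] functional_sc_scale[OF lf])+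
      then show "(\<lambda>z. l (fst z)) \<in> F_functionals (\<lambda>c (x, y). (sc c x, sc c y)) (W0 \<times> W0)"
        "(\<lambda>z. l (snd z)) \<in> F_functionals (\<lambda>c (x, y). (sc c x, sc c y)) (W0 \<times> W0)"
        using lW unfolding F_functionals_def by auto
    qed
    show "(\<lambda>z. l (fst z ** snd z)) \<in> F_polynomials (\<lambda>c (x, y). (sc c x, sc c y)) (W0 \<times> W0)"
      unfolding F_polynomials_def
      by (rule F_functional_mult[OF l]) (auto intro: generated_functions.functional fs)
  qed simp
  have inv_F: "\<exists>p\<in>F_polynomials sc W0. \<forall>x\<in>SL2 \<sigma>'. l (inv\<^bsub>SL2_group \<sigma>'\<^esub> x) = p x"
    if l: "l \<in> F_functionals sc W0" for l
    by (rule bexI[of _ "\<lambda>x. l (\<tau> x)"])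
      (simp_all add: inv_eq F_polynomials_def generated_functions.functional[OF F_functional_\<tau>[OF l]])
  have ops: "carrier (SL2_group \<sigma>') = SL2 \<sigma>'" "\<one>\<^bsub>SL2_group \<sigma>'\<^esub> = Finite_Cartesian_Product.mat 1"
    "x \<otimes>\<^bsub>SL2_group \<sigma>'\<^esub> y = x ** y" for x y by (simp_all add: SL2_group_def)
  have 1: "linear_algebraic_group sc W0 (SL2_group \<sigma>')"
    unfolding linear_algebraic_group_def ops
  proof (intro conjI ballI)
    show "F_structure sc W0" by (rule F_structure_W0)
    show "group (SL2_group \<sigma>')" by (rule group)
    show "zariski_closed sc (SL2 \<sigma>')" using M.zariski_closed_V unfolding V .
    show "defined_over_F sc W0 (SL2 \<sigma>')" by (rule defined)
    show "Finite_Cartesian_Product.mat 1 \<in> W0" by (rule one_W0)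
  qed (erule mult_F inv_F)+
  show ?thesis by (intro conjI 1 2 3)
qed

end

theorem theorem1p1:
  fixes s :: "'f::field \<Rightarrow> 'a::ring_1 \<Rightarrow> 'a"
    and \<sigma> :: "'a \<Rightarrow> 'a"
    and n :: nat
    and s' :: "'f alg_closure \<Rightarrow> 'b::ring_1 \<Rightarrow> 'b"
    and \<iota> :: "'a \<Rightarrow> 'b"
    and \<sigma>' :: "'b \<Rightarrow> 'b"
  assumes "CHAR('f) \<noteq> 2"
    and "central_simple_algebra s"
    and "vector_space.dim s (UNIV :: 'a set) = n\<^sup>2"
    and "ring_involution \<sigma>" and "Vector_Spaces.linear s s \<sigma>"
    and "scalar_extension s s' \<iota>"
    and "Vector_Spaces.linear s' s' \<sigma>'" and "\<And>a. \<sigma>' (\<iota> a) = \<iota> (\<sigma> a)"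
  shows "linear_algebraic_group (\<lambda>c. map_matrix (s' c)) (range (map_matrix \<iota>)) (SL2_group \<sigma>') \<and>
    map_matrix \<iota> ` SL2 \<sigma> = SL2 \<sigma>' \<inter> range (map_matrix \<iota>) \<and>
    (is_symplectic_group s' (2 * n) (SL2 \<sigma>') \<and>
       zariski_dim (\<lambda>c. map_matrix (s' c)) (SL2 \<sigma>') = enat (2 * n\<^sup>2 + n) \<or>
     is_orthogonal_group s' (2 * n) (SL2 \<sigma>') \<and>
       zariski_dim (\<lambda>c. map_matrix (s' c)) (SL2 \<sigma>') = enat (2 * n\<^sup>2 - n))"
proof -
  have "involution_extension s \<sigma> n s' \<iota> \<sigma>'"
    by (rule involution_extension.intro[OF assms])
  then show ?thesis by (rule involution_extension.main)
qed

end
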